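(* Let $X$ be a smooth projective toric variety. Every equivariant vector bundle $\mathcal{F}$ on $X$ admits a canonical metric; that is, there exists a finite resolution $E_\bullet\to\mathcal{F}$ by vector bundles which are direct sums of line bundles, so that $\mathcal{F}$ together with this resolution, each term being equipped with the orthogonal direct sum of the canonical metrics of its line bundle summands, is a metrized coherent sheaf whose metric is canonical.
   Context: A metrized coherent sheaf on $X$ is a pair $\overline{\mathcal{F}}=(\mathcal{F},\overline{E}_\bullet\to\mathcal{F})$ where $\mathcal{F}$ is a coherent sheaf and $\overline{E}_\bullet\to\mathcal{F}$ is a finite resolution of $\mathcal{F}$ by hermitian vector bundles (the metrics being allowed to be only continuous of the type below). On a smooth toric variety, the metric of $\mathcal{F}$ is called canonical if each term of $\overline{E}_\bullet$ is an orthogonal direct sum of line bundles endowed with their canonical metrics. Canonical metric of a line bundle: let $X$ be a smooth projective toric variety with torus $T$ and fan in $N_{\mathbb{R}}$. Every line bundle $L$ on $X$ is isomorphic to $\mathcal{O}(D)$ for a $T$-invariant divisor $D=\sum_\rho a_\rho D_\rho$. Let $\psi_D$ be the function on $N_{\mathbb{R}}$, linear on each cone of the fan, with $\psi_D(u_\rho)=-a_\rho$ for the primitive generator $u_\rho$ of each ray $\rho$. The canonical metric on $\mathcal{O}(D)$ is the unique continuous metric with $\|s_D(t)\|=\exp\bigl(\psi_D(-\log|t|)\bigr)$ for $t\in T(\mathbb{C})$, where $s_D$ is the canonical rational section of $\mathcal{O}(D)$ with divisor $D$ and $-\log|t|\in N_{\mathbb{R}}$ is the image of $t$ under $-\log|\cdot|$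 coordinatewise. The canonical metric of $L$ is its pullback under an isomorphism $L\cong\mathcal{O}(D)$ (taken over the standard model of $X$ over $\mathrm{Spec}(\mathbb{Z})$, in which case it is independent of the choices of $D$ and of the isomorphism). *)

theory Defs
  imports
    "HOL-Analysis.Analysis"
    "HOL-Library.Poly_Mapping"
    "HOL-Algebra.Module"
    "HOL-Algebra.Algebraic_Closure_Type"
begin

section \<open>Fans\<close>

text \<open>
  The cocharacter lattice \<open>N\<close> and the character lattice \<open>M\<close> of the torus are both \<open>int ^ 'n\<close>,
  in duality through the dot product; \<open>N\<^sub>\<real>\<close> is \<open>real ^ 'n\<close>.
\<close>

definition real_vec :: "int ^ 'n \<Rightarrow> real ^ 'n" where
  "real_vec m = (\<chi> i. of_int (m $ i))"

definition pairing :: "int ^ 'n::finite \<Rightarrow> real ^ 'n \<Rightarrow> real" where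
  "pairing m v = real_vec m \<bullet> v"

definition fan :: "(real ^ 'n::finite) set set \<Rightarrow> bool" where
  "fan \<Sigma> \<longleftrightarrow> finite \<Sigma> \<and> \<Sigma> \<noteq> {} \<and>
    (\<forall>\<sigma>\<in>\<Sigma>. (\<exists>B. finite B \<and> \<sigma> = convex_cone hull (real_vec ` B)) \<and> \<sigma> \<inter> uminus ` \<sigma> = {0}) \<and>
    (\<forall>\<sigma>\<in>\<Sigma>. \<forall>\<tau>. \<tau> face_of \<sigma> \<and> \<tau> \<noteq> {} \<longrightarrow> \<tau> \<in> \<Sigma>) \<and>
    (\<forall>\<sigma>\<in>\<Sigma>. \<forall>\<tau>\<in>\<Sigma>. (\<sigma> \<inter> \<tau>) face_of \<sigma> \<and> (\<sigma> \<inter> \<tau>) face_of \<tau>)"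

definition lattice_basis :: "('n::finite \<Rightarrow> int ^ 'n) \<Rightarrow> bool" where
  "lattice_basis b \<longleftrightarrow> (\<forall>u. \<exists>!c :: 'n \<Rightarrow> int. u = (\<Sum>i\<in>UNIV. c i *s b i))"

text \<open>\<open>X\<close> is smooth iff each cone is generated by part of a basis of \<open>N\<close>.\<close>

definition smooth_fan :: "(real ^ 'n::finite) set set \<Rightarrow> bool" where
  "smooth_fan \<Sigma> \<longleftrightarrow> fan \<Sigma> \<and>
    (\<forall>\<sigma>\<in>\<Sigma>. \<exists>b I. lattice_basis b \<and> \<sigma> = convex_cone hull (real_vec ` b ` I))"

definition primitive :: "int ^ 'n::finite \<Rightarrow> bool" where
  "primitive u \<longleftrightarrow> u \<noteq> 0 \<and> (\<forall>k w. u = k *s w \<longrightarrow> \<bar>k\<bar> = 1)"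

definition ray_gens :: "(real ^ 'n::finite) set \<Rightarrow> (int ^ 'n) set" where
  "ray_gens \<sigma> = {u. primitive u \<and> (convex_cone hull {real_vec u}) face_of \<sigma>}"

text \<open>
  A \<open>T\<close>-invariant divisor \<open>D = \<Sum> a\<^sub>\<rho> D\<^sub>\<rho>\<close> is a function \<open>D\<close> with \<open>D u\<^sub>\<rho> = a\<^sub>\<rho>\<close>; its values at other
  lattice vectors play no role.
\<close>

type_synonym 'n divisor = "int ^ 'n \<Rightarrow> int"

definition is_support_function ::
  "(real ^ 'n::finite) set set \<Rightarrow> 'n divisor \<Rightarrow> (real ^ 'n \<Rightarrow> real) \<Rightarrow> bool" where
  "is_support_function \<Sigma> D \<psi> \<longleftrightarrow>
    (\<forall>\<sigma>\<in>\<Sigma>. (\<exists>l. linear l \<and> (\<forall>v\<in>\<sigma>. \<psi> v = l v)) \<and>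
      (\<forall>u\<in>ray_gens \<sigma>. \<psi> (real_vec u) = - real_of_int (D u)))"

text \<open>Existence and uniqueness hold on a smooth complete fan.\<close>

definition support_function ::
  "(real ^ 'n::finite) set set \<Rightarrow> 'n divisor \<Rightarrow> real ^ 'n \<Rightarrow> real" where
  "support_function \<Sigma> D = (THE \<psi>. is_support_function \<Sigma> D \<psi>)"

text \<open>
  \<open>X\<close> is projective iff it is complete and carries an ample \<open>T\<close>-invariant divisor.
  With the sign \<open>\<psi>\<^sub>D(u\<^sub>\<rho>) = -a\<^sub>\<rho>\<close>, the divisor \<open>D\<close> is ample iff \<open>\<psi>\<^sub>D\<close> is strictly concave on a
  complete fan: on each full-dimensional cone it is given by a character whose values strictly
  exceed \<open>\<psi>\<^sub>D\<close> off that cone.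
\<close>

definition complete_fan :: "(real ^ 'n::finite) set set \<Rightarrow> bool" where
  "complete_fan \<Sigma> \<longleftrightarrow> fan \<Sigma> \<and> \<Union>\<Sigma> = UNIV"

definition ample :: "(real ^ 'n::finite) set set \<Rightarrow> 'n divisor \<Rightarrow> bool" where
  "ample \<Sigma> D \<longleftrightarrow> (\<exists>\<psi>. is_support_function \<Sigma> D \<psi> \<and>
    (\<forall>\<sigma>\<in>\<Sigma>. interior \<sigma> \<noteq> {} \<longrightarrow>
      (\<exists>m. (\<forall>v\<in>\<sigma>. \<psi> v = pairing m v) \<and> (\<forall>v. v \<notin> \<sigma> \<longrightarrow> \<psi> v < pairing m v))))"

definition projective_fan :: "(real ^ 'n::finite) set set \<Rightarrow> bool" where
  "projective_fan \<Sigma> \<longleftrightarrow> complete_fan \<Sigma> \<and> (\<exists>D. ample \<Sigma> D)"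


section \<open>The toric variety: charts and complex points\<close>

text \<open>
  The base ring \<open>R\<close> is \<open>\<int>\<close> (the standard model) or a subfield of the complex numbers. The toric
  variety \<open>X\<close> of \<open>\<Sigma>\<close> over \<open>R\<close> is glued from the charts \<open>U\<^sub>\<sigma> = Spec R[S\<^sub>\<sigma>]\<close>, where
  \<open>S\<^sub>\<sigma> = dual_monoid \<sigma>\<close> and \<open>R[S\<^sub>\<sigma>]\<close> is a subring of the Laurent polynomial ring.
\<close>

definition base_ring :: "complex set \<Rightarrow> bool" where
  "base_ring R \<longleftrightarrow> R = \<int> \<or> subfield R (ring_of_type_algebra :: complex ring)"

type_synonym 'n laurent = "(int ^ 'n) \<Rightarrow>\<^sub>0 complex"

definition dual_monoid :: "(real ^ 'n::finite) set \<Rightarrow> (int ^ 'n) set" where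
  "dual_monoid \<sigma> = {m. \<forall>v\<in>\<sigma>. 0 \<le> pairing m v}"

definition chart_ring :: "complex set \<Rightarrow> (real ^ 'n::finite) set \<Rightarrow> 'n laurent ring" where
  "chart_ring R \<sigma> =
    \<lparr>carrier = {f. Poly_Mapping.keys f \<subseteq> dual_monoid \<sigma> \<and> range (Poly_Mapping.lookup f) \<subseteq> R},
     mult = (*), one = 1, zero = 0, add = (+)\<rparr>"

text \<open>
  Points of \<open>U\<^sub>\<sigma>(\<complex>)\<close> are the \<open>R\<close>-algebra homomorphisms \<open>R[S\<^sub>\<sigma>] \<rightarrow> \<complex>\<close>, that is, the monoid
  homomorphisms \<open>S\<^sub>\<sigma> \<rightarrow> (\<complex>, \<cdot>)\<close>, extended by zero outside \<open>S\<^sub>\<sigma>\<close>. Their analytic topology is that of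
  pointwise convergence, i.e. the topology of the function type. The open inclusion
  \<open>U\<^sub>\<tau>(\<complex>) \<subseteq> U\<^sub>\<sigma>(\<complex>)\<close> for a face \<open>\<tau>\<close> of \<open>\<sigma>\<close> is \<open>incl \<sigma>\<close>, and \<open>T(\<complex>) = U\<^sub>{\<^sub>0\<^sub>}(\<complex>)\<close>.
\<close>

type_synonym 'n point = "int ^ 'n \<Rightarrow> complex"

definition chart_points :: "(real ^ 'n::finite) set \<Rightarrow> 'n point set" where
  "chart_points \<sigma> = {x. x 0 = 1 \<and>
    (\<forall>m\<in>dual_monoid \<sigma>. \<forall>m'\<in>dual_monoid \<sigma>. x (m + m') = x m * x m') \<and>
    (\<forall>m. m \<notin> dual_monoid \<sigma> \<longrightarrow> x m = 0)}"

definition incl :: "(real ^ 'n::finite) set \<Rightarrow> 'n point \<Rightarrow> 'n point" where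
  "incl \<sigma> x = (\<lambda>m. if m \<in> dual_monoid \<sigma> then x m else 0)"

definition ev :: "'n point \<Rightarrow> 'n laurent \<Rightarrow> complex" where
  "ev x f = (\<Sum>m\<in>Poly_Mapping.keys f. Poly_Mapping.lookup f m * x m)"

definition neg_log :: "'n::finite point \<Rightarrow> real ^ 'n" where
  "neg_log t = (\<chi> i. - ln (cmod (t (axis i 1))))"


section \<open>Coherent sheaves\<close>

text \<open>
  A quasi-coherent sheaf on \<open>X\<close> is given by its modules of sections over the affine charts \<open>U\<^sub>\<sigma>\<close> and
  the restriction maps \<open>restr \<sigma> \<tau>\<close> for \<open>\<tau> \<subseteq> \<sigma>\<close>, which have to be localizations: \<open>R[S\<^sub>\<tau>]\<close> arises from
  \<open>R[S\<^sub>\<sigma>]\<close> by inverting the characters in \<open>S\<^sub>\<sigma> \<inter> \<tau>\<^sup>\<bottom>\<close>. Being a module over \<open>R[S\<^sub>\<tau>]\<close>, the target has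
  these characters acting invertibly, so it suffices to describe kernel and image.
\<close>

record ('n::finite, 'a) sheaf =
  sections :: "(real ^ 'n) set \<Rightarrow> ('n laurent, 'a) module"
  restr :: "(real ^ 'n) set \<Rightarrow> (real ^ 'n) set \<Rightarrow> 'a \<Rightarrow> 'a"

abbreviation sec :: "('n::finite, 'a) sheaf \<Rightarrow> (real ^ 'n) set \<Rightarrow> 'a set" where
  "sec F \<sigma> \<equiv> carrier (sections F \<sigma>)"

abbreviation char :: "int ^ 'n \<Rightarrow> 'n laurent" where
  "char m \<equiv> Poly_Mapping.single m 1"

definition inverted_chars :: "(real ^ 'n::finite) set \<Rightarrow> (real ^ 'n) set \<Rightarrow> (int ^ 'n) set" where
  "inverted_chars \<sigma> \<tau> = {m \<in> dual_monoid \<sigma>. \<forall>v\<in>\<tau>. pairing m v = 0}"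

definition module_hom :: "('n::finite) laurent ring \<Rightarrow> ('n laurent, 'a) module \<Rightarrow>
  ('n laurent, 'b) module \<Rightarrow> ('a \<Rightarrow> 'b) set" where
  "module_hom A M N = {\<phi> \<in> carrier M \<rightarrow> carrier N.
    (\<forall>s\<in>carrier M. \<forall>t\<in>carrier M. \<phi> (s \<oplus>\<^bsub>M\<^esub> t) = \<phi> s \<oplus>\<^bsub>N\<^esub> \<phi> t) \<and>
    (\<forall>f\<in>carrier A. \<forall>s\<in>carrier M. \<phi> (f \<odot>\<^bsub>M\<^esub> s) = f \<odot>\<^bsub>N\<^esub> \<phi> s)}"

definition finitely_generated :: "('n::finite) laurent ring \<Rightarrow> ('n laurent, 'a) module \<Rightarrow> bool" where
  "finitely_generated A M \<longleftrightarrow> (\<exists>G. finite G \<and> G \<subseteq> carrier M \<and>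
    (\<forall>s\<in>carrier M. \<exists>c \<in> G \<rightarrow> carrier A. s = (\<Oplus>\<^bsub>M\<^esub>g\<in>G. c g \<odot>\<^bsub>M\<^esub> g)))"

definition quasi_coherent ::
  "complex set \<Rightarrow> (real ^ 'n::finite) set set \<Rightarrow> ('n, 'a) sheaf \<Rightarrow> bool" where
  "quasi_coherent R \<Sigma> F \<longleftrightarrow>
    (\<forall>\<sigma>\<in>\<Sigma>. Module.module (chart_ring R \<sigma>) (sections F \<sigma>) \<and> (\<forall>s\<in>sec F \<sigma>. restr F \<sigma> \<sigma> s = s)) \<and>
    (\<forall>\<sigma>\<in>\<Sigma>. \<forall>\<tau>\<in>\<Sigma>. \<tau> \<subseteq> \<sigma> \<longrightarrow>
      restr F \<sigma> \<tau> \<in> module_hom (chart_ring R \<sigma>) (sections F \<sigma>) (sections F \<tau>) \<and>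
      (\<forall>s\<in>sec F \<sigma>. restr F \<sigma> \<tau> s = \<zero>\<^bsub>sections F \<tau>\<^esub> \<longrightarrow>
        (\<exists>m\<in>inverted_chars \<sigma> \<tau>. char m \<odot>\<^bsub>sections F \<sigma>\<^esub> s = \<zero>\<^bsub>sections F \<sigma>\<^esub>)) \<and>
      (\<forall>t\<in>sec F \<tau>. \<exists>m\<in>inverted_chars \<sigma> \<tau>. \<exists>s\<in>sec F \<sigma>.
        char m \<odot>\<^bsub>sections F \<tau>\<^esub> t = restr F \<sigma> \<tau> s)) \<and>
    (\<forall>\<sigma>\<in>\<Sigma>. \<forall>\<tau>\<in>\<Sigma>. \<forall>\<upsilon>\<in>\<Sigma>. \<upsilon> \<subseteq> \<tau> \<and> \<tau> \<subseteq> \<sigma> \<longrightarrow>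
      (\<forall>s\<in>sec F \<sigma>. restr F \<tau> \<upsilon> (restr F \<sigma> \<tau> s) = restr F \<sigma> \<upsilon> s))"

definition coherent ::
  "complex set \<Rightarrow> (real ^ 'n::finite) set set \<Rightarrow> ('n, 'a) sheaf \<Rightarrow> bool" where
  "coherent R \<Sigma> F \<longleftrightarrow> quasi_coherent R \<Sigma> F \<and>
    (\<forall>\<sigma>\<in>\<Sigma>. finitely_generated (chart_ring R \<sigma>) (sections F \<sigma>))"

definition sheaf_hom :: "complex set \<Rightarrow> (real ^ 'n::finite) set set \<Rightarrow> ('n, 'a) sheaf \<Rightarrow>
  ('n, 'b) sheaf \<Rightarrow> ((real ^ 'n) set \<Rightarrow> 'a \<Rightarrow> 'b) set" where
  "sheaf_hom R \<Sigma> F G = {\<phi>.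
    (\<forall>\<sigma>\<in>\<Sigma>. \<phi> \<sigma> \<in> module_hom (chart_ring R \<sigma>) (sections F \<sigma>) (sections G \<sigma>)) \<and>
    (\<forall>\<sigma>\<in>\<Sigma>. \<forall>\<tau>\<in>\<Sigma>. \<tau> \<subseteq> \<sigma> \<longrightarrow> (\<forall>s\<in>sec F \<sigma>. \<phi> \<tau> (restr F \<sigma> \<tau> s) = restr G \<sigma> \<tau> (\<phi> \<sigma> s)))}"

definition sheaf_iso :: "complex set \<Rightarrow> (real ^ 'n::finite) set set \<Rightarrow> ('n, 'a) sheaf \<Rightarrow>
  ('n, 'b) sheaf \<Rightarrow> ((real ^ 'n) set \<Rightarrow> 'a \<Rightarrow> 'b) set" where
  "sheaf_iso R \<Sigma> F G = {\<phi> \<in> sheaf_hom R \<Sigma> F G. \<forall>\<sigma>\<in>\<Sigma>. bij_betw (\<phi> \<sigma>) (sec F \<sigma>) (sec G \<sigma>)}"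


section \<open>Vector bundles\<close>

text \<open>
  \<open>is_frame A M f es\<close> says that the elements \<open>es\<close> of the \<open>A\<close>-module \<open>M\<close> form a basis of the
  localization of \<open>M\<close> at \<open>f\<close> over that of \<open>A\<close>.
\<close>

definition is_frame :: "('n::finite) laurent ring \<Rightarrow> ('n laurent, 'a) module \<Rightarrow> 'n laurent \<Rightarrow>
  'a list \<Rightarrow> bool" where
  "is_frame A M f es \<longleftrightarrow> f \<in> carrier A \<and> set es \<subseteq> carrier M \<and>
    (\<forall>s\<in>carrier M. \<exists>k. \<exists>c \<in> {..<length es} \<rightarrow> carrier A.
      (f ^ k) \<odot>\<^bsub>M\<^esub> s = (\<Oplus>\<^bsub>M\<^esub>j\<in>{..<length es}. c j \<odot>\<^bsub>M\<^esub> (es ! j))) \<and>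
    (\<forall>c \<in> {..<length es} \<rightarrow> carrier A.
      (\<Oplus>\<^bsub>M\<^esub>j\<in>{..<length es}. c j \<odot>\<^bsub>M\<^esub> (es ! j)) = \<zero>\<^bsub>M\<^esub> \<longrightarrow>
      (\<exists>k. \<forall>j<length es. f ^ k * c j = 0))"

definition locally_free :: "('n::finite) laurent ring \<Rightarrow> ('n laurent, 'a) module \<Rightarrow>
  (nat \<Rightarrow> bool) \<Rightarrow> bool" where
  "locally_free A M P \<longleftrightarrow> (\<exists>S. finite S \<and> S \<subseteq> carrier A \<and>
    (\<exists>a \<in> S \<rightarrow> carrier A. (\<Sum>f\<in>S. a f * f) = 1) \<and>
    (\<forall>f\<in>S. \<exists>es. is_frame A M f es \<and> P (length es)))"

definition vector_bundle ::
  "complex set \<Rightarrow> (real ^ 'n::finite) set set \<Rightarrow> ('n, 'a) sheaf \<Rightarrow> bool" where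
  "vector_bundle R \<Sigma> F \<longleftrightarrow> coherent R \<Sigma> F \<and>
    (\<forall>\<sigma>\<in>\<Sigma>. locally_free (chart_ring R \<sigma>) (sections F \<sigma>) (\<lambda>r. True))"

definition line_bundle ::
  "complex set \<Rightarrow> (real ^ 'n::finite) set set \<Rightarrow> ('n, 'a) sheaf \<Rightarrow> bool" where
  "line_bundle R \<Sigma> L \<longleftrightarrow> coherent R \<Sigma> L \<and>
    (\<forall>\<sigma>\<in>\<Sigma>. locally_free (chart_ring R \<sigma>) (sections L \<sigma>) (\<lambda>r. r = 1))"

text \<open>
  An equivariant structure \<open>\<Phi> : a\<^sup>*F \<cong> p\<^sub>2\<^sup>*F\<close> on \<open>T \<times> X\<close> (\<open>a\<close> the action, \<open>p\<^sub>2\<close> the projection) is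
  determined on \<open>T \<times> U\<^sub>\<sigma>\<close> by the coaction \<open>s \<mapsto> \<Phi>(a\<^sup>*s) = \<Sum>\<^sub>m \<chi>\<^sup>m \<otimes> c \<sigma> m s\<close> from \<open>F(U\<^sub>\<sigma>)\<close> to
  \<open>R[M] \<otimes> F(U\<^sub>\<sigma>)\<close>. Linearity of \<open>\<Phi>\<close> over \<open>a\<^sup>*\<chi>\<^sup>m = \<chi>\<^sup>m \<otimes> \<chi>\<^sup>m\<close> is the fifth clause,
  and the cocycle condition with invertibility of \<open>\<Phi>\<close> amounts to coassociativity and counit.
\<close>

definition equivariant_structure :: "complex set \<Rightarrow> (real ^ 'n::finite) set set \<Rightarrow>
  ('n, 'a) sheaf \<Rightarrow> ((real ^ 'n) set \<Rightarrow> int ^ 'n \<Rightarrow> 'a \<Rightarrow> 'a) \<Rightarrow> bool" where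
  "equivariant_structure R \<Sigma> F c \<longleftrightarrow>
    (\<forall>\<sigma>\<in>\<Sigma>.
      (\<forall>m. c \<sigma> m \<in> sec F \<sigma> \<rightarrow> sec F \<sigma>) \<and>
      (\<forall>m. \<forall>s\<in>sec F \<sigma>. \<forall>t\<in>sec F \<sigma>.
        c \<sigma> m (s \<oplus>\<^bsub>sections F \<sigma>\<^esub> t) = c \<sigma> m s \<oplus>\<^bsub>sections F \<sigma>\<^esub> c \<sigma> m t) \<and>
      (\<forall>s\<in>sec F \<sigma>. finite {m. c \<sigma> m s \<noteq> \<zero>\<^bsub>sections F \<sigma>\<^esub>}) \<and>
      (\<forall>s\<in>sec F \<sigma>.
        s = (\<Oplus>\<^bsub>sections F \<sigma>\<^esub>m\<in>{m. c \<sigma> m s \<noteq> \<zero>\<^bsub>sections F \<sigma>\<^esub>}. c \<sigma> m s)) \<and>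
      (\<forall>r\<in>R. \<forall>k\<in>dual_monoid \<sigma>. \<forall>m. \<forall>s\<in>sec F \<sigma>.
        c \<sigma> (k + m) (Poly_Mapping.single k r \<odot>\<^bsub>sections F \<sigma>\<^esub> s) =
          Poly_Mapping.single k r \<odot>\<^bsub>sections F \<sigma>\<^esub> c \<sigma> m s) \<and>
      (\<forall>m k. \<forall>s\<in>sec F \<sigma>.
        c \<sigma> m (c \<sigma> k s) = (if m = k then c \<sigma> k s else \<zero>\<^bsub>sections F \<sigma>\<^esub>))) \<and>
    (\<forall>\<sigma>\<in>\<Sigma>. \<forall>\<tau>\<in>\<Sigma>. \<tau> \<subseteq> \<sigma> \<longrightarrow>
      (\<forall>m. \<forall>s\<in>sec F \<sigma>. c \<tau> m (restr F \<sigma> \<tau> s) = restr F \<sigma> \<tau> (c \<sigma> m s)))"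

text \<open>
  \<open>\<O>(D)\<close>: rational functions \<open>f\<close> with \<open>div f + D \<ge> 0\<close> on \<open>U\<^sub>\<sigma>\<close>. Such \<open>f\<close> are regular on the torus,
  and vanish along \<open>D\<^sub>\<rho>\<close> to the order \<open>min {\<langle>m, u\<^sub>\<rho>\<rangle> | m \<in> keys f}\<close>. The canonical rational section
  \<open>s\<^sub>D\<close> is the function \<open>1\<close>.
\<close>

definition divisor_sheaf :: "complex set \<Rightarrow> 'n divisor \<Rightarrow> ('n::finite, 'n laurent) sheaf" where
  "divisor_sheaf R D =
    \<lparr>sections = (\<lambda>\<sigma>.
       \<lparr>carrier = {f. range (Poly_Mapping.lookup f) \<subseteq> R \<and>
          (\<forall>m\<in>Poly_Mapping.keys f. \<forall>u\<in>ray_gens \<sigma>. - real_of_int (D u) \<le> pairing m (real_vec u))},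
        mult = (*), one = 1, zero = 0, add = (+), smult = (*)\<rparr>),
     restr = (\<lambda>\<sigma> \<tau> f. f)\<rparr>"


section \<open>Hermitian metrics\<close>

text \<open>
  A hermitian form on the fibre of \<open>F\<close> at \<open>x \<in> U\<^sub>\<sigma>(\<complex>)\<close>, i.e. on \<open>F(U\<^sub>\<sigma>) \<otimes> \<complex>\<close> along \<open>ev x\<close>, is
  the same as a form \<open>h \<sigma> x\<close> on \<open>F(U\<^sub>\<sigma>)\<close> that is sesquilinear along \<open>ev x\<close>. Positivity is required
  on the complex span of every frame around \<open>x\<close>, and a metric is continuous iff the products of
  sections over the charts are. The norm of a section is \<open>sqrt (Re (h \<sigma> x s s))\<close>.
\<close>

type_synonym ('n, 'a) metric = "(real ^ 'n) set \<Rightarrow> 'n point \<Rightarrow> 'a \<Rightarrow> 'a \<Rightarrow> complex"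

definition hermitian_metric :: "complex set \<Rightarrow> (real ^ 'n::finite) set set \<Rightarrow> ('n, 'a) sheaf \<Rightarrow>
  ('n, 'a) metric \<Rightarrow> bool" where
  "hermitian_metric R \<Sigma> E h \<longleftrightarrow>
    (\<forall>\<sigma>\<in>\<Sigma>. \<forall>x\<in>chart_points \<sigma>.
      (\<forall>s\<in>sec E \<sigma>. \<forall>s'\<in>sec E \<sigma>. \<forall>t\<in>sec E \<sigma>.
        h \<sigma> x (s \<oplus>\<^bsub>sections E \<sigma>\<^esub> s') t = h \<sigma> x s t + h \<sigma> x s' t) \<and>
      (\<forall>f\<in>carrier (chart_ring R \<sigma>). \<forall>s\<in>sec E \<sigma>. \<forall>t\<in>sec E \<sigma>.
        h \<sigma> x (f \<odot>\<^bsub>sections E \<sigma>\<^esub> s) t = ev x f * h \<sigma> x s t) \<and>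
      (\<forall>s\<in>sec E \<sigma>. \<forall>t\<in>sec E \<sigma>. h \<sigma> x t s = cnj (h \<sigma> x s t)) \<and>
      (\<forall>f es. is_frame (chart_ring R \<sigma>) (sections E \<sigma>) f es \<and> ev x f \<noteq> 0 \<longrightarrow>
        (\<forall>a :: nat \<Rightarrow> complex. (\<exists>j<length es. a j \<noteq> 0) \<longrightarrow>
          0 < Re (\<Sum>i<length es. \<Sum>j<length es. a i * cnj (a j) * h \<sigma> x (es ! i) (es ! j))))) \<and>
    (\<forall>\<sigma>\<in>\<Sigma>. \<forall>\<tau>\<in>\<Sigma>. \<tau> \<subseteq> \<sigma> \<longrightarrow> (\<forall>x\<in>chart_points \<tau>. \<forall>s\<in>sec E \<sigma>. \<forall>t\<in>sec E \<sigma>.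
      h \<tau> x (restr E \<sigma> \<tau> s) (restr E \<sigma> \<tau> t) = h \<sigma> (incl \<sigma> x) s t)) \<and>
    (\<forall>\<sigma>\<in>\<Sigma>. \<forall>s\<in>sec E \<sigma>. \<forall>t\<in>sec E \<sigma>. continuous_on (chart_points \<sigma>) (\<lambda>x. h \<sigma> x s t))"

definition hermitian_vector_bundle :: "complex set \<Rightarrow> (real ^ 'n::finite) set set \<Rightarrow>
  ('n, 'a) sheaf \<Rightarrow> ('n, 'a) metric \<Rightarrow> bool" where
  "hermitian_vector_bundle R \<Sigma> E h \<longleftrightarrow> vector_bundle R \<Sigma> E \<and> hermitian_metric R \<Sigma> E h"

text \<open>
  The torus being dense in each chart, a continuous metric is determined by its values there, so at
  most one metric on \<open>\<O>(D)\<close> satisfies this predicate (up to values off the charts and sections).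
\<close>

definition canonical_metric_divisor :: "complex set \<Rightarrow> (real ^ 'n::finite) set set \<Rightarrow>
  'n divisor \<Rightarrow> ('n, 'n laurent) metric \<Rightarrow> bool" where
  "canonical_metric_divisor R \<Sigma> D h \<longleftrightarrow> hermitian_metric R \<Sigma> (divisor_sheaf R D) h \<and>
    (\<forall>t\<in>chart_points {0}. sqrt (Re (h {0} t 1 1)) = exp (support_function \<Sigma> D (neg_log t)))"

text \<open>
  For \<open>R = \<int>\<close> the canonical metric of a line bundle does not depend on \<open>D\<close> and the isomorphism;
  over a field, choosing the isomorphism means choosing a standard model of \<open>L\<close> over \<open>\<int>\<close>.
\<close>

definition canonical_metric :: "complex set \<Rightarrow> (real ^ 'n::finite) set set \<Rightarrow>
  ('n, 'a) sheaf \<Rightarrow> ('n, 'a) metric \<Rightarrow> bool" where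
  "canonical_metric R \<Sigma> L h \<longleftrightarrow>
    (\<exists>D h0. \<exists>\<phi>\<in>sheaf_iso R \<Sigma> L (divisor_sheaf R D). canonical_metric_divisor R \<Sigma> D h0 \<and>
      (\<forall>\<sigma>\<in>\<Sigma>. \<forall>x\<in>chart_points \<sigma>. \<forall>s\<in>sec L \<sigma>. \<forall>t\<in>sec L \<sigma>.
        h \<sigma> x s t = h0 \<sigma> x (\<phi> \<sigma> s) (\<phi> \<sigma> t)))"

definition subsheaf :: "('n::finite, 'a) sheaf \<Rightarrow> ((real ^ 'n) set \<Rightarrow> 'a set) \<Rightarrow>
  ('n, 'a) sheaf" where
  "subsheaf E C = E\<lparr>sections := (\<lambda>\<sigma>. (sections E \<sigma>)\<lparr>carrier := C \<sigma>\<rparr>)\<rparr>"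

definition orthogonal_sum_of_canonical :: "complex set \<Rightarrow> (real ^ 'n::finite) set set \<Rightarrow>
  ('n, 'a) sheaf \<Rightarrow> ('n, 'a) metric \<Rightarrow> bool" where
  "orthogonal_sum_of_canonical R \<Sigma> E h \<longleftrightarrow>
    (\<exists>(k :: nat) C.
      (\<forall>j<k. (\<forall>\<sigma>\<in>\<Sigma>. submodule (C j \<sigma>) (chart_ring R \<sigma>) (sections E \<sigma>)) \<and>
        line_bundle R \<Sigma> (subsheaf E (C j)) \<and> canonical_metric R \<Sigma> (subsheaf E (C j)) h) \<and>
      (\<forall>\<sigma>\<in>\<Sigma>. \<forall>s\<in>sec E \<sigma>.
        \<exists>!v. v \<in> (\<Pi>\<^sub>E j\<in>{..<k}. C j \<sigma>) \<and> s = (\<Oplus>\<^bsub>sections E \<sigma>\<^esub>j\<in>{..<k}. v j)) \<and>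
      (\<forall>\<sigma>\<in>\<Sigma>. \<forall>x\<in>chart_points \<sigma>. \<forall>i<k. \<forall>j<k. i \<noteq> j \<longrightarrow>
        (\<forall>s\<in>C i \<sigma>. \<forall>t\<in>C j \<sigma>. h \<sigma> x s t = 0)))"


section \<open>Metrized coherent sheaves\<close>

definition finite_resolution :: "complex set \<Rightarrow> (real ^ 'n::finite) set set \<Rightarrow>
  (nat \<Rightarrow> ('n, 'b) sheaf) \<Rightarrow> (nat \<Rightarrow> (real ^ 'n) set \<Rightarrow> 'b \<Rightarrow> 'b) \<Rightarrow>
  ((real ^ 'n) set \<Rightarrow> 'b \<Rightarrow> 'a) \<Rightarrow> ('n, 'a) sheaf \<Rightarrow> bool" where
  "finite_resolution R \<Sigma> E d \<epsilon> F \<longleftrightarrow>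
    \<epsilon> \<in> sheaf_hom R \<Sigma> (E 0) F \<and> (\<forall>i. d i \<in> sheaf_hom R \<Sigma> (E (Suc i)) (E i)) \<and>
    (\<forall>\<sigma>\<in>\<Sigma>. \<epsilon> \<sigma> ` sec (E 0) \<sigma> = sec F \<sigma> \<and>
      d 0 \<sigma> ` sec (E 1) \<sigma> = {s \<in> sec (E 0) \<sigma>. \<epsilon> \<sigma> s = \<zero>\<^bsub>sections F \<sigma>\<^esub>} \<and>
      (\<forall>i. d (Suc i) \<sigma> ` sec (E (Suc (Suc i))) \<sigma> =
        {s \<in> sec (E (Suc i)) \<sigma>. d i \<sigma> s = \<zero>\<^bsub>sections (E i) \<sigma>\<^esub>})) \<and>
    (\<exists>l. \<forall>i>l. \<forall>\<sigma>\<in>\<Sigma>. sec (E i) \<sigma> = {\<zero>\<^bsub>sections (E i) \<sigma>\<^esub>})"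

definition metrized_coherent_sheaf :: "complex set \<Rightarrow> (real ^ 'n::finite) set set \<Rightarrow>
  ('n, 'a) sheaf \<Rightarrow> (nat \<Rightarrow> ('n, 'b) sheaf) \<Rightarrow> (nat \<Rightarrow> ('n, 'b) metric) \<Rightarrow>
  (nat \<Rightarrow> (real ^ 'n) set \<Rightarrow> 'b \<Rightarrow> 'b) \<Rightarrow> ((real ^ 'n) set \<Rightarrow> 'b \<Rightarrow> 'a) \<Rightarrow> bool" where
  "metrized_coherent_sheaf R \<Sigma> F E h d \<epsilon> \<longleftrightarrow> coherent R \<Sigma> F \<and>
    (\<forall>i. hermitian_vector_bundle R \<Sigma> (E i) (h i)) \<and> finite_resolution R \<Sigma> E d \<epsilon> F"

definition canonically_metrized :: "complex set \<Rightarrow> (real ^ 'n::finite) set set \<Rightarrow>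
  ('n, 'a) sheaf \<Rightarrow> (nat \<Rightarrow> ('n, 'b) sheaf) \<Rightarrow> (nat \<Rightarrow> ('n, 'b) metric) \<Rightarrow>
  (nat \<Rightarrow> (real ^ 'n) set \<Rightarrow> 'b \<Rightarrow> 'b) \<Rightarrow> ((real ^ 'n) set \<Rightarrow> 'b \<Rightarrow> 'a) \<Rightarrow> bool" where
  "canonically_metrized R \<Sigma> F E h d \<epsilon> \<longleftrightarrow> metrized_coherent_sheaf R \<Sigma> F E h d \<epsilon> \<and>
    (\<forall>i. orthogonal_sum_of_canonical R \<Sigma> (E i) (h i))"

end

theory Submission
  imports Defs
begin

text \<open>
  Over the open orbit \<open>F\<close> is \<open>R[M] \<otimes> V\<close> with \<open>V\<close> a submodule of some \<open>R\<^sup>N\<close>, and, \<open>F\<close> being torsion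
  free, its sections over a chart form a graded submodule. The part of degree \<open>m\<close> over \<open>\<sigma>\<close> depends
  only on the integers \<open>\<langle>m, u\<^sub>\<rho>\<rangle>\<close> for the rays of \<open>\<sigma>\<close>, truncated to a bounded range because \<open>F\<close> is
  finitely generated. So \<open>F\<close> amounts to a monotone family of submodules of \<open>R\<^sup>N\<close> over the finite poset
  \<open>P\<close> of functions from the rays to \<open>{L..U}\<close>; the representable families \<open>p \<mapsto> R\<close> for \<open>p \<ge> d\<close>, and zero
  otherwise, correspond to the line bundles \<open>\<O>(-\<Sum> d\<^sub>\<rho> D\<^sub>\<rho>)\<close>. As \<open>R\<close> is a principal ideal domain, such a
  family is covered by a finite sum of representable ones whose kernel starts higher up in \<open>P\<close>; hence
  there is a finite resolution.

  The canonical metric of a globally generated \<open>\<O>(D)\<close> is \<open>1 / max\<^sub>\<tau> \<bar>\<chi>\<^bsup>m\<^sub>\<tau> - m\<^sub>\<sigma>\<^esup>\<bar>\<close> on the generator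
  \<open>\<chi>\<^bsup>m\<^sub>\<sigma>\<^esup>\<close> over \<open>\<sigma>\<close>, where \<open>m\<^sub>\<tau>\<close> is the linear part of \<open>\<psi>\<^sub>D\<close> on \<open>\<tau>\<close>; the general case follows by
  writing \<open>D\<close> as a difference of globally generated divisors.
\<close>

section \<open>Resolutions of filtered modules\<close>

text \<open>The syzygies of a bundle under covers by sums of line bundles are not visibly bundles,
  so an induction inside the class of equivariant bundles would stall. Monotone families of
  submodules of \<open>R^N\<close> are closed under kernels, and local freeness is spent once, on
  embedding the sections over all charts into one \<open>R[M]^N\<close>, where restrictions become
  inclusions. Over a principal ideal domain each member of such a family has a basis; this
  independence, and not any minimality of the cover, is what expels the lowest degrees from the next
  kernel and so bounds the length.

  All maps between the terms are matrices with entries in \<open>R\<close>, hence preserve degrees,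
  and one matrix serves every chart. The part of degree \<open>m\<close> over \<sigma> is the value
  of a family at the truncated degree, so exactness at each element of the finite poset gives
  exactness over every chart at once. The metrics and the differentials are independent of each
  other, so the two halves of the proof meet only at the end.\<close>

definition ring_subset :: "complex set \<Rightarrow> bool" where
  "ring_subset R \<longleftrightarrow> 0 \<in> R \<and> 1 \<in> R \<and> (\<forall>a\<in>R. \<forall>b\<in>R. a + b \<in> R \<and> a * b \<in> R \<and> - a \<in> R)"

text \<open>Treats both kinds of base ring at once; the absence of zero divisors is inherited from
  the complex numbers.\<close>

definition pid_subset :: "complex set \<Rightarrow> bool" where
  "pid_subset R \<longleftrightarrow> ring_subset R \<and>
    (\<forall>I. I \<subseteq> R \<and> 0 \<in> I \<and> (\<forall>a\<in>I. \<forall>b\<in>I. a + b \<in> I) \<and> (\<forall>r\<in>R. \<forall>a\<in>I. r * a \<in> I) \<longrightarrow>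
      (\<exists>g\<in>I. \<forall>a\<in>I. \<exists>r\<in>R. a = r * g))"

lemma pid_subset_Ints: "pid_subset \<int>"
  unfolding pid_subset_def
proof (intro conjI allI impI)
  show "ring_subset \<int>"
    by (auto simp: ring_subset_def)
next
  fix I :: "complex set"
  assume I: "I \<subseteq> \<int> \<and> 0 \<in> I \<and> (\<forall>a\<in>I. \<forall>b\<in>I. a + b \<in> I) \<and> (\<forall>r\<in>\<int>. \<forall>a\<in>I. r * a \<in> I)"
  have IZ: "a \<in> \<int>" if "a \<in> I" for a using I that by blast
  have Iadd: "a + b \<in> I" if "a \<in> I" "b \<in> I" for a b using I that by blast
  have Imult: "of_int z * a \<in> I" if "a \<in> I" for z a using I that by auto
  show "\<exists>g\<in>I. \<forall>a\<in>I. \<exists>r\<in>\<int>. a = r * g"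
  proof (cases "I = {0}")
    case True
    then show ?thesis by auto
  next
    case False
    define Q where "Q = (\<lambda>k::nat. k > 0 \<and> of_nat k \<in> I)"
    have ex: "\<exists>k. Q k"
    proof -
      obtain a where a: "a \<in> I" "a \<noteq> 0" using False I by auto
      obtain z where z: "a = of_int z" using IZ[OF a(1)] by (rule Ints_cases)
      have "of_int (-1) * a \<in> I" using Imult a by blast
      then have "of_int \<bar>z\<bar> \<in> I" using a z by (auto simp: abs_if)
      then have "(of_nat (nat \<bar>z\<bar>) :: complex) \<in> I" by simp
      then show ?thesis unfolding Q_def using a z by (intro exI[of _ "nat \<bar>z\<bar>"]) auto
    qed
    define k where "k = (LEAST k. Q k)"
    have k: "Q k" and kmin: "\<And>l. Q l \<Longrightarrow> k \<le> l"
      using LeastI_ex[OF ex] Least_le[of Q] by (auto simp: k_def)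
    show ?thesis
    proof (rule bexI[of _ "of_nat k"], rule ballI)
      show "of_nat k \<in> I" using k by (simp add: Q_def)
      fix a assume a: "a \<in> I"
      obtain z where z: "a = of_int z" using IZ[OF a] by (rule Ints_cases)
      \<comment> \<open>Division with remainder: the remainder of \<open>z\<close> modulo the least
        positive element \<open>k\<close> lies in \<open>I\<close>, so minimality makes it
        zero.\<close>
      have "of_int (- (z div int k)) * of_nat k \<in> I"
        using Imult k unfolding Q_def by blast
      then have "a + of_int (- (z div int k)) * of_nat k \<in> I" using Iadd a by blast
      moreover have "a + of_int (- (z div int k)) * of_nat k = of_int (z mod int k)"
      proof -
        have "z + - (z div int k) * int k = z mod int k"
          by (simp add: minus_div_mult_eq_mod)
        then have "complex_of_int (z + - (z div int k) * int k) = of_int (z mod int k)"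
          by (rule arg_cong)
        then show ?thesis unfolding z by simp
      qed
      ultimately have "(of_nat (nat (z mod int k)) :: complex) \<in> I"
        using k by (simp add: Q_def)
      moreover have "nat (z mod int k) < k" using k by (simp add: Q_def nat_less_iff)
      ultimately have "nat (z mod int k) = 0"
        using kmin[of "nat (z mod int k)"] by (force simp: Q_def)
      moreover have "0 \<le> z mod int k" using k by (simp add: Q_def)
      ultimately have "z mod int k = 0" by simp
      then have "a = of_int (z div int k) * of_nat k"
      proof -
        have "z = z div int k * int k" using \<open>z mod int k = 0\<close> by (simp add: dvd_eq_mod_eq_0)
        then have "complex_of_int z = of_int (z div int k * int k)" by (rule arg_cong)
        then show ?thesis unfolding z by simp
      qed
      then show "\<exists>r\<in>\<int>. a = r * of_nat k"
        by (intro bexI[of _ "of_int (z div int k)"]) auto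
    qed
  qed
qed

lemma base_ring_imp_pid_subset:
  assumes "base_ring R"
  shows "pid_subset R"
  using assms unfolding base_ring_def
proof
  assume "R = \<int>"
  then show ?thesis by (simp add: pid_subset_Ints)
next
  assume sf: "subfield R (ring_of_type_algebra :: complex ring)"
  let ?C = "ring_of_type_algebra :: complex ring"
  interpret C: field ?C by (rule field_from_type_algebra)
  have C: "carrier ?C = UNIV" "add ?C = (+)" "mult ?C = (*)" "zero ?C = 0" "one ?C = 1"
    by (auto simp: ring_of_type_algebra_def)
  have neg: "a_inv ?C a = - a" for a
    using C.minus_equality[of "- a" a] by (simp add: C)
  note R = subringE[OF subfieldE(1)[OF sf], unfolded C neg]
  have ring: "ring_subset R"
    using R by (auto simp: ring_subset_def)
  have inv: "inverse a \<in> R" if "a \<in> R" for a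
  proof (cases "a = 0")
    case False
    then show ?thesis
      using C.subfield_m_inv_simprule[OF sf, of a "inverse a"] that R by (simp add: C)
  qed (use R in simp)
  show ?thesis
    unfolding pid_subset_def
  proof (intro conjI ring allI impI)
    fix I :: "complex set"
    assume I: "I \<subseteq> R \<and> 0 \<in> I \<and> (\<forall>a\<in>I. \<forall>b\<in>I. a + b \<in> I) \<and> (\<forall>r\<in>R. \<forall>a\<in>I. r * a \<in> I)"
    show "\<exists>g\<in>I. \<forall>a\<in>I. \<exists>r\<in>R. a = r * g"
    proof (cases "I = {0}")
      case True
      then show ?thesis using ring by (auto simp: ring_subset_def)
    next
      case False
      then obtain g where g: "g \<in> I" "g \<noteq> 0" using I by blast
      have "a = (a * inverse g) * g \<and> a * inverse g \<in> R" if "a \<in> I" for a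
        using that g I inv ring by (auto simp: ring_subset_def)
      then show ?thesis using g by blast
    qed
  qed
qed

text \<open>Vectors are functions on \<open>nat\<close> that vanish from \<open>N\<close> on, so
  submodules of all ranks live in one type and the ranks may change from term to term of a
  resolution.\<close>

definition submod :: "complex set \<Rightarrow> nat \<Rightarrow> (nat \<Rightarrow> complex) set \<Rightarrow> bool" where
  "submod R N W \<longleftrightarrow> (\<forall>w\<in>W. (\<forall>i. w i \<in> R) \<and> (\<forall>i\<ge>N. w i = 0)) \<and> (\<lambda>_. 0) \<in> W \<and>
    (\<forall>v\<in>W. \<forall>w\<in>W. (\<lambda>i. v i + w i) \<in> W) \<and> (\<forall>r\<in>R. \<forall>w\<in>W. (\<lambda>i. r * w i) \<in> W)"

lemma submod_add: "submod R N W \<Longrightarrow> v \<in> W \<Longrightarrow> w \<in> W \<Longrightarrow> (\<lambda>i. v i + w i) \<in> W"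
  by (simp add: submod_def)

lemma submod_scale: "submod R N W \<Longrightarrow> r \<in> R \<Longrightarrow> w \<in> W \<Longrightarrow> (\<lambda>i. r * w i) \<in> W"
  by (simp add: submod_def)

lemma submod_sum:
  assumes "submod R N W" "\<And>b. b \<in> B \<Longrightarrow> r b \<in> R" "\<And>b. b \<in> B \<Longrightarrow> f b \<in> W"
  shows "(\<lambda>i. \<Sum>b\<in>B. r b * f b i) \<in> W"
proof (cases "finite B")
  case True
  then show ?thesis using assms(2,3)
  proof (induction B)
    case empty
    then show ?case using assms(1) by (simp add: submod_def)
  next
    case (insert x B)
    have "(\<lambda>i. r x * f x i) \<in> W" "(\<lambda>i. \<Sum>b\<in>B. r b * f b i) \<in> W"
      using insert assms(1) by (auto simp: submod_def)
    then show ?case using insert assms(1) by (simp add: submod_def)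
  qed
next
  case False
  then show ?thesis using assms(1) by (simp add: submod_def)
qed

text \<open>Split off the last coordinate, whose values form a principal ideal.\<close>

lemma submod_basis:
  assumes "pid_subset R" "submod R N W"
  shows "\<exists>B. finite B \<and> B \<subseteq> W \<and>
    (\<forall>w\<in>W. \<exists>r. (\<forall>b\<in>B. r b \<in> R) \<and> w = (\<lambda>i. \<Sum>b\<in>B. r b * b i)) \<and>
    (\<forall>r. (\<forall>i. (\<Sum>b\<in>B. r b * b i) = 0) \<longrightarrow> (\<forall>b\<in>B. r b = 0))"
  using assms(2)
proof (induction N arbitrary: W)
  case 0
  then have "W \<subseteq> {\<lambda>_. 0}" by (auto simp: submod_def)
  then show ?case by (intro exI[of _ "{}"]) auto
next
  case (Suc N)
  have ring: "ring_subset R" using assms(1) by (simp add: pid_subset_def)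
  define W0 where "W0 = {w\<in>W. w N = 0}"
  have "submod R N W0"
    using Suc.prems unfolding submod_def W0_def
    by (auto simp: not_less_eq_eq) (metis le_antisym not_less_eq_eq)
  from Suc.IH[OF this] obtain B where B: "finite B" "B \<subseteq> W0"
    and gen: "\<forall>w\<in>W0. \<exists>r. (\<forall>b\<in>B. r b \<in> R) \<and> w = (\<lambda>i. \<Sum>b\<in>B. r b * b i)"
    and indep: "\<forall>r. (\<forall>i. (\<Sum>b\<in>B. r b * b i) = 0) \<longrightarrow> (\<forall>b\<in>B. r b = 0)"
    by blast
  define I where "I = (\<lambda>w. w N) ` W"
  have I: "I \<subseteq> R \<and> 0 \<in> I \<and> (\<forall>a\<in>I. \<forall>b\<in>I. a + b \<in> I) \<and> (\<forall>r\<in>R. \<forall>a\<in>I. r * a \<in> I)"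
  proof (intro conjI ballI)
    show "I \<subseteq> R" using Suc.prems by (auto simp: submod_def I_def)
    show "0 \<in> I" unfolding I_def
      by (rule image_eqI[of _ _ "\<lambda>_. 0"]) (use Suc.prems in \<open>auto simp: submod_def\<close>)
  next
    fix a b assume "a \<in> I" "b \<in> I"
    then obtain v w where "v \<in> W" "w \<in> W" "a = v N" "b = w N" by (auto simp: I_def)
    then show "a + b \<in> I" unfolding I_def
      by (intro image_eqI[of _ _ "\<lambda>i. v i + w i"]) (use Suc.prems in \<open>auto simp: submod_def\<close>)
  next
    fix r a assume "r \<in> R" "a \<in> I"
    then obtain v where "v \<in> W" "a = v N" by (auto simp: I_def)
    then show "r * a \<in> I" unfolding I_def
      by (intro image_eqI[of _ _ "\<lambda>i. r * v i"]) (use Suc.prems \<open>r \<in> R\<close> in \<open>auto simp: submod_def\<close>)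
  qed
  then obtain g where g: "g \<in> I" "\<forall>a\<in>I. \<exists>r\<in>R. a = r * g"
    using mp[OF spec[OF conjunct2[OF assms(1)[unfolded pid_subset_def]]] I] by blast
  then obtain wg where wg: "wg \<in> W" "wg N = g" by (auto simp: I_def)
  show ?case
  proof (cases "g = 0")
    case True
    then have "W0 = W" using g by (auto simp: W0_def I_def)
    then show ?thesis using B gen indep by blast
  next
    case False
    \<comment> \<open>The sums run over the set \<open>insert wg B\<close>, so \<open>wg\<close>
      must be new: its last coordinate \<open>g\<close> is nonzero, while those of \<open>B\<close>
      vanish.\<close>
    then have nB: "wg \<notin> B" using B wg by (auto simp: W0_def)
    have BN: "b N = 0" if "b \<in> B" for b using that B by (auto simp: W0_def)
    show ?thesis
    proof (intro exI[of _ "insert wg B"] conjI ballI allI impI)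
      show "finite (insert wg B)" "insert wg B \<subseteq> W" using B wg by (auto simp: W0_def)
    next
      fix w assume w: "w \<in> W"
      then obtain a where a: "a \<in> R" "w N = a * g" using g by (auto simp: I_def)
      have "- a \<in> R" using a ring by (auto simp: ring_subset_def)
      then have "(\<lambda>i. (- a) * wg i) \<in> W" using wg by (intro submod_scale[OF Suc.prems]) auto
      then have "(\<lambda>i. w i + (- a) * wg i) \<in> W" by (intro submod_add[OF Suc.prems] w)
      then have "(\<lambda>i. w i + (- a) * wg i) \<in> W0" using a wg by (simp add: W0_def)
      then obtain r where r: "\<forall>b\<in>B. r b \<in> R" "(\<lambda>i. w i + (- a) * wg i) = (\<lambda>i. \<Sum>b\<in>B. r b * b i)"
        using gen by blast
      have "w i = (\<Sum>b\<in>insert wg B. (r(wg := a)) b * b i)" for i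
      proof -
        have "(\<Sum>b\<in>B. (r(wg := a)) b * b i) = (\<Sum>b\<in>B. r b * b i)"
          using nB by (intro sum.cong) auto
        moreover have "w i + (- a) * wg i = (\<Sum>b\<in>B. r b * b i)" using r(2) by metis
        ultimately show ?thesis using B nB by (simp add: diff_eq_eq add.commute)
      qed
      then show "\<exists>r. (\<forall>b\<in>insert wg B. r b \<in> R) \<and> w = (\<lambda>i. \<Sum>b\<in>insert wg B. r b * b i)"
        using r a by (intro exI[of _ "r(wg := a)"]) auto
    next
      fix r b assume r: "\<forall>i. (\<Sum>b\<in>insert wg B. r b * b i) = 0" and b: "b \<in> insert wg B"
      have "r wg * g + (\<Sum>b\<in>B. r b * b N) = 0" using spec[OF r, of N] B nB wg by simp
      moreover have "(\<Sum>b\<in>B. r b * b N) = 0" using BN by (intro sum.neutral) auto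
      ultimately have "r wg = 0" using False by simp
      moreover from this have "\<forall>i. (\<Sum>b\<in>B. r b * b i) = 0" using r B nB by simp
      ultimately show "r b = 0" using indep b by auto
    qed
  qed
qed

section \<open>Free covers of monotone families\<close>

definition mat_app :: "nat \<Rightarrow> (nat \<Rightarrow> nat \<Rightarrow> complex) \<Rightarrow> (nat \<Rightarrow> complex) \<Rightarrow> nat \<Rightarrow> complex" where
  "mat_app n A v = (\<lambda>i. \<Sum>j<n. A i j * v j)"

text \<open>The value at \<open>p\<close> of a sum of representable families, one with a generator
  in each degree \<open>d j\<close> for \<open>j < n\<close>; as \<open>p\<close> grows, more
  coordinates are allowed to be nonzero.\<close>

definition free_at :: "complex set \<Rightarrow> nat \<Rightarrow> (nat \<Rightarrow> 'p::order) \<Rightarrow> 'p \<Rightarrow> (nat \<Rightarrow> complex) set" where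
  "free_at R n d p = {v. \<forall>j. v j \<in> R \<and> (v j \<noteq> 0 \<longrightarrow> j < n \<and> d j \<le> p)}"

lemma submod_free_at: "ring_subset R \<Longrightarrow> submod R n (free_at R n d p)"
  unfolding submod_def free_at_def ring_subset_def
  by auto (metis add.right_neutral not_less)+

text \<open>For every \<open>p\<close> take a basis of \<open>W p\<close> and one generator of
  degree \<open>p\<close> for each basis vector. Generators of lower degree map into
  \<open>W p\<close> by monotonicity, and those of degree exactly \<open>p\<close> already reach all
  of it. A relation among generators of one degree is a relation in a basis, which gives the last
  clause; basis vectors are nonzero, which keeps generators away from the zero modules.\<close>

lemma filtered_cover:
  fixes P :: "'p::order set"
  assumes pid: "pid_subset R" and P: "finite P"
    and W': "\<forall>p\<in>P. submod R N (W p)"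
    and mono': "\<forall>p\<in>P. \<forall>q\<in>P. p \<le> q \<longrightarrow> W p \<subseteq> W q"
  shows "\<exists>n d A. (\<forall>j<n. d j \<in> P \<and> W (d j) \<noteq> {\<lambda>_. 0}) \<and> (\<forall>i j. A i j \<in> R) \<and>
    (\<forall>p\<in>P. mat_app n A ` free_at R n d p = W p) \<and>
    (\<forall>p\<in>P. \<forall>v. mat_app n A v = (\<lambda>_. 0) \<and> (\<forall>j<n. v j \<noteq> 0 \<longrightarrow> d j = p) \<longrightarrow> (\<forall>j<n. v j = 0))"
proof -
  have ring: "ring_subset R" using pid by (simp add: pid_subset_def)
  have W: "submod R N (W p)" if "p \<in> P" for p using W' that by blast
  have mono: "W p \<subseteq> W q" if "p \<in> P" "q \<in> P" "p \<le> q" for p q using mono' that by blast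
  define Bas where "Bas q B \<longleftrightarrow> finite B \<and> B \<subseteq> W q \<and>
    (\<forall>w\<in>W q. \<exists>r. (\<forall>b\<in>B. r b \<in> R) \<and> w = (\<lambda>i. \<Sum>b\<in>B. r b * b i)) \<and>
    (\<forall>r. (\<forall>i. (\<Sum>b\<in>B. r b * b i) = 0) \<longrightarrow> (\<forall>b\<in>B. r b = 0))" for q B
  have "\<exists>B. Bas q B" if "q \<in> P" for q
    unfolding Bas_def by (rule submod_basis[OF pid W[OF that]])
  then obtain B where Bas: "\<And>q. q \<in> P \<Longrightarrow> Bas q (B q)" by metis
  have B: "\<And>q. q \<in> P \<Longrightarrow> finite (B q)" "\<And>q. q \<in> P \<Longrightarrow> B q \<subseteq> W q"
    and gen: "\<And>q w. q \<in> P \<Longrightarrow> w \<in> W q \<Longrightarrow> \<exists>r. (\<forall>b\<in>B q. r b \<in> R) \<and> w = (\<lambda>i. \<Sum>b\<in>B q. r b * b i)"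
    and indep: "\<And>q r. q \<in> P \<Longrightarrow> (\<forall>i. (\<Sum>b\<in>B q. r b * b i) = 0) \<Longrightarrow> (\<forall>b\<in>B q. r b = 0)"
    using Bas unfolding Bas_def by (blast, blast, blast, blast)
  \<comment> \<open>Pairs, because the same vector may belong to bases in several degrees and needs
    a generator in each of them.\<close>
  have fin: "finite (Sigma P B)" using P B by auto
  define n where "n = card (Sigma P B)"
  obtain e where e: "bij_betw e {..<n} (Sigma P B)"
    using ex_bij_betw_nat_finite[OF fin] by (auto simp: n_def atLeast0LessThan)
  define d where "d j = fst (e j)" for j
  \<comment> \<open>The columns from \<open>n\<close> on are zero so that all entries lie in
    \<open>R\<close>.\<close>
  define A where "A i j = (if j < n then snd (e j) i else 0)" for i j
  have eP: "d j \<in> P" "snd (e j) \<in> B (d j)" if "j < n" for j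
    using bij_betw_apply[OF e, of j] that by (auto simp: d_def mem_Sigma_iff split: prod.splits)
  have eW: "snd (e j) \<in> W (d j)" if "j < n" for j using eP[OF that] B by blast
  have reindex: "(\<Sum>j<n. if d j = q then h (snd (e j)) else 0) = (\<Sum>b\<in>B q. h b)"
    if q: "q \<in> P" for q and h :: "(nat \<Rightarrow> complex) \<Rightarrow> complex"
  proof -
    have "(\<Sum>j<n. if d j = q then h (snd (e j)) else 0) = (\<Sum>(p,b)\<in>Sigma P B. if p = q then h b else 0)"
      unfolding d_def using sum.reindex_bij_betw[OF e, of "\<lambda>(p,b). if p = q then h b else 0"]
      by (simp add: case_prod_beta)
    also have "\<dots> = (\<Sum>p\<in>P. \<Sum>b\<in>B p. if p = q then h b else 0)"
      by (subst sum.Sigma) (use P B in auto)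
    also have "\<dots> = (\<Sum>p\<in>P. if p = q then (\<Sum>b\<in>B q. h b) else 0)"
      by (intro sum.cong) auto
    also have "\<dots> = (\<Sum>b\<in>B q. h b)" using q P by simp
    finally show ?thesis .
  qed
  have fibre: "\<exists>j<n. d j = q \<and> snd (e j) = b" if "q \<in> P" "b \<in> B q" for q b
  proof -
    have "(q, b) \<in> e ` {..<n}" using that e by (simp add: bij_betw_def)
    then obtain j where "j < n" "e j = (q, b)" by auto
    then show ?thesis by (intro exI[of _ j]) (simp add: d_def)
  qed
  have inj: "j = k" if "j < n" "k < n" "d j = d k" "snd (e j) = snd (e k)" for j k
    using that e unfolding bij_betw_def inj_on_def d_def by (simp add: prod_eq_iff)
  show ?thesis
  proof (intro exI[of _ n] exI[of _ d] exI[of _ A] conjI allI ballI impI)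
    fix j assume j: "j < n"
    show "d j \<in> P" using eP j by blast
    show "W (d j) \<noteq> {\<lambda>_. 0}"
    proof
      assume "W (d j) = {\<lambda>_. 0}"
      then have z: "snd (e j) = (\<lambda>_. 0)" using eW[OF j] by simp
      \<comment> \<open>The coefficient 1 on a zero basis vector would be a nontrivial
        relation.\<close>
      have "\<forall>b\<in>B (d j). (if b = snd (e j) then 1 else 0 :: complex) = 0"
        by (rule indep) (use eP[OF j] z B in \<open>auto intro!: sum.neutral\<close>)
      then show False using eP(2)[OF j] by auto
    qed
  next
    fix i j
    show "A i j \<in> R"
      using eW[of j] W[OF eP(1), of j] ring by (auto simp: A_def submod_def ring_subset_def)
  next
    fix p assume p: "p \<in> P"
    show "mat_app n A ` free_at R n d p = W p"
    proof
      show "mat_app n A ` free_at R n d p \<subseteq> W p"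
      proof clarify
        fix v assume v: "v \<in> free_at R n d p"
        have "(\<lambda>i. \<Sum>j\<in>{j. j < n \<and> d j \<le> p}. v j * snd (e j) i) \<in> W p"
          by (rule submod_sum[OF W[OF p]]) (use v eW mono[OF eP(1) p] in \<open>auto simp: free_at_def\<close>)
        moreover have "mat_app n A v = (\<lambda>i. \<Sum>j\<in>{j. j < n \<and> d j \<le> p}. v j * snd (e j) i)"
          unfolding mat_app_def
          by (intro ext sum.mono_neutral_cong_right) (use v in \<open>auto simp: free_at_def A_def\<close>)
        ultimately show "mat_app n A v \<in> W p" by simp
      qed
      show "W p \<subseteq> mat_app n A ` free_at R n d p"
      proof
        fix w assume "w \<in> W p"
        then obtain r where r: "\<forall>b\<in>B p. r b \<in> R" "w = (\<lambda>i. \<Sum>b\<in>B p. r b * b i)" using gen p by blast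
        define v where "v j = (if j < n \<and> d j = p then r (snd (e j)) else 0)" for j
        have "v \<in> free_at R n d p"
          using r eP ring by (auto simp: v_def free_at_def ring_subset_def)
        moreover have "mat_app n A v = w"
        proof
          fix i
          have "mat_app n A v i = (\<Sum>j<n. if d j = p then r (snd (e j)) * snd (e j) i else 0)"
            unfolding mat_app_def v_def A_def by (intro sum.cong) auto
          then show "mat_app n A v i = w i" using reindex[OF p, of "\<lambda>b. r b * b i"] r by simp
        qed
        ultimately show "w \<in> mat_app n A ` free_at R n d p" by blast
      qed
    qed
  next
    fix p v j
    assume p: "p \<in> P" and v: "mat_app n A v = (\<lambda>_. 0) \<and> (\<forall>j<n. v j \<noteq> 0 \<longrightarrow> d j = p)" and j: "j < n"
    show "v j = 0"
    proof (rule ccontr)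
      assume nz: "v j \<noteq> 0"
      \<comment> \<open>Reads the relation \<open>v\<close> as one among the vectors of
        \<open>B p\<close>; the index that SOME selects is unique by \<open>inj\<close>.\<close>
      define r where "r b = v (SOME k. k < n \<and> d k = p \<and> snd (e k) = b)" for b
      have r: "r (snd (e k)) = v k" if "k < n" "d k = p" for k
        unfolding r_def by (rule someI2[of _ k]) (use that inj in auto)
      have "(\<Sum>b\<in>B p. r b * b i) = 0" for i
      proof -
        have "(\<Sum>b\<in>B p. r b * b i) = (\<Sum>k<n. if d k = p then r (snd (e k)) * snd (e k) i else 0)"
          using reindex[OF p, of "\<lambda>b. r b * b i"] by simp
        also have "\<dots> = mat_app n A v i"
          unfolding mat_app_def A_def by (intro sum.cong) (use v r in auto)
        finally show ?thesis using v by simp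
      qed
      then have "\<forall>b\<in>B p. r b = 0" using indep[OF p] by blast
      then show False using nz r[of j] v j eP by auto
    qed
  qed
qed

text \<open>
  In the kernel of a cover as above nothing is left in degrees all of whose predecessors carry
  the zero module, so iterating pushes the kernel up the poset until it vanishes.
\<close>

lemma filtered_resolution_aux:
  fixes P :: "'p::order set"
  assumes pid: "pid_subset R" and P: "finite P"
    and "\<forall>p\<in>P. submod R N (W p)"
    and "\<forall>p\<in>P. \<forall>q\<in>P. p \<le> q \<longrightarrow> W p \<subseteq> W q"
    and "\<forall>p\<in>P. card {q\<in>P. q < p} + k < card P \<longrightarrow> W p = {\<lambda>_. 0}"
  shows "\<exists>(n :: nat \<Rightarrow> nat) d A l. (\<forall>i. \<forall>j<n i. d i j \<in> P) \<and> (\<forall>i j k. A i j k \<in> R) \<and>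
    (\<forall>p\<in>P. mat_app (n 0) (A 0) ` free_at R (n 0) (d 0) p = W p) \<and>
    (\<forall>i. \<forall>p\<in>P. mat_app (n (Suc i)) (A (Suc i)) ` free_at R (n (Suc i)) (d (Suc i)) p =
      {v \<in> free_at R (n i) (d i) p. mat_app (n i) (A i) v = (\<lambda>_. 0)}) \<and>
    (\<forall>i>l. n i = 0)"
  using assms(3-)
proof (induction k arbitrary: N W)
  case 0
  have ring: "ring_subset R" using pid by (simp add: pid_subset_def)
  have "W p = {\<lambda>_. 0}" if p: "p \<in> P" for p
  proof -
    \<comment> \<open>Since \<open>p\<close> is not below itself, it has fewer than
      \<open>card P\<close> predecessors; for \<open>k = 0\<close> the vanishing hypothesis
      therefore reaches all of \<open>P\<close>.\<close>
    have "{q\<in>P. q < p} \<subset> P" using p by auto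
    then show ?thesis using bspec[OF 0(3) p] psubset_card_mono[OF P] by simp
  qed
  moreover have "free_at R 0 d p = {\<lambda>_. 0}" for d :: "nat \<Rightarrow> 'p" and p
    using ring by (auto simp: free_at_def ring_subset_def)
  ultimately show ?case
    using ring by (intro exI[of _ "\<lambda>_. 0"] exI[of _ "\<lambda>_. undefined"] exI[of _ "\<lambda>_ _ _. 0"])
      (auto simp: mat_app_def ring_subset_def)
next
  case (Suc k)
  have ring: "ring_subset R" using pid by (simp add: pid_subset_def)
  obtain n0 d0 A0 where d0: "\<forall>j<n0. d0 j \<in> P \<and> W (d0 j) \<noteq> {\<lambda>_. 0}" and A0: "\<forall>i j. A0 i j \<in> R"
    and im: "\<forall>p\<in>P. mat_app n0 A0 ` free_at R n0 d0 p = W p"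
    and ker: "\<forall>p\<in>P. \<forall>v. mat_app n0 A0 v = (\<lambda>_. 0) \<and> (\<forall>j<n0. v j \<noteq> 0 \<longrightarrow> d0 j = p) \<longrightarrow> (\<forall>j<n0. v j = 0)"
    using filtered_cover[OF pid P Suc.prems(1,2)]
    by (elim exE conjE) (rule that)
  define K where "K p = {v \<in> free_at R n0 d0 p. mat_app n0 A0 v = (\<lambda>_. 0)}" for p
  have K1: "submod R n0 (K p)" for p
  proof -
    note F = submod_free_at[OF ring, of n0 d0 p]
    have "(\<lambda>_. 0) \<in> K p" using F by (simp add: K_def mat_app_def submod_def)
    moreover have "(\<lambda>i. v i + w i) \<in> K p" if "v \<in> K p" "w \<in> K p" for v w
      using that submod_add[OF F, of v w]
      by (auto simp: K_def mat_app_def fun_eq_iff distrib_left sum.distrib)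
    moreover have "(\<lambda>i. r * w i) \<in> K p" if "r \<in> R" "w \<in> K p" for r w
      using that submod_scale[OF F, of r w]
      by (auto simp: K_def mat_app_def fun_eq_iff mult.left_commute simp flip: sum_distrib_left)
    ultimately show ?thesis using F unfolding submod_def K_def by blast
  qed
  have K2: "K p \<subseteq> K q" if "p \<le> q" for p q
    using that by (auto simp: K_def free_at_def intro: order_trans)
  \<comment> \<open>A coordinate of \<open>v\<close> of degree properly below \<open>p\<close> would
    sit at a degree with fewer predecessors than \<open>p\<close>. That strict drop makes up for the
    passage from \<open>Suc k\<close> to \<open>k\<close>, so \<open>W\<close> would vanish there,
    contrary to the choice of generators. Hence all nonzero coordinates have degree
    \<open>p\<close>, where \<open>ker\<close> excludes relations.\<close>
  have K3: "K p = {\<lambda>_. 0}" if p: "p \<in> P" "card {q\<in>P. q < p} + k < card P" for p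
  proof -
    have "v = (\<lambda>_. 0)" if v: "v \<in> K p" for v
    proof -
      have "d0 j = p" if j: "j < n0" "v j \<noteq> 0" for j
      proof (rule ccontr)
        assume "d0 j \<noteq> p"
        then have lt: "d0 j < p" using v j by (auto simp: K_def free_at_def)
        have "{q\<in>P. q < d0 j} \<subset> {q\<in>P. q < p}" using lt d0 j by auto
        then have "card {q\<in>P. q < d0 j} < card {q\<in>P. q < p}"
          using P by (intro psubset_card_mono) auto
        then have "W (d0 j) = {\<lambda>_. 0}" using bspec[OF Suc.prems(3), of "d0 j"] p d0 j by auto
        then show False using d0 j by auto
      qed
      moreover have "mat_app n0 A0 v = (\<lambda>_. 0)" using v by (simp add: K_def)
      ultimately have z: "\<forall>j<n0. v j = 0" using ker p(1) by blast
      have "v j = 0" for j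
      proof -
        have "v j \<noteq> 0 \<longrightarrow> j < n0" using v by (simp add: K_def free_at_def)
        then show ?thesis using z by blast
      qed
      then show ?thesis by (rule ext)
    qed
    moreover have "(\<lambda>_. 0) \<in> K p" using K1[of p] by (simp add: submod_def)
    ultimately show ?thesis by blast
  qed
  have "\<forall>p\<in>P. submod R n0 (K p)" "\<forall>p\<in>P. \<forall>q\<in>P. p \<le> q \<longrightarrow> K p \<subseteq> K q"
    "\<forall>p\<in>P. card {q\<in>P. q < p} + k < card P \<longrightarrow> K p = {\<lambda>_. 0}"
    using K1 K2 K3 by auto
  from Suc.IH[OF this] obtain n d A l where r: "\<forall>i. \<forall>j<n i. d i j \<in> P" "\<forall>i j k. A i j k \<in> R"
    "\<forall>p\<in>P. mat_app (n 0) (A 0) ` free_at R (n 0) (d 0) p = K p"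
    "\<forall>i. \<forall>p\<in>P. mat_app (n (Suc i)) (A (Suc i)) ` free_at R (n (Suc i)) (d (Suc i)) p =
      {v \<in> free_at R (n i) (d i) p. mat_app (n i) (A i) v = (\<lambda>_. 0)}"
    "\<forall>i>l. n i = (0::nat)"
    by (elim exE conjE) (rule that)
  show ?case
  proof (intro exI[of _ "case_nat n0 n"] exI[of _ "case_nat d0 d"] exI[of _ "case_nat A0 A"]
      exI[of _ "Suc l"] conjI allI impI ballI)
    fix i j
    show "case_nat d0 d i j \<in> P" if "j < case_nat n0 n i"
      using that d0 r by (auto split: nat.splits)
    show "case_nat A0 A i j k \<in> R" for k using A0 r by (auto split: nat.splits)
    show "case_nat n0 n i = 0" if "Suc l < i" using that r by (auto split: nat.splits)
  next
    fix p assume p: "p \<in> P"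
    show "mat_app (case_nat n0 n 0) (case_nat A0 A 0) ` free_at R (case_nat n0 n 0) (case_nat d0 d 0) p = W p"
      using im p by simp
    fix i
    show "mat_app (case_nat n0 n (Suc i)) (case_nat A0 A (Suc i)) `
        free_at R (case_nat n0 n (Suc i)) (case_nat d0 d (Suc i)) p =
      {v \<in> free_at R (case_nat n0 n i) (case_nat d0 d i) p.
        mat_app (case_nat n0 n i) (case_nat A0 A i) v = (\<lambda>_. 0)}"
      using r p by (auto simp: K_def split: nat.splits)
  qed
qed

lemma filtered_resolution:
  fixes P :: "'p::order set"
  assumes "pid_subset R" "finite P"
    and "\<forall>p\<in>P. submod R N (W p)"
    and "\<forall>p\<in>P. \<forall>q\<in>P. p \<le> q \<longrightarrow> W p \<subseteq> W q"
  obtains n :: "nat \<Rightarrow> nat" and d A l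
  where "\<And>i j. j < n i \<Longrightarrow> d i j \<in> P" "\<And>i j k. A i j k \<in> R"
    and "\<And>p. p \<in> P \<Longrightarrow> mat_app (n 0) (A 0) ` free_at R (n 0) (d 0) p = W p"
    and "\<And>i p. p \<in> P \<Longrightarrow> mat_app (n (Suc i)) (A (Suc i)) ` free_at R (n (Suc i)) (d (Suc i)) p =
      {v \<in> free_at R (n i) (d i) p. mat_app (n i) (A i) v = (\<lambda>_. 0)}"
    and "\<And>i. i > l \<Longrightarrow> n i = 0"
proof -
  \<comment> \<open>With \<open>k = card P\<close> the vanishing hypothesis is vacuous.\<close>
  have "\<forall>p\<in>P. card {q \<in> P. q < p} + card P < card P \<longrightarrow> W p = {\<lambda>_. 0}" by simp
  from filtered_resolution_aux[OF assms this]
  show ?thesis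
  proof (elim exE conjE)
    fix n d A l
    assume "\<forall>i j. j < n i \<longrightarrow> d i j \<in> P" "\<forall>i j k. A i j k \<in> R"
      "\<forall>p\<in>P. mat_app (n 0) (A 0) ` free_at R (n 0) (d 0) p = W p"
      "\<forall>i. \<forall>p\<in>P. mat_app (n (Suc i)) (A (Suc i)) ` free_at R (n (Suc i)) (d (Suc i)) p =
        {v \<in> free_at R (n i) (d i) p. mat_app (n i) (A i) v = (\<lambda>_. 0)}"
      "\<forall>i>l. n i = 0"
    then show ?thesis by (intro that[of n d A l]) auto
  qed
qed

section \<open>Laurent polynomials\<close>

lemma laurent_expand: "f = (\<Sum>k\<in>Poly_Mapping.keys f. Poly_Mapping.single k (Poly_Mapping.lookup f k))"
  by (rule poly_mapping_eqI)
    (auto simp: lookup_sum lookup_single when_def in_keys_iff if_distrib cong: if_cong)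

lemma lookup_single_mult:
  fixes g :: "'k::ab_group_add \<Rightarrow>\<^sub>0 'b::comm_semiring_1"
  shows "Poly_Mapping.lookup (Poly_Mapping.single k c * g) m = c * Poly_Mapping.lookup g (m - k)"
proof -
  have "Poly_Mapping.single k c * g =
      (\<Sum>l\<in>Poly_Mapping.keys g. Poly_Mapping.single (k + l) (c * Poly_Mapping.lookup g l))"
    by (subst laurent_expand[of g]) (simp add: sum_distrib_left mult_single)
  also have "Poly_Mapping.lookup \<dots> m =
      (\<Sum>l\<in>Poly_Mapping.keys g. if l = m - k then c * Poly_Mapping.lookup g l else 0)"
    by (auto simp: lookup_sum lookup_single when_def algebra_simps intro!: sum.cong)
  also have "\<dots> = c * Poly_Mapping.lookup g (m - k)"
    by (simp add: in_keys_iff)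
  finally show ?thesis .
qed

lemma lookup_mult_keys:
  fixes f g :: "'k::ab_group_add \<Rightarrow>\<^sub>0 'b::comm_semiring_1"
  shows "Poly_Mapping.lookup (f * g) m =
    (\<Sum>k\<in>Poly_Mapping.keys f. Poly_Mapping.lookup f k * Poly_Mapping.lookup g (m - k))"
  by (subst laurent_expand[of f]) (simp add: sum_distrib_right lookup_sum lookup_single_mult)

lemma laurent_of_finite_support:
  fixes f :: "'k \<Rightarrow> 'b::zero"
  assumes "finite K" "\<And>m. f m \<noteq> 0 \<Longrightarrow> m \<in> K"
  shows "\<exists>p. \<forall>m. Poly_Mapping.lookup p m = f m"
proof -
  have "finite {m. f m \<noteq> 0}" by (rule finite_subset[OF _ assms(1)]) (use assms(2) in auto)
  then show ?thesis by (intro exI[of _ "Abs_poly_mapping f"]) simp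
qed

text \<open>The integral form of \<open>pairing\<close>, for comparing, truncating and bounding
  degrees along rays.\<close>

definition ipair :: "int ^ 'n::finite \<Rightarrow> int ^ 'n \<Rightarrow> int" where
  "ipair m u = (\<Sum>i\<in>UNIV. m $ i * u $ i)"

lemma pairing_real_vec: "pairing m (real_vec u) = of_int (ipair m u)"
  by (simp add: pairing_def real_vec_def ipair_def inner_vec_def)

lemma ipair_add_left: "ipair (m + m') u = ipair m u + ipair m' u"
  and ipair_diff_left: "ipair (m - m') u = ipair m u - ipair m' u"
  and ipair_scale_left: "ipair (c *s m) u = c * ipair m u"
  and ipair_zero_left: "ipair 0 u = 0"
  by (simp_all add: ipair_def algebra_simps sum.distrib sum_subtractf sum_negf sum_distrib_left)

lemma ipair_sum_left: "ipair (\<Sum>i\<in>A. f i) u = (\<Sum>i\<in>A. ipair (f i) u)"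
  by (induction A rule: infinite_finite_induct) (simp_all add: ipair_zero_left ipair_add_left)

lemma real_vec_add: "real_vec (m + m') = real_vec m + real_vec m'"
  and real_vec_scale: "real_vec (c *s m) = of_int c *\<^sub>R real_vec m"
  and real_vec_diff: "real_vec (m - m') = real_vec m - real_vec m'"
  and real_vec_zero: "real_vec 0 = 0"
  by (simp_all add: real_vec_def vec_eq_iff)

lemma real_vec_inject: "real_vec m = real_vec m' \<longleftrightarrow> m = m'"
  by (simp add: real_vec_def vec_eq_iff)

lemma pairing_add_left: "pairing (m + m') v = pairing m v + pairing m' v"
  and pairing_diff_left: "pairing (m - m') v = pairing m v - pairing m' v"
  and pairing_zero_left: "pairing 0 v = 0"
  by (simp_all add: pairing_def real_vec_add real_vec_diff real_vec_scale real_vec_zero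
      inner_add_left inner_diff_left)

lemma pairing_sum_left: "pairing (\<Sum>i\<in>A. f i) v = (\<Sum>i\<in>A. pairing (f i) v)"
  by (induction A rule: infinite_finite_induct) (simp_all add: pairing_zero_left pairing_add_left)

lemma pairing_add_right: "pairing m (v + w) = pairing m v + pairing m w"
  and pairing_scaleR_right: "pairing m (c *\<^sub>R v) = c * pairing m v"
  and pairing_diff_right: "pairing m (v - w) = pairing m v - pairing m w"
  and pairing_zero_right: "pairing m 0 = 0"
  by (simp_all add: pairing_def inner_add_right inner_diff_right)

lemma linear_pairing: "linear (pairing m)"
  by (rule linearI) (simp_all add: pairing_add_right pairing_scaleR_right)

text \<open>
  A real linear functional off finitely many hyperplanes separates finitely many characters, and
  the leading terms of two Laurent polynomials with respect to it cannot cancel.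
\<close>

lemma laurent_no_zero_divisors:
  fixes f g :: "('n::finite) laurent"
  assumes "f * g = 0"
  shows "f = 0 \<or> g = 0"
proof (rule ccontr)
  assume nz: "\<not> (f = 0 \<or> g = 0)"
  define S where "S = (\<lambda>(a, b). a - b) ` ((Poly_Mapping.keys f \<union> Poly_Mapping.keys g) \<times>
    (Poly_Mapping.keys f \<union> Poly_Mapping.keys g)) - {0}"
  have finS: "finite S" by (auto simp: S_def)
  \<comment> \<open>A finite union of hyperplanes is a null set, so some \<open>v\<close> lies on
    none of them.\<close>
  have "negligible (\<Union>m\<in>S. {v. real_vec m \<bullet> v = 0})"
  proof (rule negligible_Union)
    fix t assume "t \<in> (\<lambda>m. {v. real_vec m \<bullet> v = 0}) ` S"
    then obtain m where m: "m \<in> S" "t = {v. real_vec m \<bullet> v = 0}" by auto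
    then have "real_vec m \<noteq> 0" using real_vec_inject[of m 0] by (auto simp: S_def real_vec_zero)
    then show "negligible t" unfolding m by (intro negligible_hyperplane) auto
  qed (use finS in auto)
  then have "(\<Union>m\<in>S. {v. real_vec m \<bullet> v = 0}) \<noteq> UNIV"
    using non_negligible_UNIV by metis
  then obtain v where v: "\<And>m. m \<in> S \<Longrightarrow> pairing m v \<noteq> 0" by (auto simp: pairing_def)
  have inj: "a = b" if "pairing a v = pairing b v" "a \<in> Poly_Mapping.keys f \<union> Poly_Mapping.keys g"
    "b \<in> Poly_Mapping.keys f \<union> Poly_Mapping.keys g" for a b
  proof (rule ccontr)
    assume "a \<noteq> b"
    then have "a - b \<in> S" using that unfolding S_def by force
    then show False using v[of "a - b"] that(1) by (simp add: pairing_diff_left)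
  qed
  have max: "\<exists>a\<in>Poly_Mapping.keys h. \<forall>b\<in>Poly_Mapping.keys h. pairing b v \<le> pairing a v"
    if "h \<noteq> 0" for h :: "'n laurent"
  proof -
    have fin: "finite (Poly_Mapping.keys h)" "Poly_Mapping.keys h \<noteq> {}" using that by auto
    define M where "M = Max ((\<lambda>b. pairing b v) ` Poly_Mapping.keys h)"
    have "M \<in> (\<lambda>b. pairing b v) ` Poly_Mapping.keys h" unfolding M_def using fin by (intro Max_in) auto
    then obtain a where a: "a \<in> Poly_Mapping.keys h" "pairing a v = M" by auto
    moreover have "\<forall>b\<in>Poly_Mapping.keys h. pairing b v \<le> M" unfolding M_def using fin by auto
    ultimately show ?thesis by metis
  qed
  obtain a where a: "a \<in> Poly_Mapping.keys f" "\<forall>k\<in>Poly_Mapping.keys f. pairing k v \<le> pairing a v"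
    using max[of f] nz by blast
  obtain b where b: "b \<in> Poly_Mapping.keys g" "\<forall>k\<in>Poly_Mapping.keys g. pairing k v \<le> pairing b v"
    using max[of g] nz by blast
  have "Poly_Mapping.lookup f k * Poly_Mapping.lookup g (a + b - k) =
      (if k = a then Poly_Mapping.lookup f a * Poly_Mapping.lookup g b else 0)"
    if k: "k \<in> Poly_Mapping.keys f" for k
  proof (cases "k = a")
    case False
    have "a + b - k \<notin> Poly_Mapping.keys g"
    proof
      assume l: "a + b - k \<in> Poly_Mapping.keys g"
      have "pairing (a + b - k) v \<le> pairing b v" using b l by blast
      then have "pairing a v \<le> pairing k v" by (simp add: pairing_diff_left pairing_add_left)
      then have "pairing k v = pairing a v" using a k by force
      then show False using inj[of k a] k a False by auto
    qed
    then show ?thesis using False by (simp add: in_keys_iff)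
  qed simp
  then have "Poly_Mapping.lookup (f * g) (a + b) =
      (\<Sum>k\<in>Poly_Mapping.keys f. if k = a then Poly_Mapping.lookup f a * Poly_Mapping.lookup g b else 0)"
    unfolding lookup_mult_keys by (intro sum.cong) auto
  also have "\<dots> = Poly_Mapping.lookup f a * Poly_Mapping.lookup g b" using a by simp
  also have "\<dots> \<noteq> 0" using a b by (simp add: in_keys_iff)
  finally show False using assms by simp
qed

section \<open>Smooth cones\<close>

text \<open>The \<open>bs\<close> are the basis of characters dual to the lattice basis
  \<open>b\<close>. In these coordinates the cone is the standard orthant of the coordinate subspace
  of \<open>I\<close>, so questions about its rays, dual monoid and faces become coordinate
  computations.\<close>

definition smooth_coords :: "('n::finite \<Rightarrow> int ^ 'n) \<Rightarrow> ('n \<Rightarrow> int ^ 'n) \<Rightarrow> 'n set \<Rightarrow>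
  (real ^ 'n) set \<Rightarrow> bool" where
  "smooth_coords b bs I \<sigma> \<longleftrightarrow> (\<forall>i j. ipair (bs i) (b j) = (if i = j then 1 else 0)) \<and>
    (\<forall>v. v = (\<Sum>i\<in>UNIV. pairing (bs i) v *\<^sub>R real_vec (b i))) \<and>
    \<sigma> = {v. (\<forall>i. 0 \<le> pairing (bs i) v) \<and> (\<forall>i. i \<notin> I \<longrightarrow> pairing (bs i) v = 0)}"

lemma dual_lattice_basis:
  fixes b :: "'n::finite \<Rightarrow> int ^ 'n"
  assumes "lattice_basis b"
  shows "\<exists>bs. (\<forall>i j. ipair (bs i) (b j) = (if i = j then 1 else 0)) \<and>
    (\<forall>v. v = (\<Sum>i\<in>UNIV. pairing (bs i) v *\<^sub>R real_vec (b i)))"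
proof -
  obtain C where C: "\<And>u. u = (\<Sum>i\<in>UNIV. C u i *s b i)"
    using assms unfolding lattice_basis_def by metis
  \<comment> \<open>Rows of the inverse of the matrix whose columns are the \<open>b i\<close>; they
    are integral because the standard basis vectors have integral expansions.\<close>
  define bs where "bs i = (\<chi> k. C (axis k 1) i)" for i
  have delta: "(\<Sum>i\<in>UNIV. bs i $ k * b i $ l) = (if k = l then 1 else 0)" for k l
    using arg_cong[OF C[of "axis k 1"], of "\<lambda>u. u $ l"]
    by (simp add: bs_def axis_def eq_commute)
  have u: "u = (\<Sum>i\<in>UNIV. ipair (bs i) u *s b i)" for u
  proof -
    have "(\<Sum>i\<in>UNIV. ipair (bs i) u * b i $ l) = u $ l" for l
    proof -
      have "(\<Sum>i\<in>UNIV. ipair (bs i) u * b i $ l) = (\<Sum>i\<in>UNIV. \<Sum>k\<in>UNIV. u $ k * (bs i $ k * b i $ l))"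
        by (simp add: ipair_def sum_distrib_left sum_distrib_right mult_ac)
      also have "\<dots> = (\<Sum>k\<in>UNIV. u $ k * (\<Sum>i\<in>UNIV. bs i $ k * b i $ l))"
        by (subst sum.swap) (simp add: sum_distrib_left)
      finally show ?thesis by (simp add: delta if_distrib[of "\<lambda>c. _ * c"] cong: if_cong)
    qed
    then show ?thesis by (simp add: vec_eq_iff)
  qed
  have "ipair (bs i) (b j) = (if i = j then 1 else 0)" for i j
  proof -
    \<comment> \<open>Both the pairings with \<open>bs\<close> and the Kronecker delta expand
      \<open>b j\<close>, so they agree by uniqueness.\<close>
    have "\<exists>!c. b j = (\<Sum>i\<in>UNIV. c i *s b i)" using assms by (simp add: lattice_basis_def)
    then obtain c0 where c0: "\<forall>c. b j = (\<Sum>i\<in>UNIV. c i *s b i) \<longrightarrow> c = c0" by (rule ex1E)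
    have "(\<lambda>i. ipair (bs i) (b j)) = c0" by (rule mp[OF spec[OF c0] u])
    moreover have "(\<lambda>i. if i = j then 1 else 0) = c0"
    proof (rule mp[OF spec[OF c0]])
      have "(if i = j then 1 else 0) *s b i = (if i = j then b i else 0)" for i by auto
      then show "b j = (\<Sum>i\<in>UNIV. (if i = j then 1 else 0) *s b i)" by simp
    qed
    ultimately show ?thesis by (simp add: fun_eq_iff)
  qed
  moreover have "v = (\<Sum>i\<in>UNIV. pairing (bs i) v *\<^sub>R real_vec (b i))" for v
  proof -
    have "(\<Sum>i\<in>UNIV. pairing (bs i) v * of_int (b i $ l)) = v $ l" for l
    proof -
      have "(\<Sum>i\<in>UNIV. pairing (bs i) v * of_int (b i $ l)) =
          (\<Sum>i\<in>UNIV. \<Sum>k\<in>UNIV. v $ k * of_int (bs i $ k * b i $ l))"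
        by (simp add: pairing_def real_vec_def inner_vec_def sum_distrib_left sum_distrib_right mult_ac)
      also have "\<dots> = (\<Sum>k\<in>UNIV. v $ k * of_int (\<Sum>i\<in>UNIV. bs i $ k * b i $ l))"
        by (subst sum.swap) (simp add: sum_distrib_left)
      finally show ?thesis
        by (simp add: delta if_distrib[of of_int] if_distrib[of "\<lambda>c. _ * c"] cong: if_cong)
    qed
    then show ?thesis by (simp add: vec_eq_iff real_vec_def)
  qed
  ultimately show ?thesis by blast
qed

lemma convex_cone_sum:
  assumes "convex_cone S" "\<And>i. i \<in> A \<Longrightarrow> f i \<in> S"
  shows "(\<Sum>i\<in>A. f i) \<in> S"
  using assms(2)
  by (induction A rule: infinite_finite_induct)
    (auto intro: convex_cone_add[OF assms(1)] convex_cone_contains_0[OF assms(1)])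

lemma convex_cone_hull_sing: "convex_cone hull {x} = {r *\<^sub>R x | r. 0 \<le> r}"
proof
  have "convex_cone {r *\<^sub>R x | r. 0 \<le> r}"
    unfolding convex_cone_iff
  proof (intro conjI ballI allI impI)
    show "0 \<in> {r *\<^sub>R x | r. 0 \<le> r}" by (auto intro!: exI[of _ 0])
  next
    fix y z assume "y \<in> {r *\<^sub>R x | r. 0 \<le> r}" "z \<in> {r *\<^sub>R x | r. 0 \<le> r}"
    then obtain r s where "y = r *\<^sub>R x" "z = s *\<^sub>R x" "0 \<le> r" "0 \<le> s" by auto
    then show "y + z \<in> {r *\<^sub>R x | r. 0 \<le> r}"
      by (auto simp flip: scaleR_add_left intro!: exI[of _ "r + s"])
  next
    fix y and c :: real assume "y \<in> {r *\<^sub>R x | r. 0 \<le> r}" "0 \<le> c"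
    then show "c *\<^sub>R y \<in> {r *\<^sub>R x | r. 0 \<le> r}" by auto
  qed
  then show "convex_cone hull {x} \<subseteq> {r *\<^sub>R x | r. 0 \<le> r}"
    by (intro hull_minimal) (auto intro!: exI[of _ 1])
  show "{r *\<^sub>R x | r. 0 \<le> r} \<subseteq> convex_cone hull {x}"
    using convex_cone_scaleR[OF convex_cone_convex_cone_hull] hull_inc by fastforce
qed

lemma smooth_cone_coords:
  assumes "lattice_basis b" "\<sigma> = convex_cone hull (real_vec ` b ` I)"
  shows "\<exists>bs. smooth_coords b bs I \<sigma>"
proof -
  obtain bs where dual: "\<And>i j. ipair (bs i) (b j) = (if i = j then 1 else 0)"
    and expand: "\<And>v. v = (\<Sum>i\<in>UNIV. pairing (bs i) v *\<^sub>R real_vec (b i))"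
    using dual_lattice_basis[OF assms(1)] by blast
  let ?S = "{v. (\<forall>i. 0 \<le> pairing (bs i) v) \<and> (\<forall>i. i \<notin> I \<longrightarrow> pairing (bs i) v = 0)}"
  have "convex_cone ?S"
    by (auto simp: convex_cone_iff pairing_add_right pairing_scaleR_right pairing_zero_right)
  then have "\<sigma> \<subseteq> ?S"
    unfolding assms(2) by (intro hull_minimal) (auto simp: pairing_real_vec dual)
  moreover have "?S \<subseteq> \<sigma>"
  proof
    fix v assume v: "v \<in> ?S"
    have "pairing (bs i) v *\<^sub>R real_vec (b i) \<in> convex_cone hull (real_vec ` b ` I)" for i
    proof (cases "i \<in> I")
      case True
      then show ?thesis using v
        by (intro convex_cone_scaleR[OF convex_cone_convex_cone_hull] hull_inc) auto
    next
      case False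
      then show ?thesis using v by (simp add: convex_cone_hull_contains_0)
    qed
    then have "(\<Sum>i\<in>UNIV. pairing (bs i) v *\<^sub>R real_vec (b i)) \<in> \<sigma>"
      unfolding assms(2) by (intro convex_cone_sum[OF convex_cone_convex_cone_hull])
    then show "v \<in> \<sigma>" using expand[of v] by simp
  qed
  ultimately show ?thesis using dual expand unfolding smooth_coords_def by blast
qed

context
  fixes b bs :: "'n::finite \<Rightarrow> int ^ 'n" and I \<sigma>
  assumes sc: "smooth_coords b bs I \<sigma>"
begin

lemma smooth_dual: "ipair (bs i) (b j) = (if i = j then 1 else 0)"
  using sc by (simp add: smooth_coords_def)

lemma smooth_expand: "v = (\<Sum>i\<in>UNIV. pairing (bs i) v *\<^sub>R real_vec (b i))"
  using sc unfolding smooth_coords_def by blast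

lemma smooth_mem: "v \<in> \<sigma> \<longleftrightarrow> (\<forall>i. 0 \<le> pairing (bs i) v) \<and> (\<forall>i. i \<notin> I \<longrightarrow> pairing (bs i) v = 0)"
  using sc by (auto simp: smooth_coords_def)

lemma smooth_gen_mem: "i \<in> I \<Longrightarrow> real_vec (b i) \<in> \<sigma>"
  by (auto simp: smooth_mem pairing_real_vec smooth_dual)

lemma smooth_expand_on: "v \<in> \<sigma> \<Longrightarrow> v = (\<Sum>i\<in>I. pairing (bs i) v *\<^sub>R real_vec (b i))"
  by (subst smooth_expand[of v], rule sum.mono_neutral_right) (auto simp: smooth_mem)

lemma smooth_convex_cone: "convex_cone \<sigma>"
  by (auto simp: convex_cone_iff smooth_mem pairing_add_right pairing_scaleR_right pairing_zero_right)

lemma smooth_closed: "closed \<sigma>"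
proof -
  have "\<sigma> = (\<Inter>i. {v. 0 \<le> real_vec (bs i) \<bullet> v}) \<inter> (\<Inter>i\<in>-I. {v. real_vec (bs i) \<bullet> v = 0})"
    by (auto simp: smooth_mem pairing_def)
  then show ?thesis
    by (auto intro!: closed_Int closed_INT closed_halfspace_ge closed_hyperplane)
qed

lemma smooth_basis_primitive: "primitive (b i)"
  unfolding primitive_def
proof (intro conjI allI impI)
  show "b i \<noteq> 0" using smooth_dual[of i i] by (auto simp: ipair_def)
next
  fix k w assume "b i = k *s w"
  then have "ipair (bs i) (k *s w) = 1" using smooth_dual[of i i] by simp
  then have "k * ipair (bs i) w = 1" by (simp add: ipair_def sum_distrib_left mult_ac)
  then show "\<bar>k\<bar> = 1" by (intro abs_zmult_eq_1[of k "ipair (bs i) w"]) simp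
qed

text \<open>The rays of an orthant are its coordinate axes. The sum of the other dual coordinates is
  a supporting functional that cuts out the axis of \<open>b i\<close>. Conversely, a ray on which
  the i-th coordinate is positive contains, being a face, the component along \<open>b i\<close> of
  its generator, so it is that axis, and primitivity fixes the generator.\<close>

lemma smooth_ray_gens: "ray_gens \<sigma> = b ` I"
proof
  show "b ` I \<subseteq> ray_gens \<sigma>"
  proof clarify
    fix i assume i: "i \<in> I"
    define m where "m = (\<Sum>j\<in>I - {i}. bs j)"
    have nn: "0 \<le> pairing m v" if "v \<in> \<sigma>" for v
      using that by (auto simp: m_def pairing_sum_left smooth_mem intro!: sum_nonneg)
    have "(\<sigma> \<inter> {v. real_vec m \<bullet> v = 0}) face_of \<sigma>"
      by (rule face_of_Int_supporting_hyperplane_ge)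
        (use nn smooth_convex_cone in \<open>auto simp: pairing_def convex_cone_def\<close>)
    moreover have "\<sigma> \<inter> {v. real_vec m \<bullet> v = 0} = convex_cone hull {real_vec (b i)}"
      unfolding convex_cone_hull_sing
    proof (intro equalityI subsetI)
      fix v assume v: "v \<in> \<sigma> \<inter> {v. real_vec m \<bullet> v = 0}"
      then have "(\<Sum>j\<in>I - {i}. pairing (bs j) v) = 0"
        by (simp add: m_def flip: pairing_sum_left pairing_def)
      then have "\<forall>j\<in>I - {i}. pairing (bs j) v = 0"
        using v by (subst (asm) sum_nonneg_eq_0_iff) (auto simp: smooth_mem)
      then have "pairing (bs j) v = 0" if "j \<noteq> i" for j using v that
        by (cases "j \<in> I") (auto simp: smooth_mem)
      then have "v = pairing (bs i) v *\<^sub>R real_vec (b i)"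
        by (subst smooth_expand[of v], subst sum.remove[of _ i]) (auto intro!: sum.neutral)
      then show "v \<in> {r *\<^sub>R real_vec (b i) | r. 0 \<le> r}" using v by (auto simp: smooth_mem)
    next
      fix v assume "v \<in> {r *\<^sub>R real_vec (b i) | r. 0 \<le> r}"
      then obtain r where r: "v = r *\<^sub>R real_vec (b i)" "0 \<le> r" by auto
      have "pairing m v = 0"
        unfolding m_def r pairing_scaleR_right pairing_real_vec ipair_sum_left smooth_dual
        by (simp add: sum.neutral)
      moreover have "v \<in> \<sigma>"
        using r smooth_gen_mem[OF i] convex_cone_scaleR[OF smooth_convex_cone] by blast
      ultimately show "v \<in> \<sigma> \<inter> {v. real_vec m \<bullet> v = 0}" by (simp add: pairing_def)
    qed
    ultimately show "b i \<in> ray_gens \<sigma>" using smooth_basis_primitive by (simp add: ray_gens_def)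
  qed
next
  show "ray_gens \<sigma> \<subseteq> b ` I"
  proof
    fix u assume "u \<in> ray_gens \<sigma>"
    then have u: "primitive u" and face: "{r *\<^sub>R real_vec u | r. 0 \<le> r} face_of \<sigma>"
      by (auto simp: ray_gens_def convex_cone_hull_sing)
    let ?x = "real_vec u" and ?F = "{r *\<^sub>R real_vec u | r. 0 \<le> r}"
    have xF: "?x \<in> ?F" by (auto intro!: exI[of _ 1])
    then have x: "?x \<in> \<sigma>" using face_of_imp_subset[OF face] by blast
    have "?x \<noteq> 0" using u real_vec_inject[of u 0] by (auto simp: primitive_def real_vec_zero)
    then obtain i where i: "pairing (bs i) ?x \<noteq> 0"
      using smooth_expand[of ?x] by (metis (no_types, lifting) scale_zero_left sum.neutral)
    then have iI: "i \<in> I" and pos: "0 < pairing (bs i) ?x"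
      using x unfolding smooth_mem by (blast, metis order_less_le)
    define y where "y = pairing (bs i) ?x *\<^sub>R real_vec (b i)"
    have y: "y \<in> \<sigma>" using pos smooth_gen_mem[OF iI] convex_cone_scaleR[OF smooth_convex_cone]
      by (simp add: y_def)
    have pz: "pairing (bs j) (?x - y) = (if j = i then 0 else pairing (bs j) ?x)" for j
      by (simp add: y_def pairing_diff_right pairing_scaleR_right pairing_real_vec smooth_dual)
    have z: "?x - y \<in> \<sigma>" using x by (auto simp: smooth_mem pz)
    have "y \<in> ?F"
    \<comment> \<open>\<open>?x\<close> is the midpoint of twice \<open>y\<close> and twice
      \<open>?x - y\<close>, to which the face property is applied. If these endpoints coincide the
      open segment is empty, and \<open>y\<close> is half of \<open>?x\<close>.\<close>
    proof (cases "?x - y = y")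
      case True
      then have "y = (1/2) *\<^sub>R ?x" by (simp add: algebra_simps flip: scaleR_2)
      then show ?thesis by (auto intro!: exI[of _ "1/2"])
    next
      case False
      have "?x \<in> open_segment (2 *\<^sub>R y) (2 *\<^sub>R (?x - y))"
        unfolding in_segment using False by (intro conjI exI[of _ "1/2"]) auto
      then have "2 *\<^sub>R y \<in> ?F"
        using face_ofD[OF face _ _ _ xF, of "2 *\<^sub>R y" "2 *\<^sub>R (?x - y)"] y z convex_cone_scaleR[OF smooth_convex_cone, of 2] by simp
      then obtain r where "2 *\<^sub>R y = r *\<^sub>R ?x" "0 \<le> r" by auto
      then have "y = (r/2) *\<^sub>R ?x" by (metis (no_types) divide_inverse_commute inverse_eq_divide
            scaleR_half_double scaleR_scaleR scaleR_2)
      then show ?thesis using \<open>0 \<le> r\<close> by (auto intro!: exI[of _ "r/2"])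
    qed
    then obtain r where r: "y = r *\<^sub>R ?x" by auto
    have piy: "pairing (bs j) y = (if j = i then pairing (bs i) ?x else 0)" for j
      by (simp add: y_def pairing_scaleR_right pairing_real_vec smooth_dual)
    have "r \<noteq> 0" using r piy[of i] pos by (auto simp: pairing_zero_right)
    then have "pairing (bs j) ?x = 0" if "j \<noteq> i" for j
      using piy[of j] that unfolding r by (simp add: pairing_scaleR_right)
    then have "?x = pairing (bs i) ?x *\<^sub>R real_vec (b i)"
      by (subst smooth_expand[of ?x], subst sum.remove[of _ i]) (auto intro!: sum.neutral)
    then have "u = ipair (bs i) u *s b i"
      by (simp add: pairing_real_vec flip: real_vec_scale real_vec_inject)
    moreover from this have "\<bar>ipair (bs i) u\<bar> = 1" using u unfolding primitive_def by blast
    then have "ipair (bs i) u = 1" using pos by (simp add: pairing_real_vec)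
    ultimately have "u = b i" by simp
    then show "u \<in> b ` I" using iI by blast
  qed
qed

lemma smooth_dual_monoid: "dual_monoid \<sigma> = {m. \<forall>u\<in>ray_gens \<sigma>. 0 \<le> ipair m u}"
proof (intro equalityI subsetI)
  fix m assume "m \<in> dual_monoid \<sigma>"
  then show "m \<in> {m. \<forall>u\<in>ray_gens \<sigma>. 0 \<le> ipair m u}"
    using smooth_gen_mem
      by (auto simp: smooth_ray_gens dual_monoid_def pairing_real_vec) (metis of_int_0_le_iff pairing_real_vec)
next
  fix m assume m: "m \<in> {m. \<forall>u\<in>ray_gens \<sigma>. 0 \<le> ipair m u}"
  have "0 \<le> pairing m v" if "v \<in> \<sigma>" for v
  proof -
    have "pairing m v = (\<Sum>i\<in>I. pairing (bs i) v * of_int (ipair m (b i)))"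
      by (subst smooth_expand_on[OF that]) (simp add: linear_sum[OF linear_pairing] pairing_scaleR_right pairing_real_vec)
    also have "\<dots> \<ge> 0" using m that by (intro sum_nonneg) (auto simp: smooth_ray_gens smooth_mem)
    finally show ?thesis .
  qed
  then show "m \<in> dual_monoid \<sigma>" by (simp add: dual_monoid_def)
qed

text \<open>Smoothness enters here: the ray generators are part of a lattice basis, so a combination
  of the dual basis takes any prescribed integers on them.\<close>

lemma smooth_interpolate: "\<exists>m. \<forall>u\<in>ray_gens \<sigma>. ipair m u = D u"
proof (intro exI ballI)
  fix u assume "u \<in> ray_gens \<sigma>"
  then obtain i where i: "i \<in> I" "u = b i" by (auto simp: smooth_ray_gens)
  have "ipair (\<Sum>j\<in>I. D (b j) *s bs j) u = (\<Sum>j\<in>I. if j = i then D (b i) else 0)"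
    unfolding i ipair_sum_left by (intro sum.cong) (auto simp: ipair_scale_left smooth_dual)
  also have "\<dots> = D u" using i by simp
  finally show "ipair (\<Sum>j\<in>I. D (b j) *s bs j) u = D u" .
qed

lemma smooth_linear_eq:
  assumes "linear f" "linear g" "\<And>u. u \<in> ray_gens \<sigma> \<Longrightarrow> f (real_vec u) = g (real_vec u)" "v \<in> \<sigma>"
  shows "f v = (g v :: real)"
  using assms(3)
  by (subst (1 2) smooth_expand_on[OF assms(4)])
    (simp add: linear_sum[OF assms(1)] linear_sum[OF assms(2)] linear_cmul[OF assms(1)]
      linear_cmul[OF assms(2)] smooth_ray_gens)

end

section \<open>Smooth fans\<close>

definition all_rays :: "(real ^ 'n::finite) set set \<Rightarrow> (int ^ 'n) set" where
  "all_rays \<Sigma> = (\<Union>\<sigma>\<in>\<Sigma>. ray_gens \<sigma>)"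

lemma dual_monoid_zero: "dual_monoid {0} = UNIV"
  by (auto simp: dual_monoid_def pairing_zero_right)

context
  fixes \<Sigma> :: "(real ^ 'n::finite) set set"
  assumes sf: "smooth_fan \<Sigma>"
begin

lemma fan_coords:
  assumes "\<sigma> \<in> \<Sigma>" obtains b bs I where "smooth_coords b bs I \<sigma>"
proof -
  obtain b I where "lattice_basis b" "\<sigma> = convex_cone hull (real_vec ` b ` I)"
    using sf assms unfolding smooth_fan_def by blast
  then show ?thesis using smooth_cone_coords that by blast
qed

lemma fan_finite: "finite \<Sigma>"
  using sf by (simp add: smooth_fan_def fan_def)

lemma fan_face: "\<tau> \<in> \<Sigma> \<Longrightarrow> \<sigma> \<in> \<Sigma> \<Longrightarrow> (\<sigma> \<inter> \<tau>) face_of \<sigma> \<and> (\<sigma> \<inter> \<tau>) face_of \<tau>"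
  using sf unfolding smooth_fan_def fan_def by blast

lemma fan_Int:
  assumes "\<tau> \<in> \<Sigma>" "\<sigma> \<in> \<Sigma>" shows "\<sigma> \<inter> \<tau> \<in> \<Sigma>"
proof -
  obtain b bs I where 1: "smooth_coords b bs I \<sigma>" by (rule fan_coords[OF assms(2)])
  obtain b' bs' I' where 2: "smooth_coords b' bs' I' \<tau>" by (rule fan_coords[OF assms(1)])
  have "0 \<in> \<sigma> \<inter> \<tau>" by (simp add: smooth_mem[OF 1] smooth_mem[OF 2] pairing_zero_right)
  then have "\<sigma> \<inter> \<tau> \<noteq> {}" by blast
  then show ?thesis using sf fan_face[OF assms] assms unfolding smooth_fan_def fan_def by blast
qed

lemma fan_zero: "{0} \<in> \<Sigma>"
proof -
  obtain \<sigma> where s: "\<sigma> \<in> \<Sigma>" using sf by (auto simp: smooth_fan_def fan_def)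
  obtain b bs I where c: "smooth_coords b bs I \<sigma>" by (rule fan_coords[OF s])
  note cone = smooth_convex_cone[OF c]
  have pointed: "\<sigma> \<inter> uminus ` \<sigma> = {0}" using sf s by (simp add: smooth_fan_def fan_def)
  have "{0} face_of \<sigma>"
    unfolding face_of_def
  proof (intro conjI ballI impI)
    show "{0} \<subseteq> \<sigma>" using convex_cone_contains_0[OF cone] by simp
    fix x y z assume x: "x \<in> \<sigma>" and y: "y \<in> \<sigma>" and z: "z \<in> {0}" and seg: "z \<in> open_segment x y"
    then obtain u where u: "0 < u" "u < 1" "0 = (1 - u) *\<^sub>R x + u *\<^sub>R y" and ne: "x \<noteq> y"
      by (auto simp: in_segment)
    have "u *\<^sub>R y \<in> \<sigma>" "(1 - u) *\<^sub>R x \<in> \<sigma>" using u x y convex_cone_scaleR[OF cone] by auto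
    \<comment> \<open>The two parts of a convex combination equal to 0 are opposite members of the
      cone, so pointedness makes both vanish.\<close>
    moreover have "(1 - u) *\<^sub>R x = - (u *\<^sub>R y)" using u(3) by (simp add: eq_neg_iff_add_eq_0)
    ultimately have "(1 - u) *\<^sub>R x \<in> \<sigma> \<inter> uminus ` \<sigma>" by auto
    then have "(1 - u) *\<^sub>R x = 0" "u *\<^sub>R y = 0"
      using pointed \<open>(1 - u) *\<^sub>R x = - (u *\<^sub>R y)\<close> by auto
    then show "x \<in> {0}" "y \<in> {0}" using u by auto
  qed auto
  then show ?thesis using sf s unfolding smooth_fan_def fan_def by blast
qed

lemma ray_gens_mem:
  assumes "\<sigma> \<in> \<Sigma>" "u \<in> ray_gens \<sigma>"
  shows "real_vec u \<in> \<sigma>"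
proof -
  obtain b bs I where c: "smooth_coords b bs I \<sigma>" by (rule fan_coords[OF assms(1)])
  show ?thesis using assms(2) smooth_gen_mem[OF c] by (auto simp: smooth_ray_gens[OF c])
qed

lemma finite_ray_gens:
  assumes "\<sigma> \<in> \<Sigma>"
  shows "finite (ray_gens \<sigma>)"
proof -
  obtain b bs I where c: "smooth_coords b bs I \<sigma>" by (rule fan_coords[OF assms])
  show ?thesis by (simp add: smooth_ray_gens[OF c])
qed

lemma finite_all_rays: "finite (all_rays \<Sigma>)"
  using fan_finite finite_ray_gens by (auto simp: all_rays_def)

lemma ray_gens_mono:
  assumes "\<tau> \<in> \<Sigma>" "\<sigma> \<in> \<Sigma>" "\<tau> \<subseteq> \<sigma>" shows "ray_gens \<tau> \<subseteq> ray_gens \<sigma>"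
  using fan_face[OF assms(1,2)] assms(3) by (auto simp: ray_gens_def Int_absorb1 intro: face_of_trans)

text \<open>The ray is a face of \<sigma> contained in \<tau>, hence a face of the common face of
  the two cones, hence of \<tau>.\<close>

lemma ray_gens_of_mem:
  assumes "\<tau> \<in> \<Sigma>" "\<sigma> \<in> \<Sigma>" "u \<in> ray_gens \<sigma>" "real_vec u \<in> \<tau>" shows "u \<in> ray_gens \<tau>"
proof -
  obtain b bs I where c: "smooth_coords b bs I \<tau>" by (rule fan_coords[OF assms(1)])
  have face: "(convex_cone hull {real_vec u}) face_of \<sigma>" using assms by (simp add: ray_gens_def)
  have "convex_cone hull {real_vec u} \<subseteq> \<tau>"
    using assms(4) smooth_convex_cone[OF c] by (intro hull_minimal) auto
  moreover have "convex_cone hull {real_vec u} \<subseteq> \<sigma>" by (rule face_of_imp_subset[OF face])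
  ultimately have "(convex_cone hull {real_vec u}) face_of (\<sigma> \<inter> \<tau>)"
    by (intro face_of_subset[OF face]) auto
  then show ?thesis
    using face_of_trans fan_face[OF assms(1,2)] assms(3) by (auto simp: ray_gens_def)
qed

lemma dual_monoid_rays: "\<sigma> \<in> \<Sigma> \<Longrightarrow> dual_monoid \<sigma> = {m. \<forall>u\<in>ray_gens \<sigma>. 0 \<le> ipair m u}"
  by (rule fan_coords) (auto simp: smooth_dual_monoid)

lemma ray_interpolate: "\<sigma> \<in> \<Sigma> \<Longrightarrow> \<exists>m. \<forall>u\<in>ray_gens \<sigma>. ipair m u = D u"
  by (rule fan_coords) (auto intro: smooth_interpolate)

lemma linear_eq_on_cone:
  assumes "\<sigma> \<in> \<Sigma>" "linear f" "linear g" "\<And>u. u \<in> ray_gens \<sigma> \<Longrightarrow> f (real_vec u) = (g (real_vec u) :: real)"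
    "v \<in> \<sigma>"
  shows "f v = g v"
proof -
  obtain b bs I where "smooth_coords b bs I \<sigma>" by (rule fan_coords[OF assms(1)])
  from smooth_linear_eq[OF this assms(2,3) _ assms(5)] assms(4) show ?thesis by blast
qed

lemma inverted_chars_rays:
  assumes "\<sigma> \<in> \<Sigma>" "\<tau> \<in> \<Sigma>"
  shows "inverted_chars \<sigma> \<tau> = {m \<in> dual_monoid \<sigma>. \<forall>u\<in>ray_gens \<tau>. ipair m u = 0}"
proof -
  have "(\<forall>v\<in>\<tau>. pairing m v = 0) \<longleftrightarrow> (\<forall>u\<in>ray_gens \<tau>. ipair m u = 0)" for m
  proof
    assume a: "\<forall>v\<in>\<tau>. pairing m v = 0"
    show "\<forall>u\<in>ray_gens \<tau>. ipair m u = 0"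
    proof
      fix u assume "u \<in> ray_gens \<tau>"
      then have "pairing m (real_vec u) = 0" using a ray_gens_mem[OF assms(2)] by blast
      then show "ipair m u = 0" by (simp add: pairing_real_vec)
    qed
  next
    assume "\<forall>u\<in>ray_gens \<tau>. ipair m u = 0"
    then show "\<forall>v\<in>\<tau>. pairing m v = 0"
      using linear_eq_on_cone[OF assms(2) linear_pairing linear_zero, of m]
        by (simp add: pairing_real_vec)
  qed
  then show ?thesis by (auto simp: inverted_chars_def)
qed

text \<open>Interpolate 0 on the rays of \<tau> and 1 on the other rays of \<sigma>. The resulting
  character is a unit on the chart of \<tau> and vanishes along the divisors of the remaining rays,
  so a high power of it clears poles along them.\<close>

lemma separating_char:
  assumes "\<sigma> \<in> \<Sigma>" "\<tau> \<in> \<Sigma>" "\<tau> \<subseteq> \<sigma>"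
  shows "\<exists>m\<in>inverted_chars \<sigma> \<tau>. \<forall>u\<in>ray_gens \<sigma> - ray_gens \<tau>. 1 \<le> ipair m u"
proof -
  obtain m where m: "\<forall>u\<in>ray_gens \<sigma>. ipair m u = (if u \<in> ray_gens \<tau> then 0 else 1)"
    using ray_interpolate[OF assms(1), of "\<lambda>u. if u \<in> ray_gens \<tau> then 0 else 1"] by blast
  then have "m \<in> inverted_chars \<sigma> \<tau>"
    using ray_gens_mono[OF assms(2,1,3)]
    by (auto simp: inverted_chars_rays[OF assms(1,2)] dual_monoid_rays[OF assms(1)])
  then show ?thesis using m by (intro bexI[of _ m]) auto
qed

lemma zero_subset: "\<sigma> \<in> \<Sigma> \<Longrightarrow> {0} \<subseteq> \<sigma>"
  by (rule fan_coords) (auto simp: smooth_mem pairing_zero_right)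

text \<open>A finite union of closed cones with empty interior has empty interior, so the
  full-dimensional cones alone cover the space. One of them, \<rho>, contains a relative interior
  point of \<sigma>; the face that \<rho> cuts out of \<sigma> then meets the relative interior and
  is all of \<sigma>. This is needed because \<open>ample\<close> speaks only of full-dimensional
  cones.\<close>

lemma cone_in_full_cone:
  assumes "complete_fan \<Sigma>" "\<sigma> \<in> \<Sigma>"
  shows "\<exists>\<rho>\<in>\<Sigma>. \<sigma> \<subseteq> \<rho> \<and> interior \<rho> \<noteq> {}"
proof -
  obtain b bs I where c: "smooth_coords b bs I \<sigma>" by (rule fan_coords[OF assms(2)])
  have closed: "closed \<rho>" if "\<rho> \<in> \<Sigma>" for \<rho> by (rule fan_coords[OF that]) (rule smooth_closed)
  have full: "\<Union>{\<rho>\<in>\<Sigma>. interior \<rho> \<noteq> {}} = UNIV"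
  proof -
    have thin: "interior (\<Union>A) = {}"
      if "finite A" "\<forall>a\<in>A. closed a \<and> interior a = {}" for A :: "(real ^ 'n) set set"
      using that by (induction A rule: finite_induct) (auto simp: interior_closed_Un_empty_interior)
    have "- \<Union>{\<rho>\<in>\<Sigma>. interior \<rho> \<noteq> {}} \<subseteq> interior (\<Union>{\<rho>\<in>\<Sigma>. interior \<rho> = {}})"
    proof (rule interior_maximal)
      show "- \<Union>{\<rho>\<in>\<Sigma>. interior \<rho> \<noteq> {}} \<subseteq> \<Union>{\<rho>\<in>\<Sigma>. interior \<rho> = {}}"
      proof
        fix x assume x: "x \<in> - \<Union>{\<rho>\<in>\<Sigma>. interior \<rho> \<noteq> {}}"
        have "x \<in> \<Union>\<Sigma>" using assms(1) by (simp add: complete_fan_def)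
        then show "x \<in> \<Union>{\<rho>\<in>\<Sigma>. interior \<rho> = {}}" using x by blast
      qed
      show "open (- \<Union>{\<rho>\<in>\<Sigma>. interior \<rho> \<noteq> {}})"
        using fan_finite closed by (intro open_Compl closed_Union) auto
    qed
    also have "\<dots> = {}" using fan_finite closed by (intro thin) auto
    finally show ?thesis by auto
  qed
  have conv: "convex \<sigma>" "\<sigma> \<noteq> {}" using smooth_convex_cone[OF c] by (auto simp: convex_cone_def)
  then obtain x where x: "x \<in> rel_interior \<sigma>" using rel_interior_eq_empty by blast
  have "x \<in> \<Union>{\<rho>\<in>\<Sigma>. interior \<rho> \<noteq> {}}" by (simp add: full)
  then obtain \<rho> where r: "\<rho> \<in> \<Sigma>" "interior \<rho> \<noteq> {}" "x \<in> \<rho>" by blast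
  have "x \<in> \<sigma>" using x rel_interior_subset by blast
  then have "\<sigma> \<subseteq> \<sigma> \<inter> \<rho>"
    using subset_of_face_of[OF conjunct1[OF fan_face[OF r(1) assms(2)]] order_refl] r(3) x
    by (auto simp: disjnt_iff)
  then show ?thesis using r by blast
qed

end

section \<open>Chart rings and their points\<close>

lemma ring_subset_sum: "ring_subset R \<Longrightarrow> (\<And>i. i \<in> A \<Longrightarrow> f i \<in> R) \<Longrightarrow> sum f A \<in> R"
  by (induction A rule: infinite_finite_induct) (auto simp: ring_subset_def)

lemma chart_ring_simps [simp]:
  "mult (chart_ring R \<sigma>) = (*)" "one (chart_ring R \<sigma>) = 1" "zero (chart_ring R \<sigma>) = 0"
  "add (chart_ring R \<sigma>) = (+)"
  by (simp_all add: chart_ring_def)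

lemma chart_ring_mem: "f \<in> carrier (chart_ring R \<sigma>) \<longleftrightarrow>
    (\<forall>m. Poly_Mapping.lookup f m \<in> R \<and> (Poly_Mapping.lookup f m \<noteq> 0 \<longrightarrow> m \<in> dual_monoid \<sigma>))"
  by (auto simp: chart_ring_def in_keys_iff subset_iff)

lemma dual_monoid_add: "m \<in> dual_monoid \<sigma> \<Longrightarrow> m' \<in> dual_monoid \<sigma> \<Longrightarrow> m + m' \<in> dual_monoid \<sigma>"
  by (auto simp: dual_monoid_def pairing_add_left)

lemma zero_in_dual_monoid: "0 \<in> dual_monoid \<sigma>"
  by (auto simp: dual_monoid_def pairing_zero_left)

lemma dual_monoid_antimono: "\<tau> \<subseteq> \<sigma> \<Longrightarrow> dual_monoid \<sigma> \<subseteq> dual_monoid \<tau>"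
  by (auto simp: dual_monoid_def)

lemma single_in_chart_ring:
  "ring_subset R \<Longrightarrow> r \<in> R \<Longrightarrow> m \<in> dual_monoid \<sigma> \<Longrightarrow> Poly_Mapping.single m r \<in> carrier (chart_ring R \<sigma>)"
  by (auto simp: chart_ring_mem lookup_single when_def ring_subset_def)

lemma chart_ring_add:
  "ring_subset R \<Longrightarrow> f \<in> carrier (chart_ring R \<sigma>) \<Longrightarrow> g \<in> carrier (chart_ring R \<sigma>) \<Longrightarrow>
    f + g \<in> carrier (chart_ring R \<sigma>)"
  unfolding chart_ring_mem ring_subset_def lookup_add by (metis add.right_neutral add.left_neutral)

lemma chart_ring_uminus:
  "ring_subset R \<Longrightarrow> f \<in> carrier (chart_ring R \<sigma>) \<Longrightarrow> - f \<in> carrier (chart_ring R \<sigma>)"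
  unfolding chart_ring_mem ring_subset_def lookup_uminus by (simp, blast)

lemma chart_ring_mult:
  fixes \<sigma> :: "(real ^ 'n::finite) set"
  assumes "ring_subset R" "f \<in> carrier (chart_ring R \<sigma>)" "g \<in> carrier (chart_ring R \<sigma>)"
  shows "f * g \<in> carrier (chart_ring R \<sigma>)"
  unfolding chart_ring_mem
proof (intro allI conjI impI)
  fix m
  show "Poly_Mapping.lookup (f * g) m \<in> R"
    unfolding lookup_mult_keys using assms
    by (intro ring_subset_sum) (auto simp: ring_subset_def chart_ring_mem)
  assume "Poly_Mapping.lookup (f * g) m \<noteq> 0"
  then obtain k where "Poly_Mapping.lookup f k * Poly_Mapping.lookup g (m - k) \<noteq> 0"
    unfolding lookup_mult_keys by (meson sum.not_neutral_contains_not_neutral)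
  then have "k \<in> dual_monoid \<sigma>" "m - k \<in> dual_monoid \<sigma>" using assms by (auto simp: chart_ring_mem)
  then show "m \<in> dual_monoid \<sigma>" using dual_monoid_add[of k \<sigma> "m - k"] by simp
qed

lemma chart_ring_one: "ring_subset R \<Longrightarrow> 1 \<in> carrier (chart_ring R \<sigma>)"
  and chart_ring_zero: "ring_subset R \<Longrightarrow> 0 \<in> carrier (chart_ring R \<sigma>)"
  by (auto simp: chart_ring_mem lookup_one when_def ring_subset_def zero_in_dual_monoid)

lemma chart_ring_sum:
  "ring_subset R \<Longrightarrow> (\<And>i. i \<in> A \<Longrightarrow> f i \<in> carrier (chart_ring R \<sigma>)) \<Longrightarrow> sum f A \<in> carrier (chart_ring R \<sigma>)"
  by (induction A rule: infinite_finite_induct) (auto simp: chart_ring_zero chart_ring_add)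

lemma chart_ring_power:
  "ring_subset R \<Longrightarrow> f \<in> carrier (chart_ring R \<sigma>) \<Longrightarrow> f ^ k \<in> carrier (chart_ring R \<sigma>)"
  by (induction k) (auto simp: chart_ring_one chart_ring_mult)

lemma chart_ring_antimono: "\<tau> \<subseteq> \<sigma> \<Longrightarrow> carrier (chart_ring R \<sigma>) \<subseteq> carrier (chart_ring R \<tau>)"
  using dual_monoid_antimono[of \<tau> \<sigma>] unfolding subset_iff chart_ring_mem by blast

lemma chart_cring: "ring_subset R \<Longrightarrow> cring (chart_ring R \<sigma>)"
proof (rule cringI)
  assume R: "ring_subset R"
  show "abelian_group (chart_ring R \<sigma>)"
  proof (rule abelian_groupI)
    fix f assume "f \<in> carrier (chart_ring R \<sigma>)"
    then show "\<exists>g\<in>carrier (chart_ring R \<sigma>). g \<oplus>\<^bsub>chart_ring R \<sigma>\<^esub> f = \<zero>\<^bsub>chart_ring R \<sigma>\<^esub>"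
      using chart_ring_uminus[OF R] by (intro bexI[of _ "- f"]) auto
  qed (auto simp: chart_ring_add[OF R] chart_ring_zero[OF R] algebra_simps)
  show "comm_monoid (chart_ring R \<sigma>)"
    by (rule comm_monoidI) (auto simp: chart_ring_mult[OF R] chart_ring_one[OF R] algebra_simps)
qed (simp add: algebra_simps)

lemma ev_superset:
  assumes "finite K" "Poly_Mapping.keys f \<subseteq> K"
  shows "ev x f = (\<Sum>m\<in>K. Poly_Mapping.lookup f m * x m)"
  unfolding ev_def by (rule sum.mono_neutral_left) (use assms in \<open>auto simp: in_keys_iff\<close>)

lemma ev_add: "ev x (f + g) = ev x f + ev x g"
proof -
  let ?K = "Poly_Mapping.keys f \<union> Poly_Mapping.keys g"
  have K: "finite ?K" "Poly_Mapping.keys (f + g) \<subseteq> ?K" using keys_add[of f g] by auto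
  show ?thesis
    by (simp add: ev_superset[OF K] ev_superset[OF K(1), of f] ev_superset[OF K(1), of g]
        lookup_add distrib_right sum.distrib)
qed

lemma ev_zero [simp]: "ev x 0 = 0" by (simp add: ev_def)

lemma ev_single [simp]: "ev x (Poly_Mapping.single m c) = c * x m" by (simp add: ev_def)

lemma ev_sum: "ev x (sum f A) = (\<Sum>a\<in>A. ev x (f a))"
  by (induction A rule: infinite_finite_induct) (simp_all add: ev_add)

lemma ev_one: "x \<in> chart_points \<sigma> \<Longrightarrow> ev x 1 = 1"
  using ev_single[of x 0 1] by (simp add: chart_points_def)

lemma ev_mult:
  assumes "x \<in> chart_points \<sigma>" "f \<in> carrier (chart_ring R \<sigma>)" "g \<in> carrier (chart_ring R \<sigma>)"
  shows "ev x (f * g) = ev x f * ev x g"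
proof -
  have x: "x (k + l) = x k * x l" if "k \<in> Poly_Mapping.keys f" "l \<in> Poly_Mapping.keys g" for k l
  proof -
    have "k \<in> dual_monoid \<sigma>" "l \<in> dual_monoid \<sigma>" using that assms by (auto simp: chart_ring_def)
    then show ?thesis using assms(1) by (simp add: chart_points_def)
  qed
  have "ev x (f * g) = ev x ((\<Sum>k\<in>Poly_Mapping.keys f. Poly_Mapping.single k (Poly_Mapping.lookup f k)) *
      (\<Sum>l\<in>Poly_Mapping.keys g. Poly_Mapping.single l (Poly_Mapping.lookup g l)))"
    by (simp flip: laurent_expand)
  also have "\<dots> = (\<Sum>k\<in>Poly_Mapping.keys f. \<Sum>l\<in>Poly_Mapping.keys g.
      (Poly_Mapping.lookup f k * x k) * (Poly_Mapping.lookup g l * x l))"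
    by (simp add: sum_product mult_single ev_sum x mult_ac)
  also have "\<dots> = ev x f * ev x g" by (simp add: ev_def sum_product)
  finally show ?thesis .
qed

lemma ev_power:
  assumes "ring_subset R" "x \<in> chart_points \<sigma>" "f \<in> carrier (chart_ring R \<sigma>)"
  shows "ev x (f ^ k) = ev x f ^ k"
  by (induction k) (use assms in \<open>simp_all add: ev_one ev_mult chart_ring_power\<close>)

lemma ev_incl: "f \<in> carrier (chart_ring R \<sigma>) \<Longrightarrow> ev (incl \<sigma> x) f = ev x f"
  unfolding ev_def by (intro sum.cong) (auto simp: chart_ring_mem incl_def in_keys_iff)

section \<open>Modules with coordinates\<close>

text \<open>Free modules presented by a basis \<open>e\<close> and a coordinate map \<kappa>, the
  common form of \<open>sum_sheaf\<close> and \<open>divisor_sheaf\<close> over a chart. Passing to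
  \<kappa> turns sums in an abstract module into sums of Laurent polynomials.\<close>

locale coord_module =
  fixes R :: "complex set" and \<sigma> :: "(real ^ 'n::finite) set" and M :: "('n laurent, 'a) module"
    and J :: "nat set" and \<kappa> :: "'a \<Rightarrow> nat \<Rightarrow> 'n laurent" and e :: "nat \<Rightarrow> 'a"
  assumes ring: "ring_subset R" and mod: "Module.module (chart_ring R \<sigma>) M" and fin: "finite J"
    and e_mem: "\<And>j. j \<in> J \<Longrightarrow> e j \<in> carrier M"
    and coord_mem: "\<And>s j. s \<in> carrier M \<Longrightarrow> j \<in> J \<Longrightarrow> \<kappa> s j \<in> carrier (chart_ring R \<sigma>)"
    and coord_add: "\<And>s t j. s \<in> carrier M \<Longrightarrow> t \<in> carrier M \<Longrightarrow> j \<in> J \<Longrightarrow> \<kappa> (s \<oplus>\<^bsub>M\<^esub> t) j = \<kappa> s j + \<kappa> t j"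
    and coord_smult: "\<And>f s j. f \<in> carrier (chart_ring R \<sigma>) \<Longrightarrow> s \<in> carrier M \<Longrightarrow> j \<in> J \<Longrightarrow>
      \<kappa> (f \<odot>\<^bsub>M\<^esub> s) j = f * \<kappa> s j"
    and coord_inject: "\<And>s t. s \<in> carrier M \<Longrightarrow> t \<in> carrier M \<Longrightarrow> (\<And>j. j \<in> J \<Longrightarrow> \<kappa> s j = \<kappa> t j) \<Longrightarrow> s = t"
    and coord_e: "\<And>i j. i \<in> J \<Longrightarrow> j \<in> J \<Longrightarrow> \<kappa> (e j) i = (if i = j then 1 else 0)"
begin

sublocale Module.module "chart_ring R \<sigma>" M by (rule mod)

lemma coord_zero: "j \<in> J \<Longrightarrow> \<kappa> \<zero>\<^bsub>M\<^esub> j = 0"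
  using coord_add[of "\<zero>\<^bsub>M\<^esub>" "\<zero>\<^bsub>M\<^esub>" j] by simp

lemma coord_finsum:
  assumes "finite A" "\<And>i. i \<in> A \<Longrightarrow> g i \<in> carrier M" "j \<in> J"
  shows "\<kappa> (\<Oplus>\<^bsub>M\<^esub>i\<in>A. g i) j = (\<Sum>i\<in>A. \<kappa> (g i) j)"
  using assms(1,2)
proof (induction A rule: finite_induct)
  case (insert x A)
  then have "(\<Oplus>\<^bsub>M\<^esub>i\<in>insert x A. g i) = g x \<oplus>\<^bsub>M\<^esub> (\<Oplus>\<^bsub>M\<^esub>i\<in>A. g i)"
    by (intro M.finsum_insert) auto
  moreover have "(\<Oplus>\<^bsub>M\<^esub>i\<in>A. g i) \<in> carrier M" using insert by (intro M.finsum_closed) auto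
  ultimately show ?case using insert coord_add assms(3) by simp
qed (simp add: coord_zero assms)

lemma coord_lincomb:
  assumes "finite A" "\<And>i. i \<in> A \<Longrightarrow> c i \<in> carrier (chart_ring R \<sigma>)" "\<And>i. i \<in> A \<Longrightarrow> g i \<in> carrier M" "j \<in> J"
  shows "\<kappa> (\<Oplus>\<^bsub>M\<^esub>i\<in>A. c i \<odot>\<^bsub>M\<^esub> g i) j = (\<Sum>i\<in>A. c i * \<kappa> (g i) j)"
  using assms by (subst coord_finsum) (auto simp: coord_smult intro!: sum.cong)

lemma lincomb_mem:
  assumes "\<And>i. i \<in> A \<Longrightarrow> c i \<in> carrier (chart_ring R \<sigma>)" "\<And>i. i \<in> A \<Longrightarrow> g i \<in> carrier M"
  shows "(\<Oplus>\<^bsub>M\<^esub>i\<in>A. c i \<odot>\<^bsub>M\<^esub> g i) \<in> carrier M"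
  using assms by (intro M.finsum_closed) auto

lemma inj_on_e: "inj_on e J"
proof (rule inj_onI)
  fix i j assume "i \<in> J" "j \<in> J" "e i = e j"
  then show "i = j" using coord_e[of i i] coord_e[of i j] by (auto split: if_splits)
qed

lemma finitely_generated_coords: "finitely_generated (chart_ring R \<sigma>) M"
  unfolding finitely_generated_def
proof (intro exI[of _ "e ` J"] conjI ballI)
  fix s assume s: "s \<in> carrier M"
  \<comment> \<open>\<open>finitely_generated\<close> indexes coefficients by the generators
    themselves, so the coordinates are carried over along the injection \<open>e\<close>.\<close>
  define c where "c g = \<kappa> s (the_inv_into J e g)" for g
  have c: "c (e j) = \<kappa> s j" if "j \<in> J" for j
    using that inj_on_e by (simp add: c_def the_inv_into_f_f)
  have cm: "c \<in> e ` J \<rightarrow> carrier (chart_ring R \<sigma>)" using coord_mem[OF s] by (auto simp: c)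
  have "s = (\<Oplus>\<^bsub>M\<^esub>g\<in>e ` J. c g \<odot>\<^bsub>M\<^esub> g)"
  proof (rule coord_inject)
    show "(\<Oplus>\<^bsub>M\<^esub>g\<in>e ` J. c g \<odot>\<^bsub>M\<^esub> g) \<in> carrier M"
      using cm e_mem by (intro lincomb_mem) auto
    fix j assume j: "j \<in> J"
    have "\<kappa> (\<Oplus>\<^bsub>M\<^esub>g\<in>e ` J. c g \<odot>\<^bsub>M\<^esub> g) j = (\<Sum>g\<in>e ` J. c g * \<kappa> g j)"
      using cm e_mem fin j by (intro coord_lincomb) auto
    also have "\<dots> = (\<Sum>i\<in>J. if i = j then \<kappa> s j else 0)"
      by (subst sum.reindex[OF inj_on_e]) (use j in \<open>auto simp: c coord_e intro!: sum.cong\<close>)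
    finally show "\<kappa> s j = \<kappa> (\<Oplus>\<^bsub>M\<^esub>g\<in>e ` J. c g \<odot>\<^bsub>M\<^esub> g) j" using j fin by simp
  qed (rule s)
  then show "\<exists>c\<in>e ` J \<rightarrow> carrier (chart_ring R \<sigma>). s = (\<Oplus>\<^bsub>M\<^esub>g\<in>e ` J. c g \<odot>\<^bsub>M\<^esub> g)"
    using cm by blast
qed (use fin e_mem in auto)

text \<open>The coordinate basis is a frame over the whole chart, so the cover by
  \<open>f = 1\<close> suffices.\<close>

lemma locally_free_coords:
  assumes "P (card J)"
  shows "locally_free (chart_ring R \<sigma>) M P"
proof -
  obtain js where js: "set js = J" "distinct js" using finite_distinct_list[OF fin] by blast
  let ?es = "map e js"
  have len: "length js = card J" using distinct_card[OF js(2)] js(1) by simp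
  have bij: "bij_betw ((!) js) {..<length js} J" using bij_betw_nth[OF js(2)] js(1) by blast
  have jsJ: "js ! l \<in> J" if "l < length js" for l using that js by auto
  have coord: "\<kappa> (\<Oplus>\<^bsub>M\<^esub>l\<in>{..<length ?es}. c l \<odot>\<^bsub>M\<^esub> (?es ! l)) (js ! l) = c l"
    if c: "c \<in> {..<length ?es} \<rightarrow> carrier (chart_ring R \<sigma>)" and l: "l < length js" for c l
  proof -
    have "\<kappa> (\<Oplus>\<^bsub>M\<^esub>l\<in>{..<length ?es}. c l \<odot>\<^bsub>M\<^esub> (?es ! l)) (js ! l) =
        (\<Sum>k<length ?es. c k * \<kappa> (?es ! k) (js ! l))"
      using c e_mem jsJ l by (intro coord_lincomb) auto
    also have "\<dots> = (\<Sum>k<length js. if k = l then c l else 0)"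
      using jsJ l js(2) by (intro sum.cong) (auto simp: coord_e nth_eq_iff_index_eq)
    finally show ?thesis using l by simp
  qed
  have "is_frame (chart_ring R \<sigma>) M 1 ?es"
    unfolding is_frame_def
  proof (intro conjI ballI impI)
    fix s assume s: "s \<in> carrier M"
    let ?c = "\<lambda>l. \<kappa> s (js ! l)"
    have c: "?c \<in> {..<length ?es} \<rightarrow> carrier (chart_ring R \<sigma>)" using coord_mem[OF s] jsJ by auto
    have "s = (\<Oplus>\<^bsub>M\<^esub>l\<in>{..<length ?es}. ?c l \<odot>\<^bsub>M\<^esub> (?es ! l))"
    proof (rule coord_inject[OF s])
      show "(\<Oplus>\<^bsub>M\<^esub>l\<in>{..<length ?es}. ?c l \<odot>\<^bsub>M\<^esub> (?es ! l)) \<in> carrier M"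
        using c e_mem jsJ by (intro lincomb_mem) auto
      fix j assume "j \<in> J"
      then obtain l where "l < length js" "j = js ! l" using js by (metis in_set_conv_nth)
      then show "\<kappa> s j = \<kappa> (\<Oplus>\<^bsub>M\<^esub>l\<in>{..<length ?es}. ?c l \<odot>\<^bsub>M\<^esub> (?es ! l)) j"
        using coord[OF c] by simp
    qed
    moreover have "1 \<odot>\<^bsub>M\<^esub> s = s" using smult_one[OF s] by simp
    ultimately have "1 ^ 0 \<odot>\<^bsub>M\<^esub> s = (\<Oplus>\<^bsub>M\<^esub>l\<in>{..<length ?es}. ?c l \<odot>\<^bsub>M\<^esub> (?es ! l))" by simp
    then show "\<exists>k. \<exists>c\<in>{..<length ?es} \<rightarrow> carrier (chart_ring R \<sigma>).
        1 ^ k \<odot>\<^bsub>M\<^esub> s = (\<Oplus>\<^bsub>M\<^esub>j\<in>{..<length ?es}. c j \<odot>\<^bsub>M\<^esub> (?es ! j))"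
      using c by (intro exI[of _ 0] bexI[of _ ?c])
  next
    fix c assume c: "c \<in> {..<length ?es} \<rightarrow> carrier (chart_ring R \<sigma>)"
      and z: "(\<Oplus>\<^bsub>M\<^esub>l\<in>{..<length ?es}. c l \<odot>\<^bsub>M\<^esub> (?es ! l)) = \<zero>\<^bsub>M\<^esub>"
    have "c l = 0" if "l < length js" for l
      using coord[OF c that] coord_zero[OF jsJ[OF that]] unfolding z by simp
    then show "\<exists>k. \<forall>j<length ?es. 1 ^ k * c j = 0" by auto
  qed (use e_mem js chart_ring_one[OF ring] in auto)
  then show ?thesis
    unfolding locally_free_def using chart_ring_one[OF ring] assms len
    by (intro exI[of _ "{1}"] conjI bexI[of _ "\<lambda>_. 1"]) auto
qed

text \<open>
  The transition matrices between a frame around \<open>x\<close> and the coordinate basis are inverse to each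
  other up to a power of \<open>f\<close>, so the frame evaluates to linearly independent vectors at \<open>x\<close>.
\<close>

lemma frame_independent:
  assumes frame: "is_frame (chart_ring R \<sigma>) M f es" and x: "x \<in> chart_points \<sigma>" and fx: "ev x f \<noteq> 0"
    and zero: "\<And>j. j \<in> J \<Longrightarrow> (\<Sum>i<length es. a i * ev x (\<kappa> (es ! i) j)) = 0"
    and l: "l < length es"
  shows "a l = (0::complex)"
proof -
  let ?A = "chart_ring R \<sigma>"
  have f: "f \<in> carrier ?A" and es: "set es \<subseteq> carrier M" using frame by (auto simp: is_frame_def)
  have esi: "es ! i \<in> carrier M" if "i < length es" for i using es that by auto
  note pow = chart_ring_power[OF ring f] and mul = chart_ring_mult[OF ring]
  define Q where "Q j k c \<longleftrightarrow> c \<in> {..<length es} \<rightarrow> carrier ?A \<and>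
      f ^ k \<odot>\<^bsub>M\<^esub> e j = (\<Oplus>\<^bsub>M\<^esub>i\<in>{..<length es}. c i \<odot>\<^bsub>M\<^esub> (es ! i))" for j k c
  have "\<exists>k c. Q j k c" if "j \<in> J" for j
    using frame e_mem[OF that] unfolding is_frame_def Q_def by blast
  then obtain k c where Q: "\<And>j. j \<in> J \<Longrightarrow> Q j (k j) (c j)" by metis
  then have c: "c j \<in> {..<length es} \<rightarrow> carrier ?A"
    and fk: "f ^ k j \<odot>\<^bsub>M\<^esub> e j = (\<Oplus>\<^bsub>M\<^esub>i\<in>{..<length es}. c j i \<odot>\<^bsub>M\<^esub> (es ! i))"
    if "j \<in> J" for j
    using that unfolding Q_def by (blast, blast)
  have cm: "c j i \<in> carrier ?A" if "j \<in> J" "i < length es" for i j using c[OF that(1)] that(2) by auto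
  have coordfk: "(\<Sum>i<length es. c j i * \<kappa> (es ! i) p) = f ^ k j * (if p = j then 1 else 0)"
    if "j \<in> J" "p \<in> J" for j p
  proof -
    have "f ^ k j * (if p = j then 1 else 0) = \<kappa> (f ^ k j \<odot>\<^bsub>M\<^esub> e j) p"
      using that pow e_mem by (simp add: coord_smult coord_e)
    also have "\<dots> = (\<Sum>i<length es. c j i * \<kappa> (es ! i) p)"
      unfolding fk[OF that(1)] using that cm esi by (intro coord_lincomb) auto
    finally show ?thesis by simp
  qed
  \<comment> \<open>A common exponent: \<open>f ^ K\<close> brings every \<open>e j\<close> into the
    span of the frame.\<close>
  define K where "K = (\<Sum>j\<in>J. k j)"
  have kK: "k j \<le> K" if "j \<in> J" for j unfolding K_def using that fin by (simp add: member_le_sum)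
  \<comment> \<open>The product of the two transition matrices minus \<open>f ^ K\<close> times the
    identity. Its rows are relations among \<open>es\<close>, so a power of \<open>f\<close> kills
    them, and they vanish at \<open>x\<close> because \<open>f\<close> does not.\<close>
  define d where "d i l = (\<Sum>j\<in>J. \<kappa> (es ! i) j * f ^ (K - k j) * c j l) - (if l = i then f ^ K else 0)" for i l
  have dm: "d i l \<in> carrier ?A" if "i < length es" "l < length es" for i l
  proof -
    have "(\<Sum>j\<in>J. \<kappa> (es ! i) j * f ^ (K - k j) * c j l) \<in> carrier ?A"
      by (intro chart_ring_sum[OF ring] mul pow coord_mem esi cm that)
    moreover have "- (if l = i then f ^ K else 0) \<in> carrier ?A"
      using chart_ring_uminus[OF ring pow] chart_ring_zero[OF ring] by auto
    ultimately show ?thesis unfolding d_def diff_conv_add_uminus by (rule chart_ring_add[OF ring])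
  qed
  have evd: "ev x (d i l) = 0" if i: "i < length es" and l: "l < length es" for i l
  proof -
    have "(\<Oplus>\<^bsub>M\<^esub>l\<in>{..<length es}. d i l \<odot>\<^bsub>M\<^esub> (es ! l)) = \<zero>\<^bsub>M\<^esub>"
    proof (rule coord_inject)
      show "(\<Oplus>\<^bsub>M\<^esub>l\<in>{..<length es}. d i l \<odot>\<^bsub>M\<^esub> (es ! l)) \<in> carrier M"
        using dm[OF i] esi by (intro lincomb_mem) auto
      fix p assume p: "p \<in> J"
      have "\<kappa> (\<Oplus>\<^bsub>M\<^esub>l\<in>{..<length es}. d i l \<odot>\<^bsub>M\<^esub> (es ! l)) p = (\<Sum>l<length es. d i l * \<kappa> (es ! l) p)"
        using dm[OF i] esi p by (intro coord_lincomb) auto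
      also have "\<dots> = (\<Sum>l<length es. (\<Sum>j\<in>J. \<kappa> (es ! i) j * f ^ (K - k j) * (c j l * \<kappa> (es ! l) p))
          - (if l = i then f ^ K * \<kappa> (es ! i) p else 0))"
        by (intro sum.cong) (auto simp: d_def algebra_simps sum_distrib_left sum_distrib_right)
      also have "\<dots> = (\<Sum>j\<in>J. \<kappa> (es ! i) j * f ^ (K - k j) * (\<Sum>l<length es. c j l * \<kappa> (es ! l) p))
          - f ^ K * \<kappa> (es ! i) p"
        by (simp add: sum_subtractf i sum_distrib_left) (rule sum.swap)
      also have "(\<Sum>j\<in>J. \<kappa> (es ! i) j * f ^ (K - k j) * (\<Sum>l<length es. c j l * \<kappa> (es ! l) p)) =
          (\<Sum>j\<in>J. if j = p then f ^ K * \<kappa> (es ! i) p else 0)"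
        by (intro sum.cong) (auto simp: coordfk p kK mult.assoc simp flip: power_add)
      finally show "\<kappa> (\<Oplus>\<^bsub>M\<^esub>l\<in>{..<length es}. d i l \<odot>\<^bsub>M\<^esub> (es ! l)) p = \<kappa> \<zero>\<^bsub>M\<^esub> p"
        using p fin by (simp add: coord_zero)
    qed simp
    moreover have "d i \<in> {..<length es} \<rightarrow> carrier ?A" using dm[OF i] by auto
    ultimately obtain k' where "\<forall>l<length es. f ^ k' * d i l = 0"
      using frame unfolding is_frame_def by blast
    then have "ev x (f ^ k' * d i l) = 0" using l by simp
    then show ?thesis
      using ev_mult[OF x pow dm[OF i l], of k'] ev_power[OF ring x f, of k'] fx by simp
  qed
  have "(if l = i then ev x f ^ K else 0) = (\<Sum>j\<in>J. ev x (\<kappa> (es ! i) j) * (ev x f ^ (K - k j) * ev x (c j l)))"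
    if i: "i < length es" for i
  proof -
    have "(\<Sum>j\<in>J. \<kappa> (es ! i) j * f ^ (K - k j) * c j l) = d i l + (if l = i then f ^ K else 0)"
      by (simp add: d_def)
    then have "ev x (\<Sum>j\<in>J. \<kappa> (es ! i) j * f ^ (K - k j) * c j l) = ev x (if l = i then f ^ K else 0)"
      using evd[OF i l] by (simp add: ev_add)
    also have "\<dots> = (if l = i then ev x f ^ K else 0)" using ev_power[OF ring x f] by simp
    finally have "(if l = i then ev x f ^ K else 0) =
        (\<Sum>j\<in>J. ev x (\<kappa> (es ! i) j * f ^ (K - k j) * c j l))"
      by (simp add: ev_sum)
    also have "\<dots> = (\<Sum>j\<in>J. ev x (\<kappa> (es ! i) j) * (ev x f ^ (K - k j) * ev x (c j l)))"
    proof (rule sum.cong[OF refl])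
      fix j assume j: "j \<in> J"
      have \<kappa>: "\<kappa> (es ! i) j \<in> carrier ?A" by (rule coord_mem[OF esi[OF i] j])
      show "ev x (\<kappa> (es ! i) j * f ^ (K - k j) * c j l) = ev x (\<kappa> (es ! i) j) * (ev x f ^ (K - k j) * ev x (c j l))"
        by (simp add: ev_mult[OF x mul[OF \<kappa> pow] cm[OF j l]] ev_mult[OF x \<kappa> pow] ev_power[OF ring x f])
    qed
    finally show ?thesis .
  qed
  then have "a l * ev x f ^ K = (\<Sum>i<length es. a i *
      (\<Sum>j\<in>J. ev x (\<kappa> (es ! i) j) * (ev x f ^ (K - k j) * ev x (c j l))))"
  proof -
    assume eq: "\<And>i. i < length es \<Longrightarrow> (if l = i then ev x f ^ K else 0) =
      (\<Sum>j\<in>J. ev x (\<kappa> (es ! i) j) * (ev x f ^ (K - k j) * ev x (c j l)))"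
    have "a l * ev x f ^ K = (\<Sum>i<length es. a i * (if l = i then ev x f ^ K else 0))"
      using l by (simp add: if_distrib[of "\<lambda>c. _ * c"] cong: if_cong)
    also have "\<dots> = (\<Sum>i<length es. a i *
      (\<Sum>j\<in>J. ev x (\<kappa> (es ! i) j) * (ev x f ^ (K - k j) * ev x (c j l))))"
      using eq by (intro sum.cong) auto
    finally show ?thesis .
  qed
  also have "\<dots> = (\<Sum>j\<in>J. (\<Sum>i<length es. a i * ev x (\<kappa> (es ! i) j)) * (ev x f ^ (K - k j) * ev x (c j l)))"
    by (simp add: sum_distrib_left sum_distrib_right mult.assoc) (rule sum.swap)
  also have "\<dots> = 0" using zero by simp
  finally show ?thesis using fx by simp
qed

text \<open>With \<open>z p\<close> the p-th coordinate at \<open>x\<close> of the combination with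
  coefficients \<open>a\<close>, the form is the sum of \<open>w p\<close> times the squared
  absolute value of \<open>z p\<close>, and not all \<open>z p\<close> vanish by
  \<open>frame_independent\<close>. This passes from the coordinate basis to the arbitrary frames on
  which \<open>hermitian_metric\<close> tests positivity.\<close>

lemma frame_positive:
  assumes frame: "is_frame (chart_ring R \<sigma>) M f es" and x: "x \<in> chart_points \<sigma>" and fx: "ev x f \<noteq> 0"
    and w: "\<And>j. j \<in> J \<Longrightarrow> 0 < w j"
    and h: "\<And>s t. s \<in> carrier M \<Longrightarrow> t \<in> carrier M \<Longrightarrow>
      h s t = (\<Sum>j\<in>J. complex_of_real (w j) * (ev x (\<kappa> s j) * cnj (ev x (\<kappa> t j))))"
    and a: "\<exists>j<length es. a j \<noteq> (0::complex)"
  shows "0 < Re (\<Sum>i<length es. \<Sum>j<length es. a i * cnj (a j) * h (es ! i) (es ! j))"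
proof -
  have es: "es ! i \<in> carrier M" if "i < length es" for i using frame that by (auto simp: is_frame_def)
  define z where "z p = (\<Sum>i<length es. a i * ev x (\<kappa> (es ! i) p))" for p
  have "(\<Sum>i<length es. \<Sum>j<length es. a i * cnj (a j) * h (es ! i) (es ! j)) =
    (\<Sum>i<length es. \<Sum>j<length es. \<Sum>p\<in>J. complex_of_real (w p) *
      ((a i * ev x (\<kappa> (es ! i) p)) * cnj (a j * ev x (\<kappa> (es ! j) p))))"
    by (intro sum.cong) (auto simp: h es sum_distrib_left mult_ac)
  also have "\<dots> = (\<Sum>i<length es. \<Sum>p\<in>J. \<Sum>j<length es. complex_of_real (w p) *
      ((a i * ev x (\<kappa> (es ! i) p)) * cnj (a j * ev x (\<kappa> (es ! j) p))))"
    by (intro sum.cong[OF refl] sum.swap)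
  also have "\<dots> = (\<Sum>p\<in>J. \<Sum>i<length es. \<Sum>j<length es. complex_of_real (w p) *
      ((a i * ev x (\<kappa> (es ! i) p)) * cnj (a j * ev x (\<kappa> (es ! j) p))))"
    by (rule sum.swap)
  also have "\<dots> = (\<Sum>p\<in>J. complex_of_real (w p) * (z p * cnj (z p)))"
  proof (rule sum.cong[OF refl])
    fix p
    have "z p * cnj (z p) = (\<Sum>i<length es. \<Sum>j<length es.
        (a i * ev x (\<kappa> (es ! i) p)) * cnj (a j * ev x (\<kappa> (es ! j) p)))"
      unfolding z_def cnj_sum by (rule sum_product)
    then show "(\<Sum>i<length es. \<Sum>j<length es. complex_of_real (w p) *
      ((a i * ev x (\<kappa> (es ! i) p)) * cnj (a j * ev x (\<kappa> (es ! j) p)))) =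
      complex_of_real (w p) * (z p * cnj (z p))"
      by (simp add: sum_distrib_left)
  qed
  finally have "Re (\<Sum>i<length es. \<Sum>j<length es. a i * cnj (a j) * h (es ! i) (es ! j)) =
      (\<Sum>p\<in>J. w p * (cmod (z p))\<^sup>2)"
    by (simp add: complex_mult_cnj cmod_power2)
  moreover have "\<exists>p\<in>J. z p \<noteq> 0"
    using frame_independent[OF frame x fx, of a] a unfolding z_def by blast
  ultimately show ?thesis
    using w fin by (auto intro!: sum_pos2 simp: less_imp_le)
qed

end

section \<open>Sums of line bundles\<close>

definition dsec :: "complex set \<Rightarrow> 'n divisor \<Rightarrow> (real ^ 'n::finite) set \<Rightarrow> 'n laurent set" where
  "dsec R D \<sigma> = {f. \<forall>m. Poly_Mapping.lookup f m \<in> R \<and>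
    (Poly_Mapping.lookup f m \<noteq> 0 \<longrightarrow> (\<forall>u\<in>ray_gens \<sigma>. - D u \<le> ipair m u))}"

lemma sec_divisor_sheaf: "sec (divisor_sheaf R D) \<sigma> = dsec R D \<sigma>"
  by (auto simp: divisor_sheaf_def dsec_def in_keys_iff pairing_real_vec simp flip: of_int_minus)

text \<open>The index set is arbitrary and entries outside it are zero, so that
  \<open>sum_sheaf R {j} D\<close> is literally a subsheaf of the whole sum and no inclusion maps
  are needed.\<close>

definition sum_sheaf :: "complex set \<Rightarrow> nat set \<Rightarrow> (nat \<Rightarrow> 'n divisor) \<Rightarrow>
  ('n::finite, nat \<Rightarrow> 'n laurent) sheaf" where
  "sum_sheaf R J D =
    \<lparr>sections = (\<lambda>\<sigma>.
       \<lparr>carrier = {x. (\<forall>j\<in>J. x j \<in> dsec R (D j) \<sigma>) \<and> (\<forall>j. j \<notin> J \<longrightarrow> x j = 0)},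
        mult = (\<lambda>x y j. x j * y j), one = (\<lambda>_. 1), zero = (\<lambda>_. 0), add = (\<lambda>x y j. x j + y j),
        smult = (\<lambda>f x j. f * x j)\<rparr>),
     restr = (\<lambda>\<sigma> \<tau> x. x)\<rparr>"

lemma sum_sheaf_simps [simp]:
  "zero (sections (sum_sheaf R J D) \<sigma>) = (\<lambda>_. 0)"
  "add (sections (sum_sheaf R J D) \<sigma>) = (\<lambda>x y j. x j + y j)"
  "smult (sections (sum_sheaf R J D) \<sigma>) = (\<lambda>f x j. f * x j)"
  "restr (sum_sheaf R J D) \<sigma> \<tau> x = x"
  by (simp_all add: sum_sheaf_def)

lemma sec_sum_sheaf:
  "sec (sum_sheaf R J D) \<sigma> = {x. (\<forall>j\<in>J. x j \<in> dsec R (D j) \<sigma>) \<and> (\<forall>j. j \<notin> J \<longrightarrow> x j = 0)}"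
  by (simp add: sum_sheaf_def)

lemma divisor_sheaf_simps [simp]:
  "zero (sections (divisor_sheaf R D) \<sigma>) = 0"
  "add (sections (divisor_sheaf R D) \<sigma>) = (+)"
  "smult (sections (divisor_sheaf R D) \<sigma>) = (*)"
  "restr (divisor_sheaf R D) \<sigma> \<tau> f = f"
  by (simp_all add: divisor_sheaf_def)

context
  fixes R :: "complex set" and \<Sigma> :: "(real ^ 'n::finite) set set"
  assumes R: "ring_subset R" and sf: "smooth_fan \<Sigma>"
begin

lemma dsec_zero: "0 \<in> dsec R D \<sigma>"
  using R by (simp add: dsec_def ring_subset_def)

lemma dsec_add: "f \<in> dsec R D \<sigma> \<Longrightarrow> g \<in> dsec R D \<sigma> \<Longrightarrow> f + g \<in> dsec R D \<sigma>"
  using R unfolding dsec_def ring_subset_def lookup_add mem_Collect_eq by (metis add.right_neutral)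

lemma dsec_uminus: "f \<in> dsec R D \<sigma> \<Longrightarrow> - f \<in> dsec R D \<sigma>"
  using R unfolding dsec_def ring_subset_def by auto

lemma dsec_antimono:
  assumes "\<sigma> \<in> \<Sigma>" "\<tau> \<in> \<Sigma>" "\<tau> \<subseteq> \<sigma>" shows "dsec R D \<sigma> \<subseteq> dsec R D \<tau>"
  using ray_gens_mono[OF sf assms(2,1,3)] unfolding dsec_def by blast

text \<open>An invariant divisor is principal on a smooth chart: division by the character with
  values \<open>- D u\<close> on the rays trivialises it. Closure properties of sections thus reduce
  to those of the chart ring.\<close>

lemma dsec_translate:
  assumes "\<sigma> \<in> \<Sigma>" "\<And>u. u \<in> ray_gens \<sigma> \<Longrightarrow> ipair m u = - D u"
  shows "f \<in> dsec R D \<sigma> \<longleftrightarrow> Poly_Mapping.single (- m) 1 * f \<in> carrier (chart_ring R \<sigma>)"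
proof -
  have "(\<forall>k. Poly_Mapping.lookup f k \<in> R \<and> (Poly_Mapping.lookup f k \<noteq> 0 \<longrightarrow> (\<forall>u\<in>ray_gens \<sigma>. - D u \<le> ipair k u)))
    \<longleftrightarrow> (\<forall>k. Poly_Mapping.lookup f (k + m) \<in> R \<and>
      (Poly_Mapping.lookup f (k + m) \<noteq> 0 \<longrightarrow> (\<forall>u\<in>ray_gens \<sigma>. - D u \<le> ipair (k + m) u)))" (is "?P \<longleftrightarrow> ?Q")
  proof
    assume q: ?Q
    show ?P
    proof
      fix k
      show "Poly_Mapping.lookup f k \<in> R \<and> (Poly_Mapping.lookup f k \<noteq> 0 \<longrightarrow> (\<forall>u\<in>ray_gens \<sigma>. - D u \<le> ipair k u))"
        using spec[OF q, of "k - m"] by simp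
    qed
  qed blast
  then show ?thesis
    using assms(2)
      by (auto simp: dsec_def chart_ring_mem lookup_single_mult dual_monoid_rays[OF sf assms(1)] ipair_add_left)
qed

lemma dsec_smult:
  assumes "\<sigma> \<in> \<Sigma>" "f \<in> carrier (chart_ring R \<sigma>)" "g \<in> dsec R D \<sigma>"
  shows "f * g \<in> dsec R D \<sigma>"
proof -
  obtain m where m: "\<And>u. u \<in> ray_gens \<sigma> \<Longrightarrow> ipair m u = - D u"
    using ray_interpolate[OF sf assms(1), of "\<lambda>u. - D u"] by blast
  have "f * (Poly_Mapping.single (- m) 1 * g) \<in> carrier (chart_ring R \<sigma>)"
    using dsec_translate[OF assms(1) m, of g] assms(3) by (intro chart_ring_mult[OF R assms(2)]) simp
  then show ?thesis using dsec_translate[OF assms(1) m, of "f * g"] by (simp add: mult_ac)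
qed

lemma single_mult_single:
  fixes m :: "int ^ 'n"
  shows "Poly_Mapping.single (- m) (1::complex) * (Poly_Mapping.single m 1 * f) = f"
  "Poly_Mapping.single m (1::complex) * (Poly_Mapping.single (- m) 1 * f) = f"
  by (simp_all add: mult_single flip: mult.assoc)

lemma coord_module_sum_sheaf:
  assumes "\<sigma> \<in> \<Sigma>" "finite J" "\<And>j u. j \<in> J \<Longrightarrow> u \<in> ray_gens \<sigma> \<Longrightarrow> ipair (m j) u = - D j u"
  shows "coord_module R \<sigma> (sections (sum_sheaf R J D) \<sigma>) J
    (\<lambda>x j. Poly_Mapping.single (- m j) 1 * x j) (\<lambda>j i. if i = j then Poly_Mapping.single (m j) 1 else 0)"
proof (rule coord_module.intro)
  show "ring_subset R" by (rule R)
  show "Module.module (chart_ring R \<sigma>) (sections (sum_sheaf R J D) \<sigma>)"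
  proof (rule moduleI)
    show "cring (chart_ring R \<sigma>)" by (rule chart_cring[OF R])
    show "abelian_group (sections (sum_sheaf R J D) \<sigma>)"
    proof (rule abelian_groupI)
      fix x assume "x \<in> sec (sum_sheaf R J D) \<sigma>"
      then show "\<exists>y\<in>sec (sum_sheaf R J D) \<sigma>. y \<oplus>\<^bsub>sections (sum_sheaf R J D) \<sigma>\<^esub> x =
          \<zero>\<^bsub>sections (sum_sheaf R J D) \<sigma>\<^esub>"
        by (intro bexI[of _ "\<lambda>j. - x j"]) (auto simp: sec_sum_sheaf dsec_uminus)
    qed (auto simp: sec_sum_sheaf dsec_add dsec_zero add_ac)
  qed (auto simp: sec_sum_sheaf dsec_smult[OF assms(1)] algebra_simps)
next
  fix j assume j: "j \<in> J"
  have "Poly_Mapping.single (m j) 1 \<in> dsec R (D j) \<sigma>"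
    using dsec_translate[OF assms(1) assms(3)[OF j]] chart_ring_one[OF R]
      single_mult_single(1)[of "m j" 1] by simp
  then show "(\<lambda>i. if i = j then Poly_Mapping.single (m j) 1 else 0) \<in> sec (sum_sheaf R J D) \<sigma>"
    using j dsec_zero by (auto simp: sec_sum_sheaf)
next
  fix x j assume "x \<in> sec (sum_sheaf R J D) \<sigma>" "j \<in> J"
  then show "Poly_Mapping.single (- m j) 1 * x j \<in> carrier (chart_ring R \<sigma>)"
    using dsec_translate[OF assms(1) assms(3), of j] by (auto simp: sec_sum_sheaf)
next
  fix x y assume x: "x \<in> sec (sum_sheaf R J D) \<sigma>" "y \<in> sec (sum_sheaf R J D) \<sigma>"
    and eq: "\<And>j. j \<in> J \<Longrightarrow> Poly_Mapping.single (- m j) 1 * x j = Poly_Mapping.single (- m j) 1 * y j"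
  show "x = y"
  proof
    fix j show "x j = y j"
      using x arg_cong[OF eq[of j], of "\<lambda>f. Poly_Mapping.single (m j) 1 * f"]
      by (cases "j \<in> J") (auto simp: single_mult_single sec_sum_sheaf)
  qed
qed (use assms(2) in \<open>auto simp: algebra_simps mult_single\<close>)

lemma coord_module_divisor_sheaf:
  assumes "\<sigma> \<in> \<Sigma>" "\<And>u. u \<in> ray_gens \<sigma> \<Longrightarrow> ipair m u = - D u"
  shows "coord_module R \<sigma> (sections (divisor_sheaf R D) \<sigma>) {0}
    (\<lambda>f j. Poly_Mapping.single (- m) 1 * f) (\<lambda>j. Poly_Mapping.single m 1)"
proof (rule coord_module.intro)
  show "ring_subset R" by (rule R)
  show "Module.module (chart_ring R \<sigma>) (sections (divisor_sheaf R D) \<sigma>)"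
  proof (rule moduleI)
    show "cring (chart_ring R \<sigma>)" by (rule chart_cring[OF R])
    show "abelian_group (sections (divisor_sheaf R D) \<sigma>)"
    proof (rule abelian_groupI)
      fix x assume "x \<in> sec (divisor_sheaf R D) \<sigma>"
      then show "\<exists>y\<in>sec (divisor_sheaf R D) \<sigma>. y \<oplus>\<^bsub>sections (divisor_sheaf R D) \<sigma>\<^esub> x =
          \<zero>\<^bsub>sections (divisor_sheaf R D) \<sigma>\<^esub>"
        by (intro bexI[of _ "- x"]) (auto simp: sec_divisor_sheaf dsec_uminus)
    qed (auto simp: sec_divisor_sheaf dsec_add dsec_zero add_ac)
  qed (auto simp: sec_divisor_sheaf dsec_smult[OF assms(1)] algebra_simps)
next
  show "Poly_Mapping.single m 1 \<in> sec (divisor_sheaf R D) \<sigma>"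
    using dsec_translate[OF assms] chart_ring_one[OF R] single_mult_single(1)[of m 1]
    by (simp add: sec_divisor_sheaf)
next
  fix f assume "f \<in> sec (divisor_sheaf R D) \<sigma>"
  then show "Poly_Mapping.single (- m) 1 * f \<in> carrier (chart_ring R \<sigma>)"
    using dsec_translate[OF assms] by (simp add: sec_divisor_sheaf)
next
  fix f g assume "\<And>j::nat. j \<in> {0} \<Longrightarrow> Poly_Mapping.single (- m) (1::complex) * f = Poly_Mapping.single (- m) 1 * g"
  then have "Poly_Mapping.single (- m) (1::complex) * f = Poly_Mapping.single (- m) 1 * g" by simp
  from arg_cong[OF this, of "\<lambda>f. Poly_Mapping.single m 1 * f"] show "f = g"
    by (simp add: single_mult_single)
qed (auto simp: algebra_simps mult_single)

lemma quasi_coherent_sum_sheaf: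
  assumes "finite J"
  shows "quasi_coherent R \<Sigma> (sum_sheaf R J D)"
  unfolding quasi_coherent_def
proof (intro conjI ballI impI)
  fix \<sigma> assume s: "\<sigma> \<in> \<Sigma>"
  have "\<exists>m. \<forall>u\<in>ray_gens \<sigma>. ipair m u = - D j u" for j
    using ray_interpolate[OF sf s, of "\<lambda>u. - D j u"] .
  then obtain m where "\<And>j u. u \<in> ray_gens \<sigma> \<Longrightarrow> ipair (m j) u = - D j u" by metis
  then interpret coord_module R \<sigma> "sections (sum_sheaf R J D) \<sigma>" J
    "\<lambda>x j. Poly_Mapping.single (- m j) 1 * x j" "\<lambda>j i. if i = j then Poly_Mapping.single (m j) 1 else 0"
    by (intro coord_module_sum_sheaf s assms) auto
  show "Module.module (chart_ring R \<sigma>) (sections (sum_sheaf R J D) \<sigma>)" by (rule mod)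
next
  fix \<sigma> \<tau> assume st: "\<sigma> \<in> \<Sigma>" "\<tau> \<in> \<Sigma>" "\<tau> \<subseteq> \<sigma>"
  show "restr (sum_sheaf R J D) \<sigma> \<tau> \<in>
      module_hom (chart_ring R \<sigma>) (sections (sum_sheaf R J D) \<sigma>) (sections (sum_sheaf R J D) \<tau>)"
    using dsec_antimono[OF st] by (auto simp: module_hom_def sec_sum_sheaf subset_iff)
  fix t assume t: "t \<in> sec (sum_sheaf R J D) \<tau>"
  obtain m where m: "m \<in> inverted_chars \<sigma> \<tau>" and pos: "\<forall>u\<in>ray_gens \<sigma> - ray_gens \<tau>. 1 \<le> ipair m u"
    using separating_char[OF sf st] by blast
  \<comment> \<open>\<open>B\<close> dominates the amount by which any monomial of \<open>t\<close>
    violates the condition of its divisor along a ray of \<sigma>. The power \<open>B\<close> of the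
    separating character makes up for it; a sum of absolute values avoids maxima over possibly empty
    sets.\<close>
  define B where "B = (\<Sum>j\<in>J. \<Sum>k\<in>Poly_Mapping.keys (t j). \<Sum>u\<in>ray_gens \<sigma>. \<bar>- D j u - ipair k u\<bar>)"
  have B0: "0 \<le> B" unfolding B_def by (intro sum_nonneg) auto
  have B: "- D j u - ipair k u \<le> B" if "j \<in> J" "k \<in> Poly_Mapping.keys (t j)" "u \<in> ray_gens \<sigma>" for j k u
  proof -
    have "\<bar>- D j u - ipair k u\<bar> \<le> (\<Sum>u\<in>ray_gens \<sigma>. \<bar>- D j u - ipair k u\<bar>)"
      using that finite_ray_gens[OF sf st(1)] by (intro member_le_sum) auto
    also have "\<dots> \<le> (\<Sum>k\<in>Poly_Mapping.keys (t j). \<Sum>u\<in>ray_gens \<sigma>. \<bar>- D j u - ipair k u\<bar>)"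
      using that
        by (intro member_le_sum[of k _ "\<lambda>k. \<Sum>u\<in>ray_gens \<sigma>. \<bar>- D j u - ipair k u\<bar>"]) (auto intro: sum_nonneg)
    also have "\<dots> \<le> B" unfolding B_def
      using that assms
        by (intro member_le_sum[of j _ "\<lambda>j. \<Sum>k\<in>Poly_Mapping.keys (t j). \<Sum>u\<in>ray_gens \<sigma>. \<bar>- D j u - ipair k u\<bar>"])
        (auto intro: sum_nonneg)
    finally show ?thesis by linarith
  qed
  have inv: "B *s m \<in> inverted_chars \<sigma> \<tau>"
    using m B0
      by (auto simp: inverted_chars_rays[OF sf st(1,2)] dual_monoid_rays[OF sf st(1)] ipair_scale_left)
  have "Poly_Mapping.single (B *s m) 1 * t j \<in> dsec R (D j) \<sigma>" if j: "j \<in> J" for j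
    unfolding dsec_def mem_Collect_eq lookup_single_mult
  proof (intro allI conjI impI ballI)
    fix k
    have tj: "t j \<in> dsec R (D j) \<tau>" using t j by (simp add: sec_sum_sheaf)
    then show "1 * Poly_Mapping.lookup (t j) (k - B *s m) \<in> R" by (simp add: dsec_def)
    fix u assume nz: "1 * Poly_Mapping.lookup (t j) (k - B *s m) \<noteq> 0" and u: "u \<in> ray_gens \<sigma>"
    show "- D j u \<le> ipair k u"
    proof (cases "u \<in> ray_gens \<tau>")
      case True
      then have "- D j u \<le> ipair (k - B *s m) u" using tj nz by (simp add: dsec_def)
      moreover have "ipair m u = 0" using m True by (simp add: inverted_chars_rays[OF sf st(1,2)])
      ultimately show ?thesis by (simp add: ipair_diff_left ipair_scale_left)
    next
      case False
      then have "1 \<le> ipair m u" using pos u by blast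
      then have "B * 1 \<le> B * ipair m u" using B0 by (intro mult_left_mono) auto
      moreover have "- D j u - ipair (k - B *s m) u \<le> B"
        using nz u j by (intro B) (auto simp: in_keys_iff)
      ultimately show ?thesis by (simp add: ipair_diff_left ipair_scale_left)
    qed
  qed
  then have "(\<lambda>j. Poly_Mapping.single (B *s m) 1 * t j) \<in> sec (sum_sheaf R J D) \<sigma>"
    using t by (auto simp: sec_sum_sheaf)
  then show "\<exists>m\<in>inverted_chars \<sigma> \<tau>. \<exists>s\<in>sec (sum_sheaf R J D) \<sigma>.
      char m \<odot>\<^bsub>sections (sum_sheaf R J D) \<tau>\<^esub> t = restr (sum_sheaf R J D) \<sigma> \<tau> s"
    using inv by (intro bexI[of _ "B *s m"]) auto
next
  fix \<sigma> \<tau> s assume "\<sigma> \<in> \<Sigma>" "\<tau> \<in> \<Sigma>" "\<tau> \<subseteq> \<sigma>"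
    and "restr (sum_sheaf R J D) \<sigma> \<tau> s = \<zero>\<^bsub>sections (sum_sheaf R J D) \<tau>\<^esub>"
  \<comment> \<open>Restriction is the identity, so \<open>s\<close> is already zero and the trivial
    character serves.\<close>
  then show "\<exists>m\<in>inverted_chars \<sigma> \<tau>. char m \<odot>\<^bsub>sections (sum_sheaf R J D) \<sigma>\<^esub> s = \<zero>\<^bsub>sections (sum_sheaf R J D) \<sigma>\<^esub>"
    by (intro bexI[of _ 0]) (auto simp: inverted_chars_def zero_in_dual_monoid pairing_zero_left)
qed auto

lemma sum_sheaf_bundle:
  assumes "finite J"
  shows "coherent R \<Sigma> (sum_sheaf R J D)"
    and "\<And>\<sigma> P. \<sigma> \<in> \<Sigma> \<Longrightarrow> P (card J) \<Longrightarrow> locally_free (chart_ring R \<sigma>) (sections (sum_sheaf R J D) \<sigma>) P"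
proof -
  have "finitely_generated (chart_ring R \<sigma>) (sections (sum_sheaf R J D) \<sigma>) \<and>
      (\<forall>P. P (card J) \<longrightarrow> locally_free (chart_ring R \<sigma>) (sections (sum_sheaf R J D) \<sigma>) P)" if s: "\<sigma> \<in> \<Sigma>" for \<sigma>
  proof -
    have "\<exists>m. \<forall>u\<in>ray_gens \<sigma>. ipair m u = - D j u" for j
      using ray_interpolate[OF sf s, of "\<lambda>u. - D j u"] .
    then obtain m where "\<And>j u. u \<in> ray_gens \<sigma> \<Longrightarrow> ipair (m j) u = - D j u" by metis
    then interpret coord_module R \<sigma> "sections (sum_sheaf R J D) \<sigma>" J
      "\<lambda>x j. Poly_Mapping.single (- m j) 1 * x j" "\<lambda>j i. if i = j then Poly_Mapping.single (m j) 1 else 0"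
      by (intro coord_module_sum_sheaf s assms) auto
    show ?thesis using finitely_generated_coords locally_free_coords by blast
  qed
  then show "coherent R \<Sigma> (sum_sheaf R J D)"
    and "\<And>\<sigma> P. \<sigma> \<in> \<Sigma> \<Longrightarrow> P (card J) \<Longrightarrow> locally_free (chart_ring R \<sigma>) (sections (sum_sheaf R J D) \<sigma>) P"
    using quasi_coherent_sum_sheaf[OF assms] by (auto simp: coherent_def)
qed

end

section \<open>Canonical metrics\<close>

text \<open>
  These characters generate \<open>\<O>(D)\<close> globally: \<open>\<chi>\<^sup>m\<close> with \<open>m = m \<sigma>\<close> generates it over \<open>U\<^sub>\<sigma>\<close>.
\<close>

definition generating_chars :: "(real ^ 'n::finite) set set \<Rightarrow> 'n divisor \<Rightarrow> ((real ^ 'n) set \<Rightarrow> int ^ 'n) \<Rightarrow> bool" where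
  "generating_chars \<Sigma> D m \<longleftrightarrow> (\<forall>\<sigma>\<in>\<Sigma>. (\<forall>u\<in>ray_gens \<sigma>. ipair (m \<sigma>) u = - D u) \<and>
    (\<forall>u\<in>all_rays \<Sigma>. - D u \<le> ipair (m \<sigma>) u))"

definition max_norm :: "(real ^ 'n::finite) set set \<Rightarrow> ((real ^ 'n) set \<Rightarrow> int ^ 'n) \<Rightarrow>
  (real ^ 'n) set \<Rightarrow> 'n point \<Rightarrow> real" where
  "max_norm \<Sigma> m \<sigma> x = Max ((\<lambda>\<tau>. cmod (x (m \<tau> - m \<sigma>))) ` \<Sigma>)"

text \<open>For generating characters this is the support function, a minimum of linear functions
  that is attained on each cone \<sigma> by \<open>m \<sigma>\<close>.\<close>

definition min_pairing :: "(real ^ 'n::finite) set set \<Rightarrow> ((real ^ 'n) set \<Rightarrow> int ^ 'n) \<Rightarrow>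
  real ^ 'n \<Rightarrow> real" where
  "min_pairing \<Sigma> m v = Min ((\<lambda>\<tau>. pairing (m \<tau>) v) ` \<Sigma>)"

text \<open>A section is its coordinate, obtained by dividing by the local generator, times that
  generator; the form is the product of the coordinates weighted by the squared norm
  \<open>N\<close> of the generator.\<close>

definition div_metric :: "((real ^ 'n::finite) set \<Rightarrow> int ^ 'n) \<Rightarrow> ((real ^ 'n) set \<Rightarrow> 'n point \<Rightarrow> real) \<Rightarrow>
  ('n, 'n laurent) metric" where
  "div_metric m N \<sigma> x f g = complex_of_real ((N \<sigma> x)\<^sup>2) *
    (ev x (Poly_Mapping.single (- m \<sigma>) 1 * f) * cnj (ev x (Poly_Mapping.single (- m \<sigma>) 1 * g)))"

text \<open>\<open>N \<sigma> x\<close> is the norm at \<open>x\<close> of the local generator \<open>\<chi>\<^sup>m\<close> with \<open>m = m \<sigma>\<close>.\<close>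

definition norm_data :: "(real ^ 'n::finite) set set \<Rightarrow> 'n divisor \<Rightarrow> ((real ^ 'n) set \<Rightarrow> int ^ 'n) \<Rightarrow>
  ((real ^ 'n) set \<Rightarrow> 'n point \<Rightarrow> real) \<Rightarrow> bool" where
  "norm_data \<Sigma> D m N \<longleftrightarrow>
    (\<forall>\<sigma>\<in>\<Sigma>. (\<forall>u\<in>ray_gens \<sigma>. ipair (m \<sigma>) u = - D u) \<and> (\<forall>x\<in>chart_points \<sigma>. 0 < N \<sigma> x) \<and>
      continuous_on (chart_points \<sigma>) (N \<sigma>)) \<and>
    (\<forall>\<sigma>\<in>\<Sigma>. \<forall>\<tau>\<in>\<Sigma>. \<tau> \<subseteq> \<sigma> \<longrightarrow> (\<forall>x\<in>chart_points \<tau>.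
      N \<tau> x * cmod (x (m \<sigma> - m \<tau>)) = N \<sigma> (incl \<sigma> x)))"

definition sum_metric :: "nat set \<Rightarrow> (nat \<Rightarrow> (real ^ 'n::finite) set \<Rightarrow> int ^ 'n) \<Rightarrow>
  (nat \<Rightarrow> (real ^ 'n) set \<Rightarrow> 'n point \<Rightarrow> real) \<Rightarrow> ('n, nat \<Rightarrow> 'n laurent) metric" where
  "sum_metric J m N \<sigma> x s t = (\<Sum>j\<in>J. div_metric (m j) (N j) \<sigma> x (s j) (t j))"

section \<open>Continuity, and absolute values of characters on the torus\<close>

lemma continuous_on_Max_image:
  fixes f :: "'i \<Rightarrow> 'x::topological_space \<Rightarrow> real"
  assumes "finite A" "A \<noteq> {}" "\<And>i. i \<in> A \<Longrightarrow> continuous_on S (f i)"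
  shows "continuous_on S (\<lambda>x. Max ((\<lambda>i. f i x) ` A))"
  using assms
proof (induction A rule: finite_ne_induct)
  case (insert i A)
  then have "continuous_on S (\<lambda>x. max (f i x) (Max ((\<lambda>i. f i x) ` A)))"
    by (intro continuous_on_max) auto
  moreover have "Max ((\<lambda>i. f i x) ` insert i A) = max (f i x) (Max ((\<lambda>i. f i x) ` A))" for x
    using insert by simp
  ultimately show ?case by simp
qed simp

lemma continuous_on_coordinate: "continuous_on S (\<lambda>x :: 'n point. x m)"
  by (rule continuous_on_subset[OF continuous_on_product_coordinates]) simp

lemma continuous_on_ev: "continuous_on S (\<lambda>x. ev x f)"
  unfolding ev_def by (intro continuous_intros continuous_on_coordinate)

lemma additive_int_vec:
  fixes f :: "int ^ 'n::finite \<Rightarrow> real"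
  assumes add: "\<And>a b. f (a + b) = f a + f b"
  shows "f m = (\<Sum>i\<in>UNIV. of_int (m $ i) * f (axis i 1))"
proof -
  have zero: "f 0 = 0" using add[of 0 0] by simp
  have neg: "f (- a) = - f a" for a using add[of a "- a"] zero by simp
  have nat: "f (of_nat k *s a) = of_nat k * f a" for k a

  proof (induction k)
    case (Suc k)
    have "of_nat (Suc k) *s a = a + of_nat k *s a" by (simp add: vec_eq_iff algebra_simps)
    then show ?case using Suc by (simp add: add algebra_simps)
  qed (simp add: zero)
  have scale: "f (k *s a) = of_int k * f a" for k a
  proof (cases "0 \<le> k")
    case True
    then show ?thesis using nat[of "nat k" a] by simp
  next
    case False
    then have "k *s a = - (of_nat (nat (- k)) *s a)" by (simp add: vec_eq_iff)
    then show ?thesis using nat[of "nat (- k)" a] False by (simp add: neg)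
  qed
  have sum: "f (\<Sum>i\<in>A. g i) = (\<Sum>i\<in>A. f (g i))" for A :: "'n set" and g
    by (induction A rule: infinite_finite_induct) (simp_all add: zero add)
  have "m = (\<Sum>i\<in>UNIV. m $ i *s axis i 1)" by (rule basis_expansion[symmetric])
  then have "f m = f (\<Sum>i\<in>UNIV. m $ i *s axis i 1)" by (rule arg_cong)
  then show ?thesis by (simp add: sum scale)
qed

text \<open>Characters do not vanish on the torus, so the logarithm of the absolute value of
  \<open>t m\<close> is additive in \<open>m\<close> and determined by the coordinate characters,
  whose values define \<open>neg_log\<close>.\<close>

lemma torus_point_norm:
  assumes t: "t \<in> chart_points ({0} :: (real ^ 'n::finite) set)"
  shows "cmod (t m) = exp (- pairing m (neg_log t))"
proof -
  have mult: "t (a + b) = t a * t b" for a b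
    using t by (simp add: chart_points_def dual_monoid_zero)
  have one: "t 0 = 1" using t by (simp add: chart_points_def)
  have nz: "t a \<noteq> 0" for a using mult[of a "- a"] one by auto
  have "ln (cmod (t (a + b))) = ln (cmod (t a)) + ln (cmod (t b))" for a b
    using nz by (simp add: mult norm_mult ln_mult)
  then have "ln (cmod (t m)) = (\<Sum>i\<in>UNIV. of_int (m $ i) * ln (cmod (t (axis i 1))))"
    by (rule additive_int_vec)
  also have "\<dots> = - pairing m (neg_log t)"
    by (simp add: pairing_def neg_log_def real_vec_def inner_vec_def sum_negf)
  finally show ?thesis using nz[of m] by (metis exp_ln zero_less_norm_iff)
qed

context
  fixes R :: "complex set" and \<Sigma> :: "(real ^ 'n::finite) set set"
  assumes R: "ring_subset R" and sf: "smooth_fan \<Sigma>"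
begin

lemma fan_nonempty: "\<Sigma> \<noteq> {}" using fan_zero[OF sf] by blast

lemma invertible_char:
  assumes "\<sigma> \<in> \<Sigma>" "\<tau> \<in> \<Sigma>" "\<tau> \<subseteq> \<sigma>" "\<And>u. u \<in> ray_gens \<tau> \<Longrightarrow> ipair m u = ipair m' u"
  shows "m - m' \<in> dual_monoid \<tau>"
  using assms by (simp add: dual_monoid_rays[OF sf] ipair_diff_left)

lemma point_mult: "x \<in> chart_points \<sigma> \<Longrightarrow> a \<in> dual_monoid \<sigma> \<Longrightarrow> b \<in> dual_monoid \<sigma> \<Longrightarrow> x (a + b) = x a * x b"
  by (simp add: chart_points_def)

lemma point_invertible:
  assumes "x \<in> chart_points \<sigma>" "a \<in> dual_monoid \<sigma>" "- a \<in> dual_monoid \<sigma>"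
  shows "x a \<noteq> 0"
  using point_mult[OF assms] assms(1) by (auto simp: chart_points_def)

section \<open>Norms for globally generated divisors\<close>

context
  fixes D m assumes gc: "generating_chars \<Sigma> D m"
begin

text \<open>The quotient of a global section by the local generator is regular on the chart. Hence
  the terms of \<open>max_norm\<close> are values of genuine functions and not the default 0 that
  points take off the dual monoid.\<close>

lemma generating_diff: "\<sigma> \<in> \<Sigma> \<Longrightarrow> \<tau> \<in> \<Sigma> \<Longrightarrow> m \<tau> - m \<sigma> \<in> dual_monoid \<sigma>"
  unfolding dual_monoid_rays[OF sf] mem_Collect_eq
proof
  fix u assume s: "\<sigma> \<in> \<Sigma>" "\<tau> \<in> \<Sigma>" and u: "u \<in> ray_gens \<sigma>"
  then have "u \<in> all_rays \<Sigma>" by (auto simp: all_rays_def)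
  then have "- D u \<le> ipair (m \<tau>) u" "ipair (m \<sigma>) u = - D u"
    using gc s u unfolding generating_chars_def by blast+
  then show "0 \<le> ipair (m \<tau> - m \<sigma>) u" by (simp add: ipair_diff_left)
qed

text \<open>The term of \<sigma> itself equals 1; the bound allows division by the maximum.\<close>

lemma max_norm_ge_one:
  assumes "\<sigma> \<in> \<Sigma>" "x \<in> chart_points \<sigma>"
  shows "1 \<le> max_norm \<Sigma> m \<sigma> x"
proof -
  have "cmod (x (m \<sigma> - m \<sigma>)) \<le> max_norm \<Sigma> m \<sigma> x"
    unfolding max_norm_def by (rule Max_ge[OF _ imageI[OF assms(1)]]) (simp add: fan_finite[OF sf])
  then show ?thesis using assms by (simp add: chart_points_def)
qed

lemma continuous_max_norm: "continuous_on (chart_points \<sigma>) (max_norm \<Sigma> m \<sigma>)"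
  unfolding max_norm_def
  by (intro continuous_on_Max_image fan_finite[OF sf] fan_nonempty continuous_on_norm continuous_on_coordinate)

text \<open>A change of local generator multiplies every term by the same nonnegative factor, which
  passes through the maximum.\<close>

lemma max_norm_incl:
  assumes "\<sigma> \<in> \<Sigma>" "\<tau> \<in> \<Sigma>" "\<tau> \<subseteq> \<sigma>" "x \<in> chart_points \<tau>"
  shows "max_norm \<Sigma> m \<tau> x = max_norm \<Sigma> m \<sigma> (incl \<sigma> x) * cmod (x (m \<sigma> - m \<tau>))"
proof -
  have "cmod (x (m \<rho> - m \<tau>)) = cmod (x (m \<sigma> - m \<tau>)) * cmod (incl \<sigma> x (m \<rho> - m \<sigma>))" if "\<rho> \<in> \<Sigma>" for \<rho>
  proof -
    have d: "m \<rho> - m \<sigma> \<in> dual_monoid \<sigma>" using generating_diff assms that by blast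
    have "x ((m \<sigma> - m \<tau>) + (m \<rho> - m \<sigma>)) = x (m \<sigma> - m \<tau>) * x (m \<rho> - m \<sigma>)"
      using point_mult[OF assms(4) generating_diff[OF assms(2,1)] subsetD[OF dual_monoid_antimono[OF assms(3)] d]]
      by simp
    then show ?thesis using d by (simp add: incl_def norm_mult)
  qed
  then have "(\<lambda>\<rho>. cmod (x (m \<rho> - m \<tau>))) ` \<Sigma> =
      (\<lambda>y. cmod (x (m \<sigma> - m \<tau>)) * y) ` (\<lambda>\<rho>. cmod (incl \<sigma> x (m \<rho> - m \<sigma>))) ` \<Sigma>"
    by (auto simp: image_image)
  moreover have "cmod (x (m \<sigma> - m \<tau>)) * Max ((\<lambda>\<rho>. cmod (incl \<sigma> x (m \<rho> - m \<sigma>))) ` \<Sigma>) =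
      Max ((\<lambda>y. cmod (x (m \<sigma> - m \<tau>)) * y) ` (\<lambda>\<rho>. cmod (incl \<sigma> x (m \<rho> - m \<sigma>))) ` \<Sigma>)"
    using fan_finite[OF sf] fan_nonempty by (intro mono_Max_commute) (auto simp: mono_def mult_left_mono)
  ultimately show ?thesis unfolding max_norm_def by (simp add: mult.commute)
qed

lemma min_pairing_on_cone:
  assumes "\<sigma> \<in> \<Sigma>" "v \<in> \<sigma>"
  shows "min_pairing \<Sigma> m v = pairing (m \<sigma>) v"
  unfolding min_pairing_def
proof (rule Min_eqI)
  fix y assume "y \<in> (\<lambda>\<tau>. pairing (m \<tau>) v) ` \<Sigma>"
  then obtain \<tau> where t: "\<tau> \<in> \<Sigma>" "y = pairing (m \<tau>) v" by blast
  then have "0 \<le> pairing (m \<tau> - m \<sigma>) v"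
    using generating_diff[OF assms(1) t(1)] assms(2) by (simp add: dual_monoid_def)
  then show "pairing (m \<sigma>) v \<le> y" using t by (simp add: pairing_diff_left)
qed (use assms fan_finite[OF sf] in auto)

text \<open>On the torus the negative logarithm turns the maximum of absolute values into a minimum
  of pairings.\<close>

lemma max_norm_torus:
  assumes "t \<in> chart_points {0}"
  shows "max_norm \<Sigma> m {0} t = exp (pairing (m {0}) (neg_log t) - min_pairing \<Sigma> m (neg_log t))"
proof -
  have min: "min_pairing \<Sigma> m (neg_log t) \<in> (\<lambda>\<tau>. pairing (m \<tau>) (neg_log t)) ` \<Sigma>"
    unfolding min_pairing_def using fan_finite[OF sf] fan_nonempty by (intro Min_in) auto
  then obtain \<rho> where r: "\<rho> \<in> \<Sigma>" "min_pairing \<Sigma> m (neg_log t) = pairing (m \<rho>) (neg_log t)" by auto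
  show ?thesis
    unfolding max_norm_def
  proof (rule Max_eqI)
    fix y assume "y \<in> (\<lambda>\<tau>. cmod (t (m \<tau> - m {0}))) ` \<Sigma>"
    then obtain \<tau> where t: "\<tau> \<in> \<Sigma>" "y = cmod (t (m \<tau> - m {0}))" by blast
    moreover have "min_pairing \<Sigma> m (neg_log t) \<le> pairing (m \<tau>) (neg_log t)"
      unfolding min_pairing_def using t fan_finite[OF sf] by (intro Min_le) auto
    ultimately show "y \<le> exp (pairing (m {0}) (neg_log t) - min_pairing \<Sigma> m (neg_log t))"
      by (simp add: torus_point_norm[OF assms] pairing_diff_left)
  next
    show "exp (pairing (m {0}) (neg_log t) - min_pairing \<Sigma> m (neg_log t)) \<in>
        (\<lambda>\<tau>. cmod (t (m \<tau> - m {0}))) ` \<Sigma>"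
      using r by (intro image_eqI[of _ _ \<rho>]) (auto simp: torus_point_norm[OF assms] pairing_diff_left)
  qed (use fan_finite[OF sf] in auto)
qed

end

text \<open>Adding a large multiple of an ample divisor makes any divisor globally generated.\<close>

lemma difference_of_generated:
  assumes proj: "projective_fan \<Sigma>"
  shows "\<exists>D1 D2 m1 m2. generating_chars \<Sigma> D1 m1 \<and> generating_chars \<Sigma> D2 m2 \<and> (\<forall>u. D u = D1 u - D2 u)"
proof -
  obtain A \<psi> where comp: "complete_fan \<Sigma>" and supp: "is_support_function \<Sigma> A \<psi>"
    and amp: "\<forall>\<sigma>\<in>\<Sigma>. interior \<sigma> \<noteq> {} \<longrightarrow>
      (\<exists>m. (\<forall>v\<in>\<sigma>. \<psi> v = pairing m v) \<and> (\<forall>v. v \<notin> \<sigma> \<longrightarrow> \<psi> v < pairing m v))"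
    using proj unfolding projective_fan_def ample_def by blast
  \<comment> \<open>Ampleness provides characters only for full-dimensional cones, so every cone
    borrows that of a full-dimensional cone containing it.\<close>
  have "\<exists>\<rho>. \<rho> \<in> \<Sigma> \<and> \<sigma> \<subseteq> \<rho> \<and> interior \<rho> \<noteq> {}" if "\<sigma> \<in> \<Sigma>" for \<sigma>
    using cone_in_full_cone[OF sf comp that] by blast
  then obtain \<rho> where \<rho>: "\<And>\<sigma>. \<sigma> \<in> \<Sigma> \<Longrightarrow> \<rho> \<sigma> \<in> \<Sigma> \<and> \<sigma> \<subseteq> \<rho> \<sigma> \<and> interior (\<rho> \<sigma>) \<noteq> {}" by metis
  have "\<exists>m. (\<forall>v\<in>\<rho> \<sigma>. \<psi> v = pairing m v) \<and> (\<forall>v. v \<notin> \<rho> \<sigma> \<longrightarrow> \<psi> v < pairing m v)" if "\<sigma> \<in> \<Sigma>" for \<sigma>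
    using amp \<rho>[OF that] by blast
  then obtain a where a_on: "\<And>\<sigma> v. \<sigma> \<in> \<Sigma> \<Longrightarrow> v \<in> \<rho> \<sigma> \<Longrightarrow> \<psi> v = pairing (a \<sigma>) v"
    and a_off: "\<And>\<sigma> v. \<sigma> \<in> \<Sigma> \<Longrightarrow> v \<notin> \<rho> \<sigma> \<Longrightarrow> \<psi> v < pairing (a \<sigma>) v" by metis
  have "\<exists>m. \<forall>u\<in>ray_gens (\<rho> \<sigma>). ipair m u = - D u" if "\<sigma> \<in> \<Sigma>" for \<sigma>
    using ray_interpolate[OF sf, of "\<rho> \<sigma>" "\<lambda>u. - D u"] \<rho>[OF that] by blast
  then obtain d where d: "\<And>\<sigma> u. \<sigma> \<in> \<Sigma> \<Longrightarrow> u \<in> ray_gens (\<rho> \<sigma>) \<Longrightarrow> ipair (d \<sigma>) u = - D u" by metis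
  \<comment> \<open>\<open>k\<close> bounds how far \<open>d \<sigma>\<close>, which matches
    \<open>D\<close> on its own cone, falls short along any other ray.\<close>
  define k where "k = (\<Sum>\<sigma>\<in>\<Sigma>. \<Sum>u\<in>all_rays \<Sigma>. \<bar>- D u - ipair (d \<sigma>) u\<bar>)"
  have k0: "0 \<le> k" unfolding k_def by (intro sum_nonneg) auto
  have k: "- D u - ipair (d \<sigma>) u \<le> k" if "\<sigma> \<in> \<Sigma>" "u \<in> all_rays \<Sigma>" for \<sigma> u
  proof -
    have "\<bar>- D u - ipair (d \<sigma>) u\<bar> \<le> (\<Sum>u\<in>all_rays \<Sigma>. \<bar>- D u - ipair (d \<sigma>) u\<bar>)"
      using that finite_all_rays[OF sf] by (intro member_le_sum) auto
    also have "\<dots> \<le> k" unfolding k_def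
      using that fan_finite[OF sf]
      by (intro member_le_sum[of \<sigma> _ "\<lambda>\<sigma>. \<Sum>u\<in>all_rays \<Sigma>. \<bar>- D u - ipair (d \<sigma>) u\<bar>"])
        (auto intro: sum_nonneg)
    finally show ?thesis by linarith
  qed
  have \<psi>: "\<psi> (real_vec u) = - real_of_int (A u)" if "u \<in> all_rays \<Sigma>" for u
    using supp that unfolding is_support_function_def all_rays_def by blast
  have on: "ipair (a \<sigma>) u = - A u" "ipair (d \<sigma>) u = - D u"
    if "\<sigma> \<in> \<Sigma>" "u \<in> all_rays \<Sigma>" "real_vec u \<in> \<rho> \<sigma>" for \<sigma> u
  proof -
    have "real_of_int (ipair (a \<sigma>) u) = real_of_int (- A u)"
      using a_on[OF that(1,3)] \<psi>[OF that(2)] by (simp add: pairing_real_vec)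
    then show "ipair (a \<sigma>) u = - A u" by (simp only: of_int_eq_iff)
    have "u \<in> all_rays \<Sigma>" by (rule that(2))
    then obtain \<tau> where "\<tau> \<in> \<Sigma>" "u \<in> ray_gens \<tau>" by (auto simp: all_rays_def)
    then have "u \<in> ray_gens (\<rho> \<sigma>)" using ray_gens_of_mem[OF sf _ _ _ that(3)] \<rho>[OF that(1)] by blast
    then show "ipair (d \<sigma>) u = - D u" by (rule d[OF that(1)])
  qed
  \<comment> \<open>Strict concavity between integers leaves a gap of at least 1; \<open>k\<close>
    copies of \<open>A\<close> widen it enough to cover the shortfall of
    \<open>d \<sigma>\<close>.\<close>
  have off: "- A u + 1 \<le> ipair (a \<sigma>) u" if "\<sigma> \<in> \<Sigma>" "u \<in> all_rays \<Sigma>" "real_vec u \<notin> \<rho> \<sigma>" for \<sigma> u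
  proof -
    have "real_of_int (- A u) < real_of_int (ipair (a \<sigma>) u)"
      using a_off[OF that(1,3)] \<psi>[OF that(2)] by (simp add: pairing_real_vec)
    then show ?thesis by (simp only: of_int_less_iff)
  qed
  have mem: "real_vec u \<in> \<rho> \<sigma>" "u \<in> all_rays \<Sigma>" if "\<sigma> \<in> \<Sigma>" "u \<in> ray_gens \<sigma>" for \<sigma> u
    using ray_gens_mem[OF sf that] \<rho>[OF that(1)] that by (auto simp: all_rays_def)
  have "generating_chars \<Sigma> (\<lambda>u. D u + k * A u) (\<lambda>\<sigma>. d \<sigma> + k *s a \<sigma>)"
    unfolding generating_chars_def
  proof (intro ballI conjI)
    fix \<sigma> u assume su: "\<sigma> \<in> \<Sigma>" "u \<in> ray_gens \<sigma>"
    show "ipair (d \<sigma> + k *s a \<sigma>) u = - (D u + k * A u)"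
      using on[OF su(1) mem(2,1)[OF su]] by (simp add: ipair_add_left ipair_scale_left)
  next
    fix \<sigma> u assume su: "\<sigma> \<in> \<Sigma>" "u \<in> all_rays \<Sigma>"
    show "- (D u + k * A u) \<le> ipair (d \<sigma> + k *s a \<sigma>) u"
    proof (cases "real_vec u \<in> \<rho> \<sigma>")
      case True
      then show ?thesis using on[OF su] by (simp add: ipair_add_left ipair_scale_left)
    next
      case False
      have "k * (- A u + 1) \<le> k * ipair (a \<sigma>) u" using off[OF su False] k0 by (rule mult_left_mono)
      then show ?thesis using k[OF su] by (simp add: ipair_add_left ipair_scale_left algebra_simps)
    qed
  qed
  moreover have "generating_chars \<Sigma> (\<lambda>u. k * A u) (\<lambda>\<sigma>. k *s a \<sigma>)"
    unfolding generating_chars_def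
  proof (intro ballI conjI)
    fix \<sigma> u assume su: "\<sigma> \<in> \<Sigma>" "u \<in> ray_gens \<sigma>"
    show "ipair (k *s a \<sigma>) u = - (k * A u)"
      using on[OF su(1) mem(2,1)[OF su]] by (simp add: ipair_scale_left)
  next
    fix \<sigma> u assume su: "\<sigma> \<in> \<Sigma>" "u \<in> all_rays \<Sigma>"
    have "- A u \<le> ipair (a \<sigma>) u" using on[OF su] off[OF su] by (cases "real_vec u \<in> \<rho> \<sigma>") auto
    then have "k * (- A u) \<le> k * ipair (a \<sigma>) u" using k0 by (rule mult_left_mono)
    then show "- (k * A u) \<le> ipair (k *s a \<sigma>) u" by (simp add: ipair_scale_left)
  qed
  ultimately show ?thesis
    by (intro exI[of _ "\<lambda>u. D u + k * A u"] exI[of _ "\<lambda>u. k * A u"]) auto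
qed

section \<open>Metrics from norms of local generators\<close>

lemma div_metric_add: "div_metric m N \<sigma> x (f + f') g = div_metric m N \<sigma> x f g + div_metric m N \<sigma> x f' g"
  by (simp add: div_metric_def distrib_left distrib_right ev_add)

lemma div_metric_cnj: "div_metric m N \<sigma> x g f = cnj (div_metric m N \<sigma> x f g)"
  by (simp add: div_metric_def)

lemma div_metric_zero: "div_metric m N \<sigma> x 0 g = 0" "div_metric m N \<sigma> x f 0 = 0"
  by (simp_all add: div_metric_def)

context
  fixes D m N assumes nd: "norm_data \<Sigma> D m N"
begin

lemma norm_data_translate:
  "\<sigma> \<in> \<Sigma> \<Longrightarrow> f \<in> dsec R D \<sigma> \<Longrightarrow> Poly_Mapping.single (- m \<sigma>) 1 * f \<in> carrier (chart_ring R \<sigma>)"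
  using dsec_translate[OF R sf, of \<sigma> "m \<sigma>" D f] nd by (simp add: norm_data_def)

lemma div_metric_smult:
  assumes "\<sigma> \<in> \<Sigma>" "x \<in> chart_points \<sigma>" "f \<in> carrier (chart_ring R \<sigma>)" "g \<in> dsec R D \<sigma>"
  shows "div_metric m N \<sigma> x (f * g) k = ev x f * div_metric m N \<sigma> x g k"
  using ev_mult[OF assms(2,3) norm_data_translate[OF assms(1,4)]]
  by (simp add: div_metric_def mult.left_commute)

text \<open>The transition character multiplies the coordinate of a section, and its absolute value
  is the factor by which \<open>norm_data\<close> lets \<open>N\<close> change; the two effects
  cancel.\<close>

lemma div_metric_incl:
  assumes st: "\<sigma> \<in> \<Sigma>" "\<tau> \<in> \<Sigma>" "\<tau> \<subseteq> \<sigma>" and x: "x \<in> chart_points \<tau>"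
    and f: "f \<in> dsec R D \<sigma>" and g: "g \<in> dsec R D \<sigma>"
  shows "div_metric m N \<tau> x f g = div_metric m N \<sigma> (incl \<sigma> x) f g"
proof -
  have md: "m \<sigma> - m \<tau> \<in> dual_monoid \<tau>"
    using nd st ray_gens_mono[OF sf st(2,1,3)]
      by (intro invertible_char[OF st]) (auto simp: norm_data_def)
  have ev: "ev x (Poly_Mapping.single (- m \<tau>) 1 * f) = x (m \<sigma> - m \<tau>) * ev (incl \<sigma> x) (Poly_Mapping.single (- m \<sigma>) 1 * f)"
    if f: "f \<in> dsec R D \<sigma>" for f
  proof -
    have c: "Poly_Mapping.single (- m \<sigma>) 1 * f \<in> carrier (chart_ring R \<sigma>)"
      by (rule norm_data_translate[OF st(1) f])
    have "1 \<in> R" using R by (simp add: ring_subset_def)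
    have "Poly_Mapping.single (- m \<tau>) 1 * f =
        Poly_Mapping.single (m \<sigma> - m \<tau>) 1 * (Poly_Mapping.single (- m \<sigma>) 1 * f)"
      by (simp add: mult_single flip: mult.assoc)
    then have "ev x (Poly_Mapping.single (- m \<tau>) 1 * f) =
        ev x (Poly_Mapping.single (m \<sigma> - m \<tau>) 1) * ev x (Poly_Mapping.single (- m \<sigma>) 1 * f)"
      using ev_mult[OF x single_in_chart_ring[OF R \<open>1 \<in> R\<close> md] subsetD[OF chart_ring_antimono[OF st(3)] c]]
      by simp
    then show ?thesis by (simp add: ev_incl[OF c])
  qed
  let ?f = "ev (incl \<sigma> x) (Poly_Mapping.single (- m \<sigma>) 1 * f)"
  let ?g = "ev (incl \<sigma> x) (Poly_Mapping.single (- m \<sigma>) 1 * g)"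
  have N: "N \<tau> x * cmod (x (m \<sigma> - m \<tau>)) = N \<sigma> (incl \<sigma> x)"
    using nd st x by (simp add: norm_data_def)
  have "div_metric m N \<tau> x f g = complex_of_real ((N \<tau> x)\<^sup>2) * (x (m \<sigma> - m \<tau>) * cnj (x (m \<sigma> - m \<tau>))) * (?f * cnj ?g)"
    unfolding div_metric_def ev[OF f] ev[OF g] by (simp add: mult_ac)
  also have "complex_of_real ((N \<tau> x)\<^sup>2) * (x (m \<sigma> - m \<tau>) * cnj (x (m \<sigma> - m \<tau>))) =
      complex_of_real ((N \<tau> x * cmod (x (m \<sigma> - m \<tau>)))\<^sup>2)"
    by (simp only: power_mult_distrib of_real_mult complex_norm_square mult.assoc)
  finally show ?thesis unfolding N by (simp add: div_metric_def)
qed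

lemma continuous_div_metric: "\<sigma> \<in> \<Sigma> \<Longrightarrow> continuous_on (chart_points \<sigma>) (\<lambda>x. div_metric m N \<sigma> x f g)"
  using nd unfolding norm_data_def div_metric_def
  by (intro continuous_intros continuous_on_ev) auto

end

lemma hermitian_sum_metric:
  assumes nd: "\<And>j. j \<in> J \<Longrightarrow> norm_data \<Sigma> (D j) (m j) (N j)" and J: "finite J"
  shows "hermitian_metric R \<Sigma> (sum_sheaf R J D) (sum_metric J m N)"
  unfolding hermitian_metric_def
proof (intro conjI ballI allI impI)
  fix \<sigma> x s s' t assume "\<sigma> \<in> \<Sigma>"
  show "sum_metric J m N \<sigma> x (s \<oplus>\<^bsub>sections (sum_sheaf R J D) \<sigma>\<^esub> s') t =
      sum_metric J m N \<sigma> x s t + sum_metric J m N \<sigma> x s' t"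
    by (simp add: sum_metric_def div_metric_add sum.distrib)
  show "sum_metric J m N \<sigma> x t s = cnj (sum_metric J m N \<sigma> x s t)"
    by (simp add: sum_metric_def div_metric_cnj[of _ _ _ _ "t _"])
next
  fix \<sigma> x f s t assume a: "\<sigma> \<in> \<Sigma>" "x \<in> chart_points \<sigma>" "f \<in> carrier (chart_ring R \<sigma>)" "s \<in> sec (sum_sheaf R J D) \<sigma>"
  show "sum_metric J m N \<sigma> x (f \<odot>\<^bsub>sections (sum_sheaf R J D) \<sigma>\<^esub> s) t = ev x f * sum_metric J m N \<sigma> x s t"
    using a
      by (auto simp: sum_metric_def sum_distrib_left sec_sum_sheaf div_metric_smult[OF nd] intro!: sum.cong)
next
  fix \<sigma> x f es a
  assume s: "\<sigma> \<in> \<Sigma>" and x: "x \<in> chart_points \<sigma>" and a: "\<exists>j<length es. a j \<noteq> (0::complex)"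
    and fr: "is_frame (chart_ring R \<sigma>) (sections (sum_sheaf R J D) \<sigma>) f es \<and> ev x f \<noteq> 0"
  interpret coord_module R \<sigma> "sections (sum_sheaf R J D) \<sigma>" J
    "\<lambda>x j. Poly_Mapping.single (- m j \<sigma>) 1 * x j" "\<lambda>j i. if i = j then Poly_Mapping.single (m j \<sigma>) 1 else 0"
    using nd s by (intro coord_module_sum_sheaf[OF R sf s J]) (auto simp: norm_data_def)
  show "0 < Re (\<Sum>i<length es. \<Sum>j<length es. a i * cnj (a j) * sum_metric J m N \<sigma> x (es ! i) (es ! j))"
  proof (rule frame_positive[where w = "\<lambda>j. (N j \<sigma> x)\<^sup>2"])
    fix j assume "j \<in> J"
    then have "0 < N j \<sigma> x" using nd s x by (simp add: norm_data_def)
    then show "0 < (N j \<sigma> x)\<^sup>2" by simp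
  qed (use fr x a in \<open>auto simp: sum_metric_def div_metric_def\<close>)
next
  fix \<sigma> \<tau> x s t
  assume a: "\<sigma> \<in> \<Sigma>" "\<tau> \<in> \<Sigma>" "\<tau> \<subseteq> \<sigma>" "x \<in> chart_points \<tau>" "s \<in> sec (sum_sheaf R J D) \<sigma>" "t \<in> sec (sum_sheaf R J D) \<sigma>"
  show "sum_metric J m N \<tau> x (restr (sum_sheaf R J D) \<sigma> \<tau> s) (restr (sum_sheaf R J D) \<sigma> \<tau> t) =
      sum_metric J m N \<sigma> (incl \<sigma> x) s t"
    unfolding sum_metric_def sum_sheaf_simps using a
    by (intro sum.cong refl div_metric_incl[OF nd]) (auto simp: sec_sum_sheaf)
next
  fix \<sigma> s t assume "\<sigma> \<in> \<Sigma>"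
  then show "continuous_on (chart_points \<sigma>) (\<lambda>x. sum_metric J m N \<sigma> x s t)"
    unfolding sum_metric_def by (intro continuous_on_sum continuous_div_metric[OF nd])
qed

lemma hermitian_div_metric:
  assumes nd: "norm_data \<Sigma> D m N"
  shows "hermitian_metric R \<Sigma> (divisor_sheaf R D) (div_metric m N)"
  unfolding hermitian_metric_def
proof (intro conjI ballI allI impI)
  fix \<sigma> x f es a
  assume s: "\<sigma> \<in> \<Sigma>" and x: "x \<in> chart_points \<sigma>" and a: "\<exists>j<length es. a j \<noteq> (0::complex)"
    and fr: "is_frame (chart_ring R \<sigma>) (sections (divisor_sheaf R D) \<sigma>) f es \<and> ev x f \<noteq> 0"
  interpret coord_module R \<sigma> "sections (divisor_sheaf R D) \<sigma>" "{0}"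
    "\<lambda>f j. Poly_Mapping.single (- m \<sigma>) 1 * f" "\<lambda>j. Poly_Mapping.single (m \<sigma>) 1"
    using nd s by (intro coord_module_divisor_sheaf[OF R sf s]) (auto simp: norm_data_def)
  show "0 < Re (\<Sum>i<length es. \<Sum>j<length es. a i * cnj (a j) * div_metric m N \<sigma> x (es ! i) (es ! j))"
  proof (rule frame_positive[where w = "\<lambda>j. (N \<sigma> x)\<^sup>2"])
    have "0 < N \<sigma> x" using nd s x by (simp add: norm_data_def)
    then show "0 < (N \<sigma> x)\<^sup>2" by simp
  qed (use fr x a in \<open>auto simp: div_metric_def\<close>)
qed (auto simp: div_metric_add div_metric_smult[OF nd] div_metric_cnj[symmetric] sec_divisor_sheaf
    intro: div_metric_incl[OF nd] continuous_div_metric[OF nd])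

text \<open>A linear function on a cone is determined by the rays and the cones cover the space, so
  the definite description names any function with the required properties.\<close>

lemma support_function_unique:
  assumes comp: "complete_fan \<Sigma>" and "is_support_function \<Sigma> D \<psi>"
  shows "support_function \<Sigma> D = \<psi>"
  unfolding support_function_def
proof (rule the_equality)
  fix \<phi> assume phi: "is_support_function \<Sigma> D \<phi>"
  show "\<phi> = \<psi>"
  proof
    fix v
    obtain \<sigma> where s: "\<sigma> \<in> \<Sigma>" "v \<in> \<sigma>" using comp by (auto simp: complete_fan_def)
    obtain l where l: "linear l" "\<forall>v\<in>\<sigma>. \<phi> v = l v" using phi s unfolding is_support_function_def by blast
    obtain k where k: "linear k" "\<forall>v\<in>\<sigma>. \<psi> v = k v"
      using assms(2) s unfolding is_support_function_def by blast
    have "l (real_vec u) = k (real_vec u)" if "u \<in> ray_gens \<sigma>" for u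
      using ray_gens_mem[OF sf s(1) that] l k phi assms(2) s(1) that
      unfolding is_support_function_def by metis
    then have "l v = k v" by (rule linear_eq_on_cone[OF sf s(1) l(1) k(1) _ s(2)])
    then show "\<phi> v = \<psi> v" using l k s by simp
  qed
qed (rule assms(2))

text \<open>Write \<open>D\<close> as a difference of globally generated divisors. The norm of a
  local generator is the reciprocal of \<open>max_norm\<close> for each of them, and norms divide
  when divisors are subtracted, which gives the quotient \<open>N\<close>. Correspondingly the
  support function is a difference of two minima.\<close>

lemma canonical_metric_exists:
  assumes proj: "projective_fan \<Sigma>"
  shows "\<exists>m N. norm_data \<Sigma> D m N \<and> canonical_metric_divisor R \<Sigma> D (div_metric m N)"
proof -
  obtain D1 D2 m1 m2 where g1: "generating_chars \<Sigma> D1 m1" and g2: "generating_chars \<Sigma> D2 m2"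
    and D: "\<And>u. D u = D1 u - D2 u"
    using difference_of_generated[OF proj, of D] by blast
  define m where "m \<sigma> = m1 \<sigma> - m2 \<sigma>" for \<sigma>
  define N where "N \<sigma> x = max_norm \<Sigma> m2 \<sigma> x / max_norm \<Sigma> m1 \<sigma> x" for \<sigma> x
  have m: "ipair (m \<sigma>) u = - D u" if "\<sigma> \<in> \<Sigma>" "u \<in> ray_gens \<sigma>" for \<sigma> u
    using g1 g2 that by (simp add: m_def D ipair_diff_left generating_chars_def)
  have pos: "0 < max_norm \<Sigma> m1 \<sigma> x" "0 < max_norm \<Sigma> m2 \<sigma> x" if "\<sigma> \<in> \<Sigma>" "x \<in> chart_points \<sigma>" for \<sigma> x
    using max_norm_ge_one[OF g1 that] max_norm_ge_one[OF g2 that] by auto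
  have nd: "norm_data \<Sigma> D m N"
    unfolding norm_data_def
  proof (intro conjI ballI impI)
    fix \<sigma> assume s: "\<sigma> \<in> \<Sigma>"
    show "\<And>u. u \<in> ray_gens \<sigma> \<Longrightarrow> ipair (m \<sigma>) u = - D u" by (rule m[OF s])
    show "\<And>x. x \<in> chart_points \<sigma> \<Longrightarrow> 0 < N \<sigma> x" using pos[OF s] by (simp add: N_def)
    have "max_norm \<Sigma> m1 \<sigma> x \<noteq> 0" if "x \<in> chart_points \<sigma>" for x using pos(1)[OF s that] by simp
    then show "continuous_on (chart_points \<sigma>) (N \<sigma>)"
      unfolding N_def
        by (intro continuous_on_divide continuous_max_norm[OF g1] continuous_max_norm[OF g2]) auto
  next
    fix \<sigma> \<tau> x assume st: "\<sigma> \<in> \<Sigma>" "\<tau> \<in> \<Sigma>" "\<tau> \<subseteq> \<sigma>" and x: "x \<in> chart_points \<tau>"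
    have eq: "ipair (m' \<sigma>) u = ipair (m' \<tau>) u" if "generating_chars \<Sigma> D' m'" "u \<in> ray_gens \<tau>" for D' m' u
      using that st ray_gens_mono[OF sf st(2,1,3)] by (auto simp: generating_chars_def)
    have d1: "m1 \<sigma> - m1 \<tau> \<in> dual_monoid \<tau>" "- (m1 \<sigma> - m1 \<tau>) \<in> dual_monoid \<tau>"
      using invertible_char[OF st, of "m1 \<sigma>" "m1 \<tau>"] invertible_char[OF st, of "m1 \<tau>" "m1 \<sigma>"] eq[OF g1] by auto
    have d2: "m2 \<sigma> - m2 \<tau> \<in> dual_monoid \<tau>" "m2 \<tau> - m2 \<sigma> \<in> dual_monoid \<tau>"
      using invertible_char[OF st, of "m2 \<sigma>" "m2 \<tau>"] invertible_char[OF st, of "m2 \<tau>" "m2 \<sigma>"] eq[OF g2] by auto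
    have nz: "x (m1 \<sigma> - m1 \<tau>) \<noteq> 0" by (rule point_invertible[OF x d1])
    have "x (m2 \<sigma> - m2 \<tau>) * x (m2 \<tau> - m2 \<sigma>) = 1"
      using point_mult[OF x d2] x by (simp add: chart_points_def)
    then have c2: "cmod (x (m2 \<sigma> - m2 \<tau>)) * cmod (x (m2 \<tau> - m2 \<sigma>)) = 1"
      by (metis norm_mult norm_one)
    have "m \<sigma> - m \<tau> = (m1 \<sigma> - m1 \<tau>) + (m2 \<tau> - m2 \<sigma>)" by (simp add: m_def)
    then have c: "cmod (x (m \<sigma> - m \<tau>)) = cmod (x (m1 \<sigma> - m1 \<tau>)) * cmod (x (m2 \<tau> - m2 \<sigma>))"
      by (simp only: point_mult[OF x d1(1) d2(2)] norm_mult)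
    show "N \<tau> x * cmod (x (m \<sigma> - m \<tau>)) = N \<sigma> (incl \<sigma> x)"
      unfolding N_def max_norm_incl[OF g1 st x] max_norm_incl[OF g2 st x] c
      using nz c2 by (simp add: field_simps)
  qed
  let ?\<psi> = "\<lambda>v. min_pairing \<Sigma> m1 v - min_pairing \<Sigma> m2 v"
  have on: "?\<psi> v = pairing (m \<sigma>) v" if "\<sigma> \<in> \<Sigma>" "v \<in> \<sigma>" for \<sigma> v
    using min_pairing_on_cone[OF g1 that] min_pairing_on_cone[OF g2 that]
      by (simp add: m_def pairing_diff_left)
  have "is_support_function \<Sigma> D ?\<psi>"
    unfolding is_support_function_def
  proof (intro ballI conjI)
    fix \<sigma> assume s: "\<sigma> \<in> \<Sigma>"
    show "\<exists>l. linear l \<and> (\<forall>v\<in>\<sigma>. ?\<psi> v = l v)"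
      using on[OF s] linear_pairing by blast
    fix u assume u: "u \<in> ray_gens \<sigma>"
    show "?\<psi> (real_vec u) = - real_of_int (D u)"
      using on[OF s ray_gens_mem[OF sf s u]] m[OF s u] by (simp add: pairing_real_vec)
  qed
  then have supp: "support_function \<Sigma> D = ?\<psi>"
    using support_function_unique proj unfolding projective_fan_def by blast
  have "sqrt (Re (div_metric m N {0} t 1 1)) = exp (support_function \<Sigma> D (neg_log t))"
    if t: "t \<in> chart_points {0}" for t
  proof -
    let ?v = "neg_log t"
    \<comment> \<open>The section 1 has the character \<open>- m {0}\<close> as its coordinate over
      the torus.\<close>
    have "Re (div_metric m N {0} t 1 1) = (N {0} t * cmod (t (- m {0})))\<^sup>2"
      by (simp add: div_metric_def complex_mult_cnj power_mult_distrib cmod_power2)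
    moreover have "0 < N {0} t" using pos[OF fan_zero[OF sf] t] by (simp add: N_def)
    ultimately have "sqrt (Re (div_metric m N {0} t 1 1)) = N {0} t * cmod (t (- m {0}))" by simp
    also have "cmod (t (- m {0})) = exp (pairing (m {0}) ?v)"
      using pairing_diff_left[of 0 "m {0}" ?v] by (simp add: torus_point_norm[OF t] pairing_zero_left)
    also have "N {0} t = exp ((pairing (m2 {0}) ?v - min_pairing \<Sigma> m2 ?v) - (pairing (m1 {0}) ?v - min_pairing \<Sigma> m1 ?v))"
      by (simp add: N_def max_norm_torus[OF g1 t] max_norm_torus[OF g2 t] exp_diff)
    also have "exp ((pairing (m2 {0}) ?v - min_pairing \<Sigma> m2 ?v) - (pairing (m1 {0}) ?v - min_pairing \<Sigma> m1 ?v)) *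
        exp (pairing (m {0}) ?v) = exp (?\<psi> ?v)"
      by (simp add: m_def pairing_diff_left flip: exp_add)
    finally show ?thesis unfolding supp .
  qed
  then have "canonical_metric_divisor R \<Sigma> D (div_metric m N)"
    using hermitian_div_metric[OF nd] by (simp add: canonical_metric_divisor_def)
  then show ?thesis using nd by blast
qed

section \<open>Orthogonal sums of canonical line bundles\<close>

lemma finsum_sum_sheaf:
  assumes "\<sigma> \<in> \<Sigma>" "finite J" "finite A" "\<And>a. a \<in> A \<Longrightarrow> v a \<in> sec (sum_sheaf R J D) \<sigma>"
  shows "(\<Oplus>\<^bsub>sections (sum_sheaf R J D) \<sigma>\<^esub>a\<in>A. v a) = (\<lambda>i. \<Sum>a\<in>A. v a i)"
proof -
  interpret Module.module "chart_ring R \<sigma>" "sections (sum_sheaf R J D) \<sigma>"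
    using quasi_coherent_sum_sheaf[OF R sf assms(2), of D] assms(1) by (simp add: quasi_coherent_def)
  show ?thesis
    using assms(3,4)
  proof (induction A rule: finite_induct)
    case (insert a A)
    then have "(\<Oplus>\<^bsub>sections (sum_sheaf R J D) \<sigma>\<^esub>a\<in>insert a A. v a) =
        v a \<oplus>\<^bsub>sections (sum_sheaf R J D) \<sigma>\<^esub> (\<Oplus>\<^bsub>sections (sum_sheaf R J D) \<sigma>\<^esub>a\<in>A. v a)"
      by (intro M.finsum_insert) auto
    then show ?case using insert by simp
  qed simp
qed

lemma line_summand:
  "subsheaf (sum_sheaf R J D) (\<lambda>\<sigma>. sec (sum_sheaf R {j} D) \<sigma>) = sum_sheaf R {j} D"
  by (simp add: subsheaf_def sum_sheaf_def)

lemma summand_sections: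
  assumes "j < n"
  shows "sec (sum_sheaf R {j} D) \<sigma> \<subseteq> sec (sum_sheaf R {..<n} D) \<sigma>"
proof
  fix x assume x: "x \<in> sec (sum_sheaf R {j} D) \<sigma>"
  have "x i \<in> dsec R (D i) \<sigma>" for i
    using x dsec_zero[OF R sf] by (cases "i = j") (auto simp: sec_sum_sheaf)
  then show "x \<in> sec (sum_sheaf R {..<n} D) \<sigma>" using x assms by (auto simp: sec_sum_sheaf)
qed

lemma orthogonal_sum_metric:
  assumes nd: "\<And>j. j < n \<Longrightarrow> norm_data \<Sigma> (D j) (m j) (N j)"
    and can: "\<And>j. j < n \<Longrightarrow> canonical_metric_divisor R \<Sigma> (D j) (div_metric (m j) (N j))"
  shows "orthogonal_sum_of_canonical R \<Sigma> (sum_sheaf R {..<n} D) (sum_metric {..<n} m N)"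
  unfolding orthogonal_sum_of_canonical_def
\<comment> \<open>The j-th summand consists of the vectors supported at \<open>j\<close>, on which
  \<open>sum_metric\<close> reduces to the metric of \<open>D j\<close>.\<close>
proof (intro exI[of _ n] exI[of _ "\<lambda>j \<sigma>. sec (sum_sheaf R {j} D) \<sigma>"] conjI allI impI ballI)
  fix j \<sigma> assume j: "j < n" and s: "\<sigma> \<in> \<Sigma>"
  interpret Module.module "chart_ring R \<sigma>" "sections (sum_sheaf R {..<n} D) \<sigma>"
    using quasi_coherent_sum_sheaf[OF R sf finite_lessThan, of n D] s by (simp add: quasi_coherent_def)
  show "submodule (sec (sum_sheaf R {j} D) \<sigma>) (chart_ring R \<sigma>) (sections (sum_sheaf R {..<n} D) \<sigma>)"
  proof (rule submoduleI)
    show "sec (sum_sheaf R {j} D) \<sigma> \<subseteq> sec (sum_sheaf R {..<n} D) \<sigma>"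
      by (rule summand_sections[OF j])
    fix a assume a: "a \<in> sec (sum_sheaf R {j} D) \<sigma>"
    then have "a \<in> sec (sum_sheaf R {..<n} D) \<sigma>" using \<open>sec (sum_sheaf R {j} D) \<sigma> \<subseteq> _\<close> by blast
    moreover have "(\<lambda>i. - a i) \<in> sec (sum_sheaf R {j} D) \<sigma>"
      using a dsec_uminus[OF R sf] by (auto simp: sec_sum_sheaf)
    ultimately have "\<ominus>\<^bsub>sections (sum_sheaf R {..<n} D) \<sigma>\<^esub> a = (\<lambda>i. - a i)"
      using \<open>sec (sum_sheaf R {j} D) \<sigma> \<subseteq> _\<close> by (intro M.minus_equality) auto
    then show "\<ominus>\<^bsub>sections (sum_sheaf R {..<n} D) \<sigma>\<^esub> a \<in> sec (sum_sheaf R {j} D) \<sigma>"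
      using \<open>(\<lambda>i. - a i) \<in> _\<close> by simp
  qed (auto simp: sec_sum_sheaf dsec_zero[OF R sf] dsec_add[OF R sf] dsec_smult[OF R sf s])
next
  fix j assume j: "j < n"
  show "line_bundle R \<Sigma> (subsheaf (sum_sheaf R {..<n} D) (\<lambda>\<sigma>. sec (sum_sheaf R {j} D) \<sigma>))"
    unfolding line_summand line_bundle_def
    using sum_sheaf_bundle[OF R sf, where J = "{j}" and D = D] by simp
  show "canonical_metric R \<Sigma> (subsheaf (sum_sheaf R {..<n} D) (\<lambda>\<sigma>. sec (sum_sheaf R {j} D) \<sigma>))
      (sum_metric {..<n} m N)"
    unfolding line_summand canonical_metric_def
  proof (intro exI[of _ "D j"] exI[of _ "div_metric (m j) (N j)"] bexI[of _ "\<lambda>\<sigma> s. s j"] conjI ballI can[OF j])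
    fix \<sigma> x s t assume st: "s \<in> sec (sum_sheaf R {j} D) \<sigma>" "t \<in> sec (sum_sheaf R {j} D) \<sigma>"
    have "sum_metric {..<n} m N \<sigma> x s t = (\<Sum>i<n. if i = j then div_metric (m j) (N j) \<sigma> x (s j) (t j) else 0)"
      unfolding sum_metric_def using st by (intro sum.cong) (auto simp: sec_sum_sheaf div_metric_zero)
    then show "sum_metric {..<n} m N \<sigma> x s t = div_metric (m j) (N j) \<sigma> x (s j) (t j)" using j by simp
  next
    have "bij_betw (\<lambda>s. s j) (sec (sum_sheaf R {j} D) \<sigma>) (sec (divisor_sheaf R (D j)) \<sigma>)" for \<sigma>
    proof (rule bij_betw_byWitness[where f' = "\<lambda>f i. if i = j then f else 0"])
    qed (auto simp: sec_sum_sheaf sec_divisor_sheaf fun_eq_iff)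
    then show "(\<lambda>\<sigma> s. s j) \<in> sheaf_iso R \<Sigma> (sum_sheaf R {j} D) (divisor_sheaf R (D j))"
      by (auto simp: sheaf_iso_def sheaf_hom_def module_hom_def sec_sum_sheaf sec_divisor_sheaf)
  qed
next
  fix \<sigma> s assume s: "\<sigma> \<in> \<Sigma>" and sec: "s \<in> sec (sum_sheaf R {..<n} D) \<sigma>"
  let ?C = "\<lambda>j. sec (sum_sheaf R {j} D) \<sigma>"
  let ?v = "\<lambda>j\<in>{..<n}. \<lambda>i. if i = j then s i else 0"
  have sub: "?C j \<subseteq> sec (sum_sheaf R {..<n} D) \<sigma>" if "j < n" for j
    by (rule summand_sections[OF that])
  have sum: "(\<Oplus>\<^bsub>sections (sum_sheaf R {..<n} D) \<sigma>\<^esub>j\<in>{..<n}. v j) = (\<lambda>i. if i < n then v i i else 0)"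
    if v: "v \<in> (\<Pi>\<^sub>E j\<in>{..<n}. ?C j)" for v
  proof -
    have vj: "v j \<in> ?C j" if "j < n" for j using v that by auto
    have "(\<Oplus>\<^bsub>sections (sum_sheaf R {..<n} D) \<sigma>\<^esub>j\<in>{..<n}. v j) = (\<lambda>i. \<Sum>j<n. v j i)"
      using vj sub by (intro finsum_sum_sheaf s) auto
    also have "\<dots> = (\<lambda>i. \<Sum>j<n. if j = i then v i i else 0)"
      using vj by (intro ext sum.cong) (auto simp: sec_sum_sheaf)
    finally show ?thesis by simp
  qed
  have v: "?v \<in> (\<Pi>\<^sub>E j\<in>{..<n}. ?C j)" using sec by (auto simp: sec_sum_sheaf)
  show "\<exists>!v. v \<in> (\<Pi>\<^sub>E j\<in>{..<n}. ?C j) \<and> s = (\<Oplus>\<^bsub>sections (sum_sheaf R {..<n} D) \<sigma>\<^esub>j\<in>{..<n}. v j)"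
  proof (rule ex1I[of _ ?v])
    show "?v \<in> (\<Pi>\<^sub>E j\<in>{..<n}. ?C j) \<and> s = (\<Oplus>\<^bsub>sections (sum_sheaf R {..<n} D) \<sigma>\<^esub>j\<in>{..<n}. ?v j)"
      using v sec unfolding sum[OF v] by (auto simp: sec_sum_sheaf fun_eq_iff)
  next
    fix v' assume v': "v' \<in> (\<Pi>\<^sub>E j\<in>{..<n}. ?C j) \<and> s = (\<Oplus>\<^bsub>sections (sum_sheaf R {..<n} D) \<sigma>\<^esub>j\<in>{..<n}. v' j)"
    then have mem: "v' \<in> (\<Pi>\<^sub>E j\<in>{..<n}. ?C j)" and s': "s = (\<lambda>i. if i < n then v' i i else 0)"
      using sum[of v'] by auto
    show "v' = ?v"
    proof (rule PiE_ext[OF mem v])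
      fix j assume "j \<in> {..<n}"
      then have "v' j \<in> ?C j" "j < n" using mem by auto
      then show "v' j = ?v j" by (auto simp: sec_sum_sheaf s' fun_eq_iff)
    qed
  qed
next
  fix \<sigma> x i j s t
  assume "i \<noteq> j" "s \<in> sec (sum_sheaf R {i} D) \<sigma>" "t \<in> sec (sum_sheaf R {j} D) \<sigma>"
  then have "s k = 0 \<or> t k = 0" for k by (auto simp: sec_sum_sheaf)
  then have "div_metric (m k) (N k) \<sigma> x (s k) (t k) = 0" for k
    using div_metric_zero by metis
  then show "sum_metric {..<n} m N \<sigma> x s t = 0" by (simp add: sum_metric_def)
qed

lemma sum_sheaf_canonical:
  assumes proj: "projective_fan \<Sigma>"
  shows "\<exists>h. hermitian_vector_bundle R \<Sigma> (sum_sheaf R {..<n} D) h \<and>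
    orthogonal_sum_of_canonical R \<Sigma> (sum_sheaf R {..<n} D) h"
proof -
  have "\<exists>m N. norm_data \<Sigma> (D j) m N \<and> canonical_metric_divisor R \<Sigma> (D j) (div_metric m N)" for j
    by (rule canonical_metric_exists[OF proj])
  then obtain m N where mN: "\<And>j. norm_data \<Sigma> (D j) (m j) (N j)"
    "\<And>j. canonical_metric_divisor R \<Sigma> (D j) (div_metric (m j) (N j))"
    by metis
  have "hermitian_vector_bundle R \<Sigma> (sum_sheaf R {..<n} D) (sum_metric {..<n} m N)"
    unfolding hermitian_vector_bundle_def vector_bundle_def
    using sum_sheaf_bundle[OF R sf finite_lessThan, where D = D] hermitian_sum_metric[OF mN(1) finite_lessThan, of n] by simp
  then show ?thesis
    using orthogonal_sum_metric[where D = D and m = m and N = N, OF mN] by blast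
qed

end

section \<open>Graded families of submodules\<close>

definition coef :: "(nat \<Rightarrow> ('n::finite) laurent) \<Rightarrow> int ^ 'n \<Rightarrow> nat \<Rightarrow> complex" where
  "coef x m = (\<lambda>e. Poly_Mapping.lookup (x e) m)"

definition mono_vec :: "int ^ 'n::finite \<Rightarrow> (nat \<Rightarrow> complex) \<Rightarrow> nat \<Rightarrow> 'n laurent" where
  "mono_vec m v = (\<lambda>e. Poly_Mapping.single m (v e))"

text \<open>The graded module with prescribed parts \<Phi>; finiteness of the sum of homogeneous
  parts is built into the finite support of Laurent polynomials.\<close>

definition family_sections :: "(int ^ 'n::finite \<Rightarrow> (nat \<Rightarrow> complex) set) \<Rightarrow> (nat \<Rightarrow> 'n laurent) set" where
  "family_sections \<Phi> = {x. \<forall>m. coef x m \<in> \<Phi> m}"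

text \<open>The entries are constants, placed in degree 0, so the map preserves degrees and acts on
  each degree by the same matrix.\<close>

definition mat_map :: "nat \<Rightarrow> (nat \<Rightarrow> nat \<Rightarrow> complex) \<Rightarrow> (nat \<Rightarrow> ('n::finite) laurent) \<Rightarrow> nat \<Rightarrow> 'n laurent" where
  "mat_map n A x = (\<lambda>i. \<Sum>j<n. Poly_Mapping.single 0 (A i j) * x j)"

lemma coef_mono_vec: "coef (mono_vec m v) k = (if k = m then v else (\<lambda>_. 0))"
  by (auto simp: coef_def mono_vec_def lookup_single when_def)

lemma coef_add: "coef (\<lambda>e. x e + y e) m = (\<lambda>e. coef x m e + coef y m e)"
  by (simp add: coef_def lookup_add)

lemma coef_single_mult: "coef (\<lambda>e. Poly_Mapping.single k r * x e) m = (\<lambda>e. r * coef x (m - k) e)"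
  by (simp add: coef_def lookup_single_mult)

lemma coef_zero: "coef (\<lambda>_. 0) m = (\<lambda>_. 0)"
  by (simp add: coef_def)

lemma coef_eqI: "(\<And>m. coef x m = coef y m) \<Longrightarrow> x = y"
  by (intro ext poly_mapping_eqI) (metis coef_def)

lemma coef_mat_map: "coef (mat_map n A x) m = mat_app n A (coef x m)"
  by (simp add: coef_def mat_map_def mat_app_def lookup_sum lookup_single_mult)

lemma finite_coef_support:
  assumes "\<And>e. N \<le> e \<Longrightarrow> x e = 0"
  shows "finite {m. coef x m \<noteq> (\<lambda>_. 0)}"
proof (rule finite_subset)
  show "{m. coef x m \<noteq> (\<lambda>_. 0)} \<subseteq> (\<Union>e<N. Poly_Mapping.keys (x e))"
  proof
    fix m assume "m \<in> {m. coef x m \<noteq> (\<lambda>_. 0)}"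
    then obtain e where e: "Poly_Mapping.lookup (x e) m \<noteq> 0" by (auto simp: coef_def fun_eq_iff)
    moreover from this have "e < N" using assms[of e] by (cases "N \<le> e") auto
    ultimately show "m \<in> (\<Union>e<N. Poly_Mapping.keys (x e))" by (auto simp: in_keys_iff)
  qed
qed simp

lemma vec_of_coefs:
  assumes fin: "finite K" "\<And>m. w m \<noteq> (\<lambda>_. 0) \<Longrightarrow> m \<in> K"
  shows "\<exists>x. \<forall>m. coef x m = w m"
proof -
  have "\<exists>p. \<forall>m. Poly_Mapping.lookup p m = w m e" for e
    by (rule laurent_of_finite_support[OF fin(1)]) (use fin(2) in force)
  then obtain x where "\<And>e m. Poly_Mapping.lookup (x e) m = w m e" by metis
  then show ?thesis by (intro exI[of _ x]) (simp add: coef_def)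
qed

text \<open>Images of degree-preserving maps can be computed degree by degree: choose a preimage in
  each degree and assemble. The uniform bound \<open>N\<close> ensures that only finitely many
  degrees of a target are nonzero. This transfers exactness from the poset to the charts.\<close>

lemma family_sections_image:
  assumes zero: "\<And>m. (\<lambda>_. 0) \<in> \<Phi> m"
    and im: "\<And>m. mat_app n A ` \<Phi> m = \<Psi> m"
    and supp: "\<And>m v e. v \<in> \<Psi> m \<Longrightarrow> N \<le> e \<Longrightarrow> v e = 0"
  shows "mat_map n A ` family_sections \<Phi> = family_sections \<Psi>"
proof
  show "mat_map n A ` family_sections \<Phi> \<subseteq> family_sections \<Psi>"
    by (auto simp: family_sections_def coef_mat_map im[symmetric])
  show "family_sections \<Psi> \<subseteq> mat_map n A ` family_sections \<Phi>"
  proof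
    fix y assume y: "y \<in> family_sections \<Psi>"
    have "y e = 0" if "N \<le> e" for e
    proof (rule poly_mapping_eqI)
      fix m show "Poly_Mapping.lookup (y e) m = Poly_Mapping.lookup 0 m"
        using supp[of "coef y m" m e] y that by (auto simp: family_sections_def coef_def)
    qed
    then have fin: "finite {m. coef y m \<noteq> (\<lambda>_. 0)}" by (rule finite_coef_support)
    \<comment> \<open>The preimage of zero is chosen to be zero, so that the assembled vector has
      finite support.\<close>
    have "\<exists>w. w \<in> \<Phi> m \<and> mat_app n A w = coef y m \<and> (coef y m = (\<lambda>_. 0) \<longrightarrow> w = (\<lambda>_. 0))" for m
    proof (cases "coef y m = (\<lambda>_. 0)")
      case True
      then show ?thesis using zero[of m] by (intro exI[of _ "\<lambda>_. 0"]) (simp add: mat_app_def)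
    next
      case False
      have "coef y m \<in> mat_app n A ` \<Phi> m" unfolding im using y by (simp add: family_sections_def)
      then show ?thesis using False by auto
    qed
    then obtain w where w: "\<And>m. w m \<in> \<Phi> m" "\<And>m. mat_app n A (w m) = coef y m"
      "\<And>m. coef y m = (\<lambda>_. 0) \<Longrightarrow> w m = (\<lambda>_. 0)" by metis
    obtain x where x: "\<And>m. coef x m = w m"
      using vec_of_coefs[OF fin, of w] w(3) by blast
    have "mat_map n A x = y"
      by (rule coef_eqI) (simp add: coef_mat_map x w)
    moreover have "x \<in> family_sections \<Phi>" by (simp add: family_sections_def x w)
    ultimately show "y \<in> mat_map n A ` family_sections \<Phi>" by blast
  qed
qed

text \<open>The generated submodule, built one term at a time so that facts about it follow by rule
  induction, without finite sums over varying generators.\<close>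

inductive_set lin_span :: "complex set \<Rightarrow> (nat \<Rightarrow> complex) set \<Rightarrow> (nat \<Rightarrow> complex) set"
  for R B where
  zero: "(\<lambda>_. 0) \<in> lin_span R B"
| step: "v \<in> lin_span R B \<Longrightarrow> r \<in> R \<Longrightarrow> b \<in> B \<Longrightarrow> (\<lambda>i. r * b i + v i) \<in> lin_span R B"

lemma lin_span_mono: "B \<subseteq> C \<Longrightarrow> v \<in> lin_span R B \<Longrightarrow> v \<in> lin_span R C"
  by (rotate_tac 1, induction rule: lin_span.induct) (auto intro: lin_span.intros)

lemma lin_span_add:
  assumes "v \<in> lin_span R B" "w \<in> lin_span R B"
  shows "(\<lambda>i. v i + w i) \<in> lin_span R B"
  using assms(1)
proof (induction rule: lin_span.induct)
  case (step v r b)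
  from lin_span.step[OF step.IH step.hyps(2,3)] show ?case by (simp add: add.assoc)
qed (simp add: assms(2))

lemma lin_span_scale:
  assumes "ring_subset R" "v \<in> lin_span R B" "r \<in> R"
  shows "(\<lambda>i. r * v i) \<in> lin_span R B"
  using assms(2)
proof (induction rule: lin_span.induct)
  case (step v s b)
  have "r * s \<in> R" using assms(1,3) step.hyps(2) by (simp add: ring_subset_def)
  from lin_span.step[OF step.IH this step.hyps(3)] show ?case by (simp add: algebra_simps)
qed (simp add: lin_span.zero)

lemma lin_span_base: "ring_subset R \<Longrightarrow> b \<in> B \<Longrightarrow> b \<in> lin_span R B"
  using lin_span.step[OF lin_span.zero, of 1 R b B] by (simp add: ring_subset_def)

lemma lin_span_empty: "v \<in> lin_span R {} \<Longrightarrow> v = (\<lambda>_. 0)"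
  by (induction rule: lin_span.induct) auto

text \<open>The finite poset of truncated degrees. The value 0 off the rays makes it finite; its
  members are negatives of the divisors that occur in the resolution.\<close>

definition box :: "(real ^ 'n::finite) set set \<Rightarrow> int \<Rightarrow> int \<Rightarrow> 'n divisor set" where
  "box \<Sigma> L U = {p. (\<forall>u\<in>all_rays \<Sigma>. L \<le> p u \<and> p u \<le> U) \<and> (\<forall>u. u \<notin> all_rays \<Sigma> \<longrightarrow> p u = 0)}"

text \<open>With \<open>L\<close> below the degrees of all generators, no nonzero section over
  \<sigma> has any other degree.\<close>

definition good_degree :: "int \<Rightarrow> (real ^ 'n::finite) set \<Rightarrow> int ^ 'n \<Rightarrow> bool" where
  "good_degree L \<sigma> m \<longleftrightarrow> (\<forall>u\<in>ray_gens \<sigma>. L \<le> ipair m u)"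

text \<open>The place of the degree \<open>m\<close> over \<sigma> in the poset. Sections over
  \<sigma> are unrestricted along rays outside \<sigma>, hence the top value \<open>U\<close>
  there.\<close>

definition clamp_degree :: "(real ^ 'n::finite) set set \<Rightarrow> int \<Rightarrow> (real ^ 'n) set \<Rightarrow> int ^ 'n \<Rightarrow> 'n divisor" where
  "clamp_degree \<Sigma> U \<sigma> m = (\<lambda>u. if u \<in> ray_gens \<sigma> then min (ipair m u) U
    else if u \<in> all_rays \<Sigma> then U else 0)"

definition box_part :: "(real ^ 'n::finite) set set \<Rightarrow> int \<Rightarrow> int \<Rightarrow> ('n divisor \<Rightarrow> (nat \<Rightarrow> complex) set) \<Rightarrow>
  (real ^ 'n) set \<Rightarrow> int ^ 'n \<Rightarrow> (nat \<Rightarrow> complex) set" where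
  "box_part \<Sigma> L U W \<sigma> m = (if good_degree L \<sigma> m then W (clamp_degree \<Sigma> U \<sigma> m) else {\<lambda>_. 0})"

lemma finite_box:
  assumes "smooth_fan \<Sigma>" shows "finite (box \<Sigma> L U)"
proof -
  have "finite {p. \<forall>u. (u \<in> all_rays \<Sigma> \<longrightarrow> p u \<in> {L..U}) \<and> (u \<notin> all_rays \<Sigma> \<longrightarrow> p u = (0::int))}"
    by (rule finite_set_of_finite_funs) (simp_all add: finite_all_rays[OF assms])
  moreover have "box \<Sigma> L U = {p. \<forall>u. (u \<in> all_rays \<Sigma> \<longrightarrow> p u \<in> {L..U}) \<and> (u \<notin> all_rays \<Sigma> \<longrightarrow> p u = (0::int))}"
    by (auto simp: box_def)
  ultimately show ?thesis by simp
qed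

lemma clamp_degree_in_box:
  assumes "L \<le> U" "\<sigma> \<in> \<Sigma>" "good_degree L \<sigma> m"
  shows "clamp_degree \<Sigma> U \<sigma> m \<in> box \<Sigma> L U"
  using assms by (auto simp: box_def clamp_degree_def good_degree_def all_rays_def)

text \<open>Turns the divisor conditions along the rays of \<sigma> into the order of the poset. The
  other rays impose nothing since \<open>clamp_degree\<close> has the top value there, and the lower
  bound \<open>L\<close> of \<open>p\<close> makes the degree good.\<close>

lemma box_le_clamp:
  assumes "\<sigma> \<in> \<Sigma>" "p \<in> box \<Sigma> L U"
  shows "(\<forall>u\<in>ray_gens \<sigma>. p u \<le> ipair m u) \<longleftrightarrow> good_degree L \<sigma> m \<and> p \<le> clamp_degree \<Sigma> U \<sigma> m"
proof -
  have r: "u \<in> all_rays \<Sigma>" if "u \<in> ray_gens \<sigma>" for u using assms(1) that by (auto simp: all_rays_def)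
  show ?thesis
  proof
    assume a: "\<forall>u\<in>ray_gens \<sigma>. p u \<le> ipair m u"
    have "good_degree L \<sigma> m"
      unfolding good_degree_def
    proof
      fix u assume u: "u \<in> ray_gens \<sigma>"
      then have "L \<le> p u" using assms(2) r[OF u] by (simp add: box_def)
      then show "L \<le> ipair m u" using a u by force
    qed
    moreover have "p \<le> clamp_degree \<Sigma> U \<sigma> m"
      unfolding le_fun_def clamp_degree_def using a assms(2) r by (auto simp: box_def)
    ultimately show "good_degree L \<sigma> m \<and> p \<le> clamp_degree \<Sigma> U \<sigma> m" by simp
  next
    assume a: "good_degree L \<sigma> m \<and> p \<le> clamp_degree \<Sigma> U \<sigma> m"
    show "\<forall>u\<in>ray_gens \<sigma>. p u \<le> ipair m u"
    proof
      fix u assume "u \<in> ray_gens \<sigma>"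
      moreover have "p u \<le> clamp_degree \<Sigma> U \<sigma> m u" using a by (simp add: le_fun_def)
      ultimately show "p u \<le> ipair m u" by (simp add: clamp_degree_def)
    qed
  qed
qed

text \<open>An equivariant sheaf with all charts embedded in one graded module over the torus, so
  that restriction is inclusion. \<open>Z_local\<close> is the localisation property.
  \<open>B \<sigma>\<close> holds homogeneous generators tagged with their degrees; by
  \<open>B_gen\<close> only those whose degree differs from \<open>m\<close> by a regular character
  contribute in degree \<open>m\<close>.\<close>

locale graded_family =
  fixes R :: "complex set" and \<Sigma> :: "(real ^ 'n::finite) set set" and N :: nat
    and Z :: "(real ^ 'n) set \<Rightarrow> (nat \<Rightarrow> 'n laurent) set"
    and B :: "(real ^ 'n) set \<Rightarrow> ((int ^ 'n) \<times> (nat \<Rightarrow> complex)) set"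
  assumes R: "ring_subset R" and sf: "smooth_fan \<Sigma>"
    and Z_mem: "\<And>\<sigma> x m e. \<sigma> \<in> \<Sigma> \<Longrightarrow> x \<in> Z \<sigma> \<Longrightarrow> coef x m e \<in> R"
    and Z_supp: "\<And>\<sigma> x e. \<sigma> \<in> \<Sigma> \<Longrightarrow> x \<in> Z \<sigma> \<Longrightarrow> N \<le> e \<Longrightarrow> x e = 0"
    and Z_zero: "\<And>\<sigma>. \<sigma> \<in> \<Sigma> \<Longrightarrow> (\<lambda>_. 0) \<in> Z \<sigma>"
    and Z_add: "\<And>\<sigma> x y. \<sigma> \<in> \<Sigma> \<Longrightarrow> x \<in> Z \<sigma> \<Longrightarrow> y \<in> Z \<sigma> \<Longrightarrow> (\<lambda>e. x e + y e) \<in> Z \<sigma>"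
    and Z_smult: "\<And>\<sigma> x k r. \<sigma> \<in> \<Sigma> \<Longrightarrow> x \<in> Z \<sigma> \<Longrightarrow> k \<in> dual_monoid \<sigma> \<Longrightarrow> r \<in> R \<Longrightarrow>
      (\<lambda>e. Poly_Mapping.single k r * x e) \<in> Z \<sigma>"
    and Z_graded: "\<And>\<sigma> x m. \<sigma> \<in> \<Sigma> \<Longrightarrow> x \<in> Z \<sigma> \<Longrightarrow> mono_vec m (coef x m) \<in> Z \<sigma>"
    and Z_antimono: "\<And>\<sigma> \<tau>. \<sigma> \<in> \<Sigma> \<Longrightarrow> \<tau> \<in> \<Sigma> \<Longrightarrow> \<tau> \<subseteq> \<sigma> \<Longrightarrow> Z \<sigma> \<subseteq> Z \<tau>"
    and Z_local: "\<And>\<sigma> \<tau> x. \<sigma> \<in> \<Sigma> \<Longrightarrow> \<tau> \<in> \<Sigma> \<Longrightarrow> \<tau> \<subseteq> \<sigma> \<Longrightarrow> x \<in> Z \<tau> \<Longrightarrow>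
      \<exists>k\<in>inverted_chars \<sigma> \<tau>. (\<lambda>e. Poly_Mapping.single k 1 * x e) \<in> Z \<sigma>"
    and B_finite: "\<And>\<sigma>. \<sigma> \<in> \<Sigma> \<Longrightarrow> finite (B \<sigma>)"
    and B_mem: "\<And>\<sigma> d b. \<sigma> \<in> \<Sigma> \<Longrightarrow> (d, b) \<in> B \<sigma> \<Longrightarrow> mono_vec d b \<in> Z \<sigma>"
    and B_gen: "\<And>\<sigma> x m. \<sigma> \<in> \<Sigma> \<Longrightarrow> x \<in> Z \<sigma> \<Longrightarrow>
      coef x m \<in> lin_span R {b. \<exists>d. (d, b) \<in> B \<sigma> \<and> m - d \<in> dual_monoid \<sigma>}"
begin

lemma single_mult_mono_vec:
  "(\<lambda>e. Poly_Mapping.single k r * mono_vec m v e) = mono_vec (k + m) (\<lambda>e. r * v e)"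
  by (simp add: mono_vec_def mult_single)

lemma mono_vec_span:
  assumes s: "\<sigma> \<in> \<Sigma>" and v: "v \<in> lin_span R {b. \<exists>d. (d, b) \<in> B \<sigma> \<and> m - d \<in> dual_monoid \<sigma>}"
  shows "mono_vec m v \<in> Z \<sigma>"
  using v
proof (induction rule: lin_span.induct)
  case zero
  then show ?case using Z_zero[OF s] by (simp add: mono_vec_def)
next
  case (step v r b)
  then obtain d where d: "(d, b) \<in> B \<sigma>" "m - d \<in> dual_monoid \<sigma>" by auto
  have "mono_vec m (\<lambda>e. r * b e) \<in> Z \<sigma>"
    using Z_smult[OF s B_mem[OF s d(1)] d(2) step.hyps(2)] by (simp add: single_mult_mono_vec)
  from Z_add[OF s this step.IH] show ?case by (simp add: mono_vec_def single_add)
qed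

lemma mem_iff_mono_vec:
  assumes s: "\<sigma> \<in> \<Sigma>"
  shows "x \<in> Z \<sigma> \<longleftrightarrow> (\<forall>e\<ge>N. x e = 0) \<and> (\<forall>m. mono_vec m (coef x m) \<in> Z \<sigma>)"
proof
  assume "x \<in> Z \<sigma>"
  then show "(\<forall>e\<ge>N. x e = 0) \<and> (\<forall>m. mono_vec m (coef x m) \<in> Z \<sigma>)"
    using Z_supp[OF s] Z_graded[OF s] by blast
next
  assume x: "(\<forall>e\<ge>N. x e = 0) \<and> (\<forall>m. mono_vec m (coef x m) \<in> Z \<sigma>)"
  let ?K = "{m. coef x m \<noteq> (\<lambda>_. 0)}"
  have fin: "finite ?K" using x by (intro finite_coef_support) auto
  have sum: "(\<lambda>e. \<Sum>m\<in>A. mono_vec m (coef x m) e) \<in> Z \<sigma>" if "finite A" for A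
    using that
  proof (induction A rule: finite_induct)
    case empty
    then show ?case using Z_zero[OF s] by simp
  next
    case (insert m A)
    have "mono_vec m (coef x m) \<in> Z \<sigma>" using x by blast
    from Z_add[OF s this insert.IH] show ?case using insert by simp
  qed
  have eq: "x = (\<lambda>e. \<Sum>m\<in>?K. mono_vec m (coef x m) e)"
  proof (intro ext poly_mapping_eqI)
    fix e k
    have "Poly_Mapping.lookup (\<Sum>m\<in>?K. mono_vec m (coef x m) e) k = (\<Sum>m\<in>?K. if m = k then coef x k e else 0)"
      unfolding lookup_sum by (intro sum.cong) (auto simp: mono_vec_def lookup_single when_def)
    also have "\<dots> = coef x k e" using fin by auto
    finally show "Poly_Mapping.lookup (x e) k = Poly_Mapping.lookup (\<Sum>m\<in>?K. mono_vec m (coef x m) e) k"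
      by (simp add: coef_def)
  qed
  show "x \<in> Z \<sigma>" using sum[OF fin] unfolding eq[symmetric] .
qed

text \<open>Asking for sections on every chart and in every degree above \<open>p\<close> makes
  monotonicity in \<open>p\<close> immediate. That this demand is not too strong at a clamped degree
  is the content of \<open>mono_vec_iff_box\<close>.\<close>

definition box_module :: "'n divisor \<Rightarrow> (nat \<Rightarrow> complex) set" where
  "box_module p = {v. (\<forall>e. v e \<in> R) \<and> (\<forall>e\<ge>N. v e = 0) \<and>
    (\<forall>\<sigma>\<in>\<Sigma>. \<forall>m. (\<forall>u\<in>ray_gens \<sigma>. p u \<le> ipair m u) \<longrightarrow> mono_vec m v \<in> Z \<sigma>)}"

lemma submod_box_module: "submod R N (box_module p)"
proof -
  have "(\<lambda>i. v i + w i) \<in> box_module p" if "v \<in> box_module p" "w \<in> box_module p" for v w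
  proof -
    have "mono_vec m (\<lambda>i. v i + w i) \<in> Z \<sigma>"
      if s: "\<sigma> \<in> \<Sigma>" and m: "mono_vec m v \<in> Z \<sigma>" "mono_vec m w \<in> Z \<sigma>" for \<sigma> m
      using Z_add[OF s m] by (simp add: mono_vec_def single_add)
    then show ?thesis using that R unfolding box_module_def ring_subset_def by auto
  qed
  moreover have "(\<lambda>i. r * v i) \<in> box_module p" if "v \<in> box_module p" "r \<in> R" for v r
  proof -
    have "mono_vec m (\<lambda>i. r * v i) \<in> Z \<sigma>" if s: "\<sigma> \<in> \<Sigma>" and m: "mono_vec m v \<in> Z \<sigma>" for \<sigma> m
      using Z_smult[OF s m zero_in_dual_monoid \<open>r \<in> R\<close>] by (simp add: single_mult_mono_vec)
    then show ?thesis using that R unfolding box_module_def ring_subset_def by auto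
  qed
  moreover have "(\<lambda>_. 0) \<in> box_module p"
    using R Z_zero by (auto simp: box_module_def mono_vec_def ring_subset_def)
  ultimately show ?thesis unfolding submod_def by (auto simp: box_module_def)
qed

lemma box_module_mono: "p \<le> q \<Longrightarrow> box_module p \<subseteq> box_module q"
proof
  fix v assume le: "p \<le> q" and v: "v \<in> box_module p"
  have "mono_vec m v \<in> Z \<sigma>" if "\<sigma> \<in> \<Sigma>" "\<forall>u\<in>ray_gens \<sigma>. q u \<le> ipair m u" for \<sigma> m
  proof -
    have "\<forall>u\<in>ray_gens \<sigma>. p u \<le> ipair m u"
      using that(2) le_funD[OF le] by (blast intro: order_trans)
    then show ?thesis using v that(1) by (simp add: box_module_def)
  qed
  then show "v \<in> box_module q" using v by (simp add: box_module_def)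
qed

lemma degree_bounds: "\<exists>L U. L \<le> U \<and> (\<forall>\<sigma>\<in>\<Sigma>. \<forall>(d, b)\<in>B \<sigma>. \<forall>u\<in>all_rays \<Sigma>. L \<le> ipair d u \<and> ipair d u \<le> U)"
proof -
  define T where "T = (\<lambda>((d, b), u). ipair d u) ` ((\<Union>\<sigma>\<in>\<Sigma>. B \<sigma>) \<times> all_rays \<Sigma>)"
  have fin: "finite T"
    unfolding T_def using fan_finite[OF sf] B_finite finite_all_rays[OF sf]
      by (intro finite_imageI finite_cartesian_product finite_UN_I) auto
  \<comment> \<open>Inserting 0 keeps the extrema meaningful when there are no generators or no
    rays.\<close>
  have h: "Min (insert 0 T) \<le> t \<and> t \<le> Max (insert 0 T)" if "t \<in> insert 0 T" for t
    using fin that by auto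
  show ?thesis
  proof (intro exI conjI)
    show "Min (insert 0 T) \<le> Max (insert 0 T)" using h[OF insertI1] by linarith
    show "\<forall>\<sigma>\<in>\<Sigma>. \<forall>(d, b)\<in>B \<sigma>. \<forall>u\<in>all_rays \<Sigma>.
        Min (insert 0 T) \<le> ipair d u \<and> ipair d u \<le> Max (insert 0 T)"
    proof clarify
      fix \<sigma> d b u assume a: "\<sigma> \<in> \<Sigma>" "(d, b) \<in> B \<sigma>" "u \<in> all_rays \<Sigma>"
      have "ipair d u \<in> T"
        unfolding T_def by (rule image_eqI[of _ _ "((d, b), u)"]) (use a in auto)
      then show "Min (insert 0 T) \<le> ipair d u \<and> ipair d u \<le> Max (insert 0 T)" by (intro h) simp
    qed
  qed
qed

text \<open>
  A homogeneous section over \<open>\<sigma>\<close> extends to any other chart \<open>\<sigma>'\<close> after raising its degree along the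
  rays of \<open>\<sigma>'\<close> outside \<open>\<sigma>\<close>; beyond the degrees of the generators the amount no longer matters.
\<close>

lemma mono_vec_iff_box:
  assumes LU: "L \<le> U"
    and all_bounds: "\<forall>\<sigma>\<in>\<Sigma>. \<forall>(d, b)\<in>B \<sigma>. \<forall>u\<in>all_rays \<Sigma>. L \<le> ipair d u \<and> ipair d u \<le> U"
    and s: "\<sigma> \<in> \<Sigma>" and vR: "\<forall>e. v e \<in> R" and vN: "\<forall>e\<ge>N. v e = 0"
  shows "mono_vec m v \<in> Z \<sigma> \<longleftrightarrow> v \<in> box_part \<Sigma> L U box_module \<sigma> m"
proof
  assume v: "v \<in> box_part \<Sigma> L U box_module \<sigma> m"
  show "mono_vec m v \<in> Z \<sigma>"
  proof (cases "good_degree L \<sigma> m")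
    case True
    then have "v \<in> box_module (clamp_degree \<Sigma> U \<sigma> m)" using v by (simp add: box_part_def)
    moreover have "\<forall>u\<in>ray_gens \<sigma>. clamp_degree \<Sigma> U \<sigma> m u \<le> ipair m u" by (simp add: clamp_degree_def)
    ultimately show ?thesis using s by (simp add: box_module_def)
  next
    case False
    then show ?thesis using v Z_zero[OF s] by (simp add: box_part_def mono_vec_def)
  qed
next
  assume v: "mono_vec m v \<in> Z \<sigma>"
  have bounds: "L \<le> ipair d u \<and> ipair d u \<le> U"
    if "\<rho> \<in> \<Sigma>" "(d, b) \<in> B \<rho>" "u \<in> all_rays \<Sigma>" for \<rho> d b u
    using all_bounds that by fastforce
  have span: "v \<in> lin_span R {b. \<exists>d. (d, b) \<in> B \<rho> \<and> k - d \<in> dual_monoid \<rho>}"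
    if "\<rho> \<in> \<Sigma>" "mono_vec k v \<in> Z \<rho>" for \<rho> k
    using B_gen[OF that, of k] by (simp add: coef_mono_vec)
  show "v \<in> box_part \<Sigma> L U box_module \<sigma> m"
  proof (cases "good_degree L \<sigma> m")
    case False
    \<comment> \<open>Along \<open>u\<close> every generator has a degree above that of
      \<open>m\<close>, so none contributes and \<open>v\<close> is zero.\<close>
    then obtain u where u: "u \<in> ray_gens \<sigma>" "ipair m u < L" by (auto simp: good_degree_def not_le)
    have empty: "{b. \<exists>d. (d, b) \<in> B \<sigma> \<and> m - d \<in> dual_monoid \<sigma>} = {}"
    proof (rule equals0I)
      fix b assume "b \<in> {b. \<exists>d. (d, b) \<in> B \<sigma> \<and> m - d \<in> dual_monoid \<sigma>}"
      then obtain d where d: "(d, b) \<in> B \<sigma>" "m - d \<in> dual_monoid \<sigma>" by blast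
      have "u \<in> all_rays \<Sigma>" using u s by (auto simp: all_rays_def)
      then have "L \<le> ipair d u" using bounds[OF s d(1)] by blast
      moreover have "0 \<le> ipair (m - d) u" using d u by (simp add: dual_monoid_rays[OF sf s])
      ultimately show False using u by (simp add: ipair_diff_left)
    qed
    have "v = (\<lambda>_. 0)" using span[OF s v] unfolding empty by (rule lin_span_empty)
    then show ?thesis using False by (simp add: box_part_def)
  next
    case True
    have "mono_vec m' v \<in> Z \<rho>"
      if r: "\<rho> \<in> \<Sigma>" and m': "\<forall>u\<in>ray_gens \<rho>. clamp_degree \<Sigma> U \<sigma> m u \<le> ipair m' u" for \<rho> m'
    proof -
      let ?\<tau> = "\<rho> \<inter> \<sigma>"
      have t: "?\<tau> \<in> \<Sigma>" by (rule fan_Int[OF sf s r])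
      have "mono_vec m v \<in> Z ?\<tau>" using Z_antimono[OF s t] v by blast
      then obtain k where k: "k \<in> inverted_chars \<rho> ?\<tau>" "(\<lambda>e. Poly_Mapping.single k 1 * mono_vec m v e) \<in> Z \<rho>"
        using Z_local[OF r t] by blast
      then have "mono_vec (k + m) v \<in> Z \<rho>" by (simp add: single_mult_mono_vec)
      then have "v \<in> lin_span R {b. \<exists>d. (d, b) \<in> B \<rho> \<and> k + m - d \<in> dual_monoid \<rho>}" by (rule span[OF r])
      \<comment> \<open>Any generator usable in degree \<open>k + m\<close> is usable in degree
        \<open>m'\<close>. On a ray shared with \<sigma>, \<open>k\<close> vanishes, so
        \<open>d\<close> is bounded by \<open>m\<close> and by \<open>U\<close>, hence by the
        clamped degree. On any other ray the clamped degree is \<open>U\<close>, which bounds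
        \<open>d\<close> by itself.\<close>
      moreover have "{b. \<exists>d. (d, b) \<in> B \<rho> \<and> k + m - d \<in> dual_monoid \<rho>} \<subseteq>
          {b. \<exists>d. (d, b) \<in> B \<rho> \<and> m' - d \<in> dual_monoid \<rho>}"
      proof clarify
        fix b d assume d: "(d, b) \<in> B \<rho>" "k + m - d \<in> dual_monoid \<rho>"
        have "0 \<le> ipair (m' - d) u" if u: "u \<in> ray_gens \<rho>" for u
        proof -
          have ua: "u \<in> all_rays \<Sigma>" using u r by (auto simp: all_rays_def)
          have dU: "ipair d u \<le> U" using bounds[OF r d(1) ua] by blast
          have mc: "clamp_degree \<Sigma> U \<sigma> m u \<le> ipair m' u" using m' u by blast
          show ?thesis
          proof (cases "u \<in> ray_gens \<sigma>")
            case True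
            then have "real_vec u \<in> ?\<tau>" using ray_gens_mem[OF sf r u] ray_gens_mem[OF sf s] by blast
            then have "u \<in> ray_gens ?\<tau>" by (rule ray_gens_of_mem[OF sf t r u])
            then have "ipair k u = 0" using k(1) by (simp add: inverted_chars_rays[OF sf r t])
            moreover have "0 \<le> ipair (k + m - d) u" using d u by (simp add: dual_monoid_rays[OF sf r])
            ultimately have "ipair d u \<le> ipair m u" by (simp add: ipair_diff_left ipair_add_left)
            then show ?thesis using dU mc True by (simp add: clamp_degree_def ipair_diff_left)
          next
            case False
            then show ?thesis using dU mc ua by (simp add: clamp_degree_def ipair_diff_left)
          qed
        qed
        then have "m' - d \<in> dual_monoid \<rho>" by (simp add: dual_monoid_rays[OF sf r])
        then show "\<exists>d. (d, b) \<in> B \<rho> \<and> m' - d \<in> dual_monoid \<rho>" using d(1) by blast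
      qed
      ultimately show ?thesis by (intro mono_vec_span[OF r]) (rule lin_span_mono)
    qed
    then have "v \<in> box_module (clamp_degree \<Sigma> U \<sigma> m)" using vR vN by (simp add: box_module_def)
    then show ?thesis using True by (simp add: box_part_def)
  qed
qed

lemma family_is_box_family:
  "\<exists>L U. L \<le> U \<and> (\<forall>\<sigma>\<in>\<Sigma>. Z \<sigma> = family_sections (box_part \<Sigma> L U box_module \<sigma>))"
proof -
  obtain L U where LU: "L \<le> U"
    and bounds: "\<forall>\<sigma>\<in>\<Sigma>. \<forall>(d, b)\<in>B \<sigma>. \<forall>u\<in>all_rays \<Sigma>. L \<le> ipair d u \<and> ipair d u \<le> U"
    using degree_bounds by blast
  have "Z \<sigma> = family_sections (box_part \<Sigma> L U box_module \<sigma>)" if s: "\<sigma> \<in> \<Sigma>" for \<sigma>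
  proof (intro equalityI subsetI)
    fix x assume x: "x \<in> Z \<sigma>"
    have "coef x m \<in> box_part \<Sigma> L U box_module \<sigma> m" for m
      using mono_vec_iff_box[OF LU bounds s, where v = "coef x m" and m = m] Z_mem[OF s x] Z_supp[OF s x] Z_graded[OF s x]
      by (simp add: coef_def)
    then show "x \<in> family_sections (box_part \<Sigma> L U box_module \<sigma>)" by (simp add: family_sections_def)
  next
    fix x assume x: "x \<in> family_sections (box_part \<Sigma> L U box_module \<sigma>)"
    have part: "v e \<in> R" "N \<le> e \<Longrightarrow> v e = 0" if "v \<in> box_part \<Sigma> L U box_module \<sigma> m" for v m e
      using that R by (auto simp: box_part_def box_module_def ring_subset_def split: if_splits)
    have c: "coef x m \<in> box_part \<Sigma> L U box_module \<sigma> m" for m using x by (simp add: family_sections_def)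
    have "mono_vec m (coef x m) \<in> Z \<sigma>" for m
      using mono_vec_iff_box[OF LU bounds s, where v = "coef x m" and m = m] part[OF c] c by blast
    moreover have "x e = 0" if "N \<le> e" for e
      using part(2)[OF c that] by (intro poly_mapping_eqI) (simp add: coef_def)
    ultimately show "x \<in> Z \<sigma>" using mem_iff_mono_vec[OF s] by blast
  qed
  then show ?thesis using LU by blast
qed

end

section \<open>Torsion-freeness and coordinates of locally free modules\<close>

locale chart_module =
  fixes R :: "complex set" and \<sigma> :: "(real ^ 'n::finite) set" and M :: "('n laurent, 'a) module"
  assumes ring: "ring_subset R" and mod: "Module.module (chart_ring R \<sigma>) M"
begin

sublocale Module.module "chart_ring R \<sigma>" M by (rule mod)

abbreviation A where "A \<equiv> carrier (chart_ring R \<sigma>)"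

lemma smult_add: "a \<in> A \<Longrightarrow> b \<in> A \<Longrightarrow> x \<in> carrier M \<Longrightarrow> (a + b) \<odot>\<^bsub>M\<^esub> x = a \<odot>\<^bsub>M\<^esub> x \<oplus>\<^bsub>M\<^esub> b \<odot>\<^bsub>M\<^esub> x"
  using smult_l_distr[of a b x] by simp

lemma smult_mult: "a \<in> A \<Longrightarrow> b \<in> A \<Longrightarrow> x \<in> carrier M \<Longrightarrow> (a * b) \<odot>\<^bsub>M\<^esub> x = a \<odot>\<^bsub>M\<^esub> (b \<odot>\<^bsub>M\<^esub> x)"
  using smult_assoc1[of a b x] by simp

lemma smult_1: "x \<in> carrier M \<Longrightarrow> 1 \<odot>\<^bsub>M\<^esub> x = x"
  using smult_one[of x] by simp

lemma smult_0: "x \<in> carrier M \<Longrightarrow> 0 \<odot>\<^bsub>M\<^esub> x = \<zero>\<^bsub>M\<^esub>"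
  using smult_l_null[of x] by simp

lemma smult_commute: "a \<in> A \<Longrightarrow> b \<in> A \<Longrightarrow> x \<in> carrier M \<Longrightarrow> a \<odot>\<^bsub>M\<^esub> (b \<odot>\<^bsub>M\<^esub> x) = b \<odot>\<^bsub>M\<^esub> (a \<odot>\<^bsub>M\<^esub> x)"
  using smult_mult[of a b x] smult_mult[of b a x] by (simp add: mult.commute)

lemma finsum_induct:
  assumes "finite I" "\<And>i. i \<in> I \<Longrightarrow> g i \<in> carrier M" "\<And>i. i \<in> I \<Longrightarrow> P (g i)"
    and P0: "P \<zero>\<^bsub>M\<^esub>" and Padd: "\<And>s t. s \<in> carrier M \<Longrightarrow> t \<in> carrier M \<Longrightarrow> P s \<Longrightarrow> P t \<Longrightarrow> P (s \<oplus>\<^bsub>M\<^esub> t)"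
  shows "P (\<Oplus>\<^bsub>M\<^esub>i\<in>I. g i)"
  using assms(1-3)
proof (induction I rule: finite_induct)
  case (insert i I)
  have "(\<Oplus>\<^bsub>M\<^esub>i\<in>insert i I. g i) = g i \<oplus>\<^bsub>M\<^esub> (\<Oplus>\<^bsub>M\<^esub>i\<in>I. g i)"
    using insert by (intro M.finsum_insert) auto
  moreover have "(\<Oplus>\<^bsub>M\<^esub>i\<in>I. g i) \<in> carrier M" using insert by (intro M.finsum_closed) auto
  ultimately show ?case using insert by (auto intro: Padd)
qed (simp add: P0)

text \<open>A coaction is compatible with multiplication by single terms, not by arbitrary
  functions; facts about general multiples go through this induction.\<close>

lemma smult_induct:
  assumes f: "f \<in> A" and s: "s \<in> carrier M" and P: "P s" and P0: "P \<zero>\<^bsub>M\<^esub>"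
    and Padd: "\<And>s t. s \<in> carrier M \<Longrightarrow> t \<in> carrier M \<Longrightarrow> P s \<Longrightarrow> P t \<Longrightarrow> P (s \<oplus>\<^bsub>M\<^esub> t)"
    and Psingle: "\<And>k r s. k \<in> dual_monoid \<sigma> \<Longrightarrow> r \<in> R \<Longrightarrow> s \<in> carrier M \<Longrightarrow> P s \<Longrightarrow>
      P (Poly_Mapping.single k r \<odot>\<^bsub>M\<^esub> s)"
  shows "P (f \<odot>\<^bsub>M\<^esub> s)"
proof -
  have single: "Poly_Mapping.single k (Poly_Mapping.lookup f k) \<in> A" if "k \<in> Poly_Mapping.keys f" for k
    using f that by (intro single_in_chart_ring[OF ring]) (auto simp: chart_ring_mem in_keys_iff)
  have "P ((\<Sum>k\<in>K. Poly_Mapping.single k (Poly_Mapping.lookup f k)) \<odot>\<^bsub>M\<^esub> s)"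
    if "finite K" "K \<subseteq> Poly_Mapping.keys f" for K
    using that
  proof (induction K rule: finite_induct)
    case empty
    then show ?case by (simp add: smult_0[OF s] P0)
  next
    case (insert k K)
    let ?g = "\<Sum>k\<in>K. Poly_Mapping.single k (Poly_Mapping.lookup f k)"
    have k: "k \<in> dual_monoid \<sigma>" "Poly_Mapping.lookup f k \<in> R"
      using f insert.prems by (auto simp: chart_ring_mem in_keys_iff)
    have g: "?g \<in> A" using insert.prems single by (intro chart_ring_sum[OF ring]) auto
    have "(\<Sum>k\<in>insert k K. Poly_Mapping.single k (Poly_Mapping.lookup f k)) \<odot>\<^bsub>M\<^esub> s =
        Poly_Mapping.single k (Poly_Mapping.lookup f k) \<odot>\<^bsub>M\<^esub> s \<oplus>\<^bsub>M\<^esub> ?g \<odot>\<^bsub>M\<^esub> s"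
      using insert single g s by (simp add: smult_add)
    then show ?case
      using insert single g s k P by (auto intro!: Padd Psingle)
  qed
  from this[of "Poly_Mapping.keys f"] show ?thesis by (simp flip: laurent_expand)
qed

lemma generated_induct:
  assumes G: "finite G" "G \<subseteq> carrier M"
    and gen: "\<forall>s\<in>carrier M. \<exists>c\<in>G \<rightarrow> A. s = (\<Oplus>\<^bsub>M\<^esub>g\<in>G. c g \<odot>\<^bsub>M\<^esub> g)"
    and s: "s \<in> carrier M" and P: "\<And>g. g \<in> G \<Longrightarrow> P g" and P0: "P \<zero>\<^bsub>M\<^esub>"
    and Padd: "\<And>s t. s \<in> carrier M \<Longrightarrow> t \<in> carrier M \<Longrightarrow> P s \<Longrightarrow> P t \<Longrightarrow> P (s \<oplus>\<^bsub>M\<^esub> t)"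
    and Psmult: "\<And>f s. f \<in> A \<Longrightarrow> s \<in> carrier M \<Longrightarrow> P s \<Longrightarrow> P (f \<odot>\<^bsub>M\<^esub> s)"
  shows "P s"
proof -
  obtain c where c: "c \<in> G \<rightarrow> A" "s = (\<Oplus>\<^bsub>M\<^esub>g\<in>G. c g \<odot>\<^bsub>M\<^esub> g)" using gen s by blast
  show ?thesis
    unfolding c(2)
    by (rule finsum_induct[where P = P]) (use c(1) G P in \<open>auto intro: P0 Padd Psmult\<close>)
qed

lemma hom_inj_on:
  assumes add: "\<And>s t. s \<in> carrier M \<Longrightarrow> t \<in> carrier M \<Longrightarrow> \<phi> (s \<oplus>\<^bsub>M\<^esub> t) = (\<lambda>j. \<phi> s j + (\<phi> t j :: 'c::ab_group_add))"
    and inj: "\<And>s. s \<in> carrier M \<Longrightarrow> \<phi> s = (\<lambda>_. 0) \<Longrightarrow> s = \<zero>\<^bsub>M\<^esub>"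
  shows "inj_on \<phi> (carrier M)"
proof (rule inj_onI)
  fix s t assume s: "s \<in> carrier M" and t: "t \<in> carrier M" and eq: "\<phi> s = \<phi> t"
  have st: "s \<ominus>\<^bsub>M\<^esub> t \<in> carrier M" using s t by simp
  have "(s \<ominus>\<^bsub>M\<^esub> t) \<oplus>\<^bsub>M\<^esub> t = s" using s t by (simp add: M.minus_eq M.a_assoc M.l_neg)
  then have "\<phi> t = (\<lambda>j. \<phi> (s \<ominus>\<^bsub>M\<^esub> t) j + \<phi> t j)" using add[OF st t] eq by simp
  then have "\<phi> (s \<ominus>\<^bsub>M\<^esub> t) = (\<lambda>_. 0)" by (simp add: fun_eq_iff)
  then have "s \<ominus>\<^bsub>M\<^esub> t = \<zero>\<^bsub>M\<^esub>" by (rule inj[OF st])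
  then show "s = t" using \<open>(s \<ominus>\<^bsub>M\<^esub> t) \<oplus>\<^bsub>M\<^esub> t = s\<close> t by simp
qed

section \<open>Combinations of a local frame\<close>

context
  fixes f es assumes frame: "is_frame (chart_ring R \<sigma>) M f es"
begin

definition lincomb :: "(nat \<Rightarrow> 'n laurent) \<Rightarrow> 'a" where
  "lincomb c = (\<Oplus>\<^bsub>M\<^esub>j\<in>{..<length es}. c j \<odot>\<^bsub>M\<^esub> (es ! j))"

lemma frame_mem: "f \<in> A" "j < length es \<Longrightarrow> es ! j \<in> carrier M"
  using frame by (auto simp: is_frame_def)

lemma frame_span: "s \<in> carrier M \<Longrightarrow> \<exists>k. \<exists>c \<in> {..<length es} \<rightarrow> A. (f ^ k) \<odot>\<^bsub>M\<^esub> s = lincomb c"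
  using frame by (simp add: is_frame_def lincomb_def)

lemma frame_indep: "c \<in> {..<length es} \<rightarrow> A \<Longrightarrow> lincomb c = \<zero>\<^bsub>M\<^esub> \<Longrightarrow> \<exists>k. \<forall>j<length es. f ^ k * c j = 0"
  using frame by (simp add: is_frame_def lincomb_def)

lemma lincomb_closed: "c \<in> {..<length es} \<rightarrow> A \<Longrightarrow> lincomb c \<in> carrier M"
  unfolding lincomb_def using frame_mem by (intro M.finsum_closed) auto

lemma lincomb_smult:
  assumes "a \<in> A" "c \<in> {..<length es} \<rightarrow> A"
  shows "a \<odot>\<^bsub>M\<^esub> lincomb c = lincomb (\<lambda>j. a * c j)"
proof -
  have "a \<odot>\<^bsub>M\<^esub> lincomb c = (\<Oplus>\<^bsub>M\<^esub>j\<in>{..<length es}. a \<odot>\<^bsub>M\<^esub> (c j \<odot>\<^bsub>M\<^esub> (es ! j)))"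
    unfolding lincomb_def using assms frame_mem by (intro finsum_smult_ldistr) auto
  also have "\<dots> = lincomb (\<lambda>j. a * c j)"
    unfolding lincomb_def using assms frame_mem
      by (intro M.finsum_cong') (auto simp: smult_mult chart_ring_mult[OF ring] Pi_iff)
  finally show ?thesis .
qed

lemma lincomb_add:
  assumes "c \<in> {..<length es} \<rightarrow> A" "d \<in> {..<length es} \<rightarrow> A"
  shows "lincomb c \<oplus>\<^bsub>M\<^esub> lincomb d = lincomb (\<lambda>j. c j + d j)"
proof -
  have "lincomb c \<oplus>\<^bsub>M\<^esub> lincomb d = (\<Oplus>\<^bsub>M\<^esub>j\<in>{..<length es}. c j \<odot>\<^bsub>M\<^esub> (es ! j) \<oplus>\<^bsub>M\<^esub> d j \<odot>\<^bsub>M\<^esub> (es ! j))"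
    unfolding lincomb_def using assms frame_mem by (intro M.finsum_addf[symmetric]) auto
  also have "\<dots> = lincomb (\<lambda>j. c j + d j)"
    unfolding lincomb_def using assms frame_mem
      by (intro M.finsum_cong') (auto simp: smult_add chart_ring_add[OF ring] Pi_iff)
  finally show ?thesis .
qed

lemma lincomb_zero: "(\<And>j. j < length es \<Longrightarrow> c j = 0) \<Longrightarrow> lincomb c = \<zero>\<^bsub>M\<^esub>"
  unfolding lincomb_def using frame_mem
  by (subst M.finsum_cong'[of _ _ "\<lambda>_. \<zero>\<^bsub>M\<^esub>"]) (auto simp: smult_0)

lemma lincomb_cong:
  assumes "c \<in> {..<length es} \<rightarrow> A" "\<And>j. j < length es \<Longrightarrow> d j = c j"
  shows "lincomb d = lincomb c"
  unfolding lincomb_def using assms frame_mem by (intro M.finsum_cong') (auto simp: Pi_iff)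

text \<open>After multiplication by a power of \<open>f\<close>, the element has coefficients in the
  frame, and some further power of \<open>f\<close> kills their products with \<open>a\<close>.
  Laurent polynomials have no zero divisors, so that power kills the coefficients
  themselves.\<close>

lemma frame_annihilator:
  assumes a: "a \<in> A" "a \<noteq> 0" and s: "s \<in> carrier M" and z: "a \<odot>\<^bsub>M\<^esub> s = \<zero>\<^bsub>M\<^esub>"
  shows "\<exists>k. f ^ k \<odot>\<^bsub>M\<^esub> s = \<zero>\<^bsub>M\<^esub>"
proof -
  note pow = chart_ring_power[OF ring frame_mem(1)] and mul = chart_ring_mult[OF ring]
  obtain k c where c: "c \<in> {..<length es} \<rightarrow> A" "f ^ k \<odot>\<^bsub>M\<^esub> s = lincomb c" using frame_span[OF s] by blast
  have "lincomb (\<lambda>j. a * c j) = a \<odot>\<^bsub>M\<^esub> (f ^ k \<odot>\<^bsub>M\<^esub> s)" using lincomb_smult[OF a(1) c(1)] c(2) by simp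
  also have "\<dots> = \<zero>\<^bsub>M\<^esub>" using smult_commute[OF a(1) pow s] z smult_r_null[OF pow] by simp
  finally obtain l where l: "\<forall>j<length es. f ^ l * (a * c j) = 0"
    using frame_indep[of "\<lambda>j. a * c j"] a c mul by blast
  have "f ^ l * c j = 0" if "j < length es" for j
  proof -
    have "a * (f ^ l * c j) = 0" using l that by (simp add: mult_ac)
    then show ?thesis using laurent_no_zero_divisors a by blast
  qed
  then have "lincomb (\<lambda>j. f ^ l * c j) = \<zero>\<^bsub>M\<^esub>" by (rule lincomb_zero)
  then have "f ^ l \<odot>\<^bsub>M\<^esub> (f ^ k \<odot>\<^bsub>M\<^esub> s) = \<zero>\<^bsub>M\<^esub>" using lincomb_smult[OF pow c(1)] c(2) by simp
  then have "f ^ (l + k) \<odot>\<^bsub>M\<^esub> s = \<zero>\<^bsub>M\<^esub>" using smult_mult[OF pow pow s] by (simp add: power_add)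
  then show ?thesis by blast
qed

lemma lincomb_inject:
  assumes f0: "f \<noteq> 0" and c: "c \<in> {..<length es} \<rightarrow> A" and d: "d \<in> {..<length es} \<rightarrow> A"
    and eq: "lincomb c = lincomb d" and j: "j < length es"
  shows "c j = d j"
proof -
  have nd: "(\<lambda>j. c j - d j) \<in> {..<length es} \<rightarrow> A"
  proof
    fix j assume "j \<in> {..<length es}"
    then have "c j \<in> A" "- d j \<in> A" using c d chart_ring_uminus[OF ring] by auto
    then show "c j - d j \<in> A" using chart_ring_add[OF ring, of "c j" \<sigma> "- d j"] by simp
  qed
  have "lincomb (\<lambda>j. c j - d j) \<oplus>\<^bsub>M\<^esub> lincomb d = lincomb c"
    using lincomb_add[OF nd d] by simp
  then have "lincomb (\<lambda>j. c j - d j) = \<zero>\<^bsub>M\<^esub>"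
    using lincomb_closed[OF nd] lincomb_closed[OF d] eq M.add.r_cancel_one by metis
  then obtain k where "f ^ k * (c j - d j) = 0" using frame_indep[OF nd] j by blast
  moreover have "f ^ k \<noteq> 0" for k
    by (induction k) (use f0 laurent_no_zero_divisors in auto)
  ultimately have "c j - d j = 0" using laurent_no_zero_divisors by blast
  then show ?thesis by simp
qed

end

section \<open>Locally free modules: torsion and embeddings\<close>

context
  fixes P assumes lf: "locally_free (chart_ring R \<sigma>) M P"
begin

lemma locally_free_cover:
  obtains S b where "finite S" "S \<subseteq> A" "b \<in> S \<rightarrow> A" "(\<Sum>g\<in>S. b g * g) = 1"
    "\<And>g. g \<in> S \<Longrightarrow> \<exists>es. is_frame (chart_ring R \<sigma>) M g es"
proof -
  obtain S where S: "finite S" "S \<subseteq> A" "\<exists>b\<in>S \<rightarrow> A. (\<Sum>g\<in>S. b g * g) = 1"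
    and fr: "\<forall>g\<in>S. \<exists>es. is_frame (chart_ring R \<sigma>) M g es \<and> P (length es)"
    using lf unfolding locally_free_def by (elim exE conjE) (rule that)
  obtain b where b: "b \<in> S \<rightarrow> A" "(\<Sum>g\<in>S. b g * g) = 1" using S(3) by (rule bexE)
  show ?thesis
  proof (rule that[OF S(1,2) b])
    fix g assume "g \<in> S"
    then show "\<exists>es. is_frame (chart_ring R \<sigma>) M g es" using fr by blast
  qed
qed

text \<open>By \<open>frame_annihilator\<close> a power of each member of the cover kills
  \<open>s\<close>. Multiplying a nonzero torsion element by suitable powers, one member after
  another, yields a nonzero element killed by all members themselves, against the relation that
  expresses 1 by them. This avoids showing that powers of the cover generate the unit ideal.\<close>

lemma torsion_free:
  assumes a: "a \<in> A" "a \<noteq> 0" and s: "s \<in> carrier M" and z: "a \<odot>\<^bsub>M\<^esub> s = \<zero>\<^bsub>M\<^esub>"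
  shows "s = \<zero>\<^bsub>M\<^esub>"
proof (rule ccontr)
  assume s0: "s \<noteq> \<zero>\<^bsub>M\<^esub>"
  obtain S b where S: "finite S" "S \<subseteq> A" "b \<in> S \<rightarrow> A" "(\<Sum>g\<in>S. b g * g) = 1"
    and fr: "\<And>g. g \<in> S \<Longrightarrow> \<exists>es. is_frame (chart_ring R \<sigma>) M g es"
    by (rule locally_free_cover) (rule that)
  note pow = chart_ring_power[OF ring] and mul = chart_ring_mult[OF ring]
  have ann: "\<forall>g\<in>S. \<exists>k. g ^ k \<odot>\<^bsub>M\<^esub> s = \<zero>\<^bsub>M\<^esub>"
  proof
    fix g assume "g \<in> S"
    then obtain es where "is_frame (chart_ring R \<sigma>) M g es" using fr by blast
    then show "\<exists>k. g ^ k \<odot>\<^bsub>M\<^esub> s = \<zero>\<^bsub>M\<^esub>" by (rule frame_annihilator[OF _ a s z])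
  qed
  have "\<exists>t\<in>carrier M. t \<noteq> \<zero>\<^bsub>M\<^esub> \<and> (\<forall>g\<in>S'. g \<odot>\<^bsub>M\<^esub> t = \<zero>\<^bsub>M\<^esub>) \<and> (\<forall>g\<in>S. \<exists>k. g ^ k \<odot>\<^bsub>M\<^esub> t = \<zero>\<^bsub>M\<^esub>)"
    if "finite S'" "S' \<subseteq> S" for S'
    using that
  proof (induction S' rule: finite_induct)
    case empty
    then show ?case using s s0 ann by blast
  next
    case (insert g S')
    then obtain t where t: "t \<in> carrier M" "t \<noteq> \<zero>\<^bsub>M\<^esub>" "\<forall>h\<in>S'. h \<odot>\<^bsub>M\<^esub> t = \<zero>\<^bsub>M\<^esub>"
      "\<forall>h\<in>S. \<exists>k. h ^ k \<odot>\<^bsub>M\<^esub> t = \<zero>\<^bsub>M\<^esub>" by blast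
    have g: "g \<in> S" "g \<in> A" using insert.prems S by auto
    \<comment> \<open>The last multiple before vanishing, by the power \<open>k - 1\<close>, is
      nonzero and killed by \<open>g\<close>.\<close>
    define k where "k = (LEAST k. g ^ k \<odot>\<^bsub>M\<^esub> t = \<zero>\<^bsub>M\<^esub>)"
    have k: "g ^ k \<odot>\<^bsub>M\<^esub> t = \<zero>\<^bsub>M\<^esub>" unfolding k_def
      using t(4) g(1) LeastI_ex[of "\<lambda>k. g ^ k \<odot>\<^bsub>M\<^esub> t = \<zero>\<^bsub>M\<^esub>"] by blast
    have "k \<noteq> 0" using k t smult_1 by (metis power_0)
    then obtain k' where k': "k = Suc k'" using not0_implies_Suc by blast
    let ?t = "g ^ k' \<odot>\<^bsub>M\<^esub> t"
    have "?t \<in> carrier M" using t pow[OF g(2)] by simp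
    moreover have "?t \<noteq> \<zero>\<^bsub>M\<^esub>" using not_less_Least[of k' "\<lambda>k. g ^ k \<odot>\<^bsub>M\<^esub> t = \<zero>\<^bsub>M\<^esub>"] k' k_def by auto
    moreover have "h \<odot>\<^bsub>M\<^esub> ?t = \<zero>\<^bsub>M\<^esub>" if "h \<in> insert g S'" for h
    proof (cases "h = g")
      case True
      then show ?thesis using k smult_mult[OF g(2) pow[OF g(2)] t(1), of k'] by (simp add: k')
    next
      case False
      then have h: "h \<in> S'" "h \<in> A" using that insert.prems S by auto
      then show ?thesis
        using smult_commute[OF h(2) pow[OF g(2)] t(1)] t(3) smult_r_null[OF pow[OF g(2)]] by simp
    qed
    moreover have "\<exists>k. h ^ k \<odot>\<^bsub>M\<^esub> ?t = \<zero>\<^bsub>M\<^esub>" if hS: "h \<in> S" for h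
    proof -
      obtain l where l: "h ^ l \<odot>\<^bsub>M\<^esub> t = \<zero>\<^bsub>M\<^esub>" using bspec[OF t(4) hS] by (rule exE)
      have "h \<in> A" using hS S by blast
      then have "h ^ l \<odot>\<^bsub>M\<^esub> ?t = \<zero>\<^bsub>M\<^esub>"
        using smult_commute[OF pow pow[OF g(2)] t(1)] l smult_r_null[OF pow[OF g(2)]] by simp
      then show ?thesis by blast
    qed
    ultimately show ?case by (intro bexI[of _ ?t] conjI ballI)
  qed
  from this[OF S(1) order_refl] obtain t where t: "t \<in> carrier M" "t \<noteq> \<zero>\<^bsub>M\<^esub>" "\<forall>g\<in>S. g \<odot>\<^bsub>M\<^esub> t = \<zero>\<^bsub>M\<^esub>"
    by (elim bexE conjE) (rule that)
  have "(\<Sum>g\<in>S'. b g * g) \<in> A \<and> (\<Sum>g\<in>S'. b g * g) \<odot>\<^bsub>M\<^esub> t = \<zero>\<^bsub>M\<^esub>" if "finite S'" "S' \<subseteq> S" for S'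
    using that
  proof (induction S' rule: finite_induct)
    case empty
    then show ?case using smult_0[OF t(1)] chart_ring_zero[OF ring] by simp
  next
    case (insert g S')
    then have g: "g \<in> A" "b g \<in> A" "g \<odot>\<^bsub>M\<^esub> t = \<zero>\<^bsub>M\<^esub>" using S t by auto
    then have "(b g * g) \<odot>\<^bsub>M\<^esub> t = \<zero>\<^bsub>M\<^esub>" using smult_mult[OF g(2,1) t(1)] smult_r_null by simp
    then show ?case
      using insert smult_add[OF mul[OF g(2,1)] _ t(1)] chart_ring_add[OF ring mul[OF g(2,1)]] by auto
  qed
  from this[OF S(1) order_refl] have "t = \<zero>\<^bsub>M\<^esub>" using S(4) smult_1[OF t(1)] by simp
  then show False using t by simp
qed

text \<open>Up to multiplication by a power of \<open>f\<close>, a frame on one nonempty open set embeds the whole module.\<close>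

lemma embedding:
  assumes fg: "finitely_generated (chart_ring R \<sigma>) M"
  shows "\<exists>(n :: nat) \<kappa>. (\<forall>s\<in>carrier M. \<forall>j. \<kappa> s j \<in> A \<and> (n \<le> j \<longrightarrow> \<kappa> s j = 0)) \<and>
    (\<forall>s\<in>carrier M. \<forall>t\<in>carrier M. \<kappa> (s \<oplus>\<^bsub>M\<^esub> t) = (\<lambda>j. \<kappa> s j + \<kappa> t j)) \<and>
    (\<forall>a\<in>A. \<forall>s\<in>carrier M. \<kappa> (a \<odot>\<^bsub>M\<^esub> s) = (\<lambda>j. a * \<kappa> s j)) \<and>
    (\<forall>s\<in>carrier M. \<kappa> s = (\<lambda>_. 0) \<longrightarrow> s = \<zero>\<^bsub>M\<^esub>)"
proof -
  obtain S b where S: "S \<subseteq> A" "(\<Sum>g\<in>S. b g * g) = 1"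
    and fr: "\<And>g. g \<in> S \<Longrightarrow> \<exists>es. is_frame (chart_ring R \<sigma>) M g es"
    by (rule locally_free_cover) (rule that)
  have "\<exists>f\<in>S. f \<noteq> 0"
  proof (rule ccontr)
    assume "\<not> ?thesis"
    then have "(\<Sum>g\<in>S. b g * g) = 0" by (intro sum.neutral) auto
    then show False using S(2) by simp
  qed
  then obtain f es where f0: "f \<noteq> 0" and frame: "is_frame (chart_ring R \<sigma>) M f es" using fr by blast
  note fA = frame_mem(1)[OF frame]
  note pow = chart_ring_power[OF ring fA] and mul = chart_ring_mult[OF ring]
  let ?C = "{..<length es} \<rightarrow> A"
  obtain G where G: "finite G" "G \<subseteq> carrier M"
    and gen: "\<forall>s\<in>carrier M. \<exists>c\<in>G \<rightarrow> A. s = (\<Oplus>\<^bsub>M\<^esub>g\<in>G. c g \<odot>\<^bsub>M\<^esub> g)"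
    using fg unfolding finitely_generated_def by blast
  have "\<forall>g\<in>G. \<exists>k. \<exists>c\<in>?C. f ^ k \<odot>\<^bsub>M\<^esub> g = lincomb es c" using frame_span[OF frame] G by blast
  from bchoice[OF this] obtain k where k: "\<forall>g\<in>G. \<exists>c\<in>?C. f ^ k g \<odot>\<^bsub>M\<^esub> g = lincomb es c" by blast
  \<comment> \<open>Finite generation provides one exponent that moves the whole module into the
    span of the frame.\<close>
  define K where "K = (\<Sum>g\<in>G. k g)"
  have ex: "\<exists>c\<in>?C. f ^ K \<odot>\<^bsub>M\<^esub> s = lincomb es c" if "s \<in> carrier M" for s
  proof (rule generated_induct[OF G gen that, where P = "\<lambda>s. \<exists>c\<in>?C. f ^ K \<odot>\<^bsub>M\<^esub> s = lincomb es c"])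
    fix g assume g: "g \<in> G"
    then obtain c where c: "c \<in> ?C" "f ^ k g \<odot>\<^bsub>M\<^esub> g = lincomb es c" using k by blast
    have "k g \<le> K" unfolding K_def using g G by (simp add: member_le_sum)
    then have "f ^ K = f ^ (K - k g) * f ^ k g" by (simp flip: power_add)
    then have "f ^ K \<odot>\<^bsub>M\<^esub> g = f ^ (K - k g) \<odot>\<^bsub>M\<^esub> lincomb es c"
      using smult_mult[OF pow pow, of g] g G c by auto
    also have "\<dots> = lincomb es (\<lambda>j. f ^ (K - k g) * c j)" by (rule lincomb_smult[OF frame pow c(1)])
    finally show "\<exists>c\<in>?C. f ^ K \<odot>\<^bsub>M\<^esub> g = lincomb es c"
      using c(1) mul[OF pow] by (intro bexI[of _ "\<lambda>j. f ^ (K - k g) * c j"]) auto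
  next
    show "\<exists>c\<in>?C. f ^ K \<odot>\<^bsub>M\<^esub> \<zero>\<^bsub>M\<^esub> = lincomb es c"
      using lincomb_zero[OF frame, of "\<lambda>_. 0"] smult_r_null[OF pow] chart_ring_zero[OF ring]
      by (intro bexI[of _ "\<lambda>_. 0"]) auto
  next
    fix s t assume st: "s \<in> carrier M" "t \<in> carrier M"
      and "\<exists>c\<in>?C. f ^ K \<odot>\<^bsub>M\<^esub> s = lincomb es c" "\<exists>c\<in>?C. f ^ K \<odot>\<^bsub>M\<^esub> t = lincomb es c"
    then obtain c d where cd: "c \<in> ?C" "d \<in> ?C" "f ^ K \<odot>\<^bsub>M\<^esub> s = lincomb es c" "f ^ K \<odot>\<^bsub>M\<^esub> t = lincomb es d"
      by blast
    then have "f ^ K \<odot>\<^bsub>M\<^esub> (s \<oplus>\<^bsub>M\<^esub> t) = lincomb es (\<lambda>j. c j + d j)"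
      using smult_r_distr[OF pow st] lincomb_add[OF frame cd(1,2)] by simp
    then show "\<exists>c\<in>?C. f ^ K \<odot>\<^bsub>M\<^esub> (s \<oplus>\<^bsub>M\<^esub> t) = lincomb es c"
      using cd(1,2)
        by (intro bexI[of _ "\<lambda>j. c j + d j"]) (auto simp: Pi_iff intro: chart_ring_add[OF ring])
  next
    fix a s assume a: "a \<in> A" and s: "s \<in> carrier M" and "\<exists>c\<in>?C. f ^ K \<odot>\<^bsub>M\<^esub> s = lincomb es c"
    then obtain c where c: "c \<in> ?C" "f ^ K \<odot>\<^bsub>M\<^esub> s = lincomb es c" by blast
    then have "f ^ K \<odot>\<^bsub>M\<^esub> (a \<odot>\<^bsub>M\<^esub> s) = lincomb es (\<lambda>j. a * c j)"
      using smult_commute[OF pow a s] lincomb_smult[OF frame a c(1)] by simp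
    then show "\<exists>c\<in>?C. f ^ K \<odot>\<^bsub>M\<^esub> (a \<odot>\<^bsub>M\<^esub> s) = lincomb es c"
      using c(1) mul[OF a] by (intro bexI[of _ "\<lambda>j. a * c j"]) auto
  qed
  \<comment> \<open>The coefficients of \<open>f ^ K\<close> times \<open>s\<close> in the frame.
    Because \<open>f\<close> is nonzero they are unique, so the choice by SOME is linear all the
    same.\<close>
  define \<kappa> where "\<kappa> s = (\<lambda>j. if j < length es then (SOME c. c \<in> ?C \<and> f ^ K \<odot>\<^bsub>M\<^esub> s = lincomb es c) j else 0)" for s
  have \<kappa>: "\<kappa> s \<in> ?C" "f ^ K \<odot>\<^bsub>M\<^esub> s = lincomb es (\<kappa> s)" if s: "s \<in> carrier M" for s
  proof -
    let ?c = "SOME c. c \<in> ?C \<and> f ^ K \<odot>\<^bsub>M\<^esub> s = lincomb es c"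
    have c: "?c \<in> ?C \<and> f ^ K \<odot>\<^bsub>M\<^esub> s = lincomb es ?c"
      using ex[OF s] by (intro someI_ex[of "\<lambda>c. c \<in> ?C \<and> f ^ K \<odot>\<^bsub>M\<^esub> s = lincomb es c"]) blast
    show "\<kappa> s \<in> ?C" using c by (auto simp: \<kappa>_def)
    have "lincomb es (\<kappa> s) = lincomb es ?c"
      by (rule lincomb_cong[OF frame conjunct1[OF c]]) (simp add: \<kappa>_def)
    then show "f ^ K \<odot>\<^bsub>M\<^esub> s = lincomb es (\<kappa> s)" using c by simp
  qed
  have out: "\<kappa> s j = 0" if "length es \<le> j" for s j using that by (simp add: \<kappa>_def)
  have unique: "\<kappa> s = d" if s: "s \<in> carrier M" and d: "d \<in> ?C" "\<And>j. length es \<le> j \<Longrightarrow> d j = 0"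
    "f ^ K \<odot>\<^bsub>M\<^esub> s = lincomb es d" for s d
  proof
    fix j
    have eq: "lincomb es (\<kappa> s) = lincomb es d" using \<kappa>(2)[OF s] d(3) by simp
    show "\<kappa> s j = d j"
    proof (cases "j < length es")
      case True
      show ?thesis by (rule lincomb_inject[OF frame f0 \<kappa>(1)[OF s] d(1) eq True])
    next
      case False
      then show ?thesis using out[of j s] d(2)[of j] by simp
    qed
  qed
  show ?thesis
  proof (intro exI[of _ "length es"] exI[of _ \<kappa>] conjI ballI allI impI)
    fix s j assume s: "s \<in> carrier M"
    show "\<kappa> s j \<in> A" using \<kappa>(1)[OF s] out[of j s] chart_ring_zero[OF ring]
      by (cases "j < length es") auto
    show "length es \<le> j \<Longrightarrow> \<kappa> s j = 0" by (rule out)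
  next
    fix s t assume st: "s \<in> carrier M" "t \<in> carrier M"
    show "\<kappa> (s \<oplus>\<^bsub>M\<^esub> t) = (\<lambda>j. \<kappa> s j + \<kappa> t j)"
    proof (rule unique)
      show "f ^ K \<odot>\<^bsub>M\<^esub> (s \<oplus>\<^bsub>M\<^esub> t) = lincomb es (\<lambda>j. \<kappa> s j + \<kappa> t j)"
        using smult_r_distr[OF pow st] lincomb_add[OF frame \<kappa>(1)[OF st(1)] \<kappa>(1)[OF st(2)]] \<kappa>(2) st by simp
      show "(\<lambda>j. \<kappa> s j + \<kappa> t j) \<in> ?C"
        using \<kappa>(1)[OF st(1)] \<kappa>(1)[OF st(2)] by (simp add: Pi_iff chart_ring_add[OF ring])
    qed (simp_all add: st out)
  next
    fix a s assume a: "a \<in> A" and s: "s \<in> carrier M"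
    show "\<kappa> (a \<odot>\<^bsub>M\<^esub> s) = (\<lambda>j. a * \<kappa> s j)"
    proof (rule unique)
      show "f ^ K \<odot>\<^bsub>M\<^esub> (a \<odot>\<^bsub>M\<^esub> s) = lincomb es (\<lambda>j. a * \<kappa> s j)"
        using smult_commute[OF pow a s] lincomb_smult[OF frame a \<kappa>(1)[OF s]] \<kappa>(2)[OF s] by simp
      show "(\<lambda>j. a * \<kappa> s j) \<in> ?C" using \<kappa>(1)[OF s] by (simp add: Pi_iff mul[OF a])
    qed (simp_all add: a s out)
  next
    fix s assume s: "s \<in> carrier M" and z: "\<kappa> s = (\<lambda>_. 0)"
    have "f ^ K \<odot>\<^bsub>M\<^esub> s = \<zero>\<^bsub>M\<^esub>" using \<kappa>(2)[OF s] lincomb_zero[OF frame, of "\<kappa> s"] z by simp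
    moreover have "f ^ k \<noteq> 0" for k by (induction k) (use f0 laurent_no_zero_divisors in auto)
    ultimately show "s = \<zero>\<^bsub>M\<^esub>" using torsion_free[OF pow _ s] by blast
  qed
qed

end

text \<open>The clauses of \<open>equivariant_structure\<close> that concern a single chart.\<close>

definition coaction :: "(int ^ 'n \<Rightarrow> 'a \<Rightarrow> 'a) \<Rightarrow> bool" where
  "coaction c \<longleftrightarrow>
    (\<forall>m. \<forall>s\<in>carrier M. c m s \<in> carrier M) \<and>
    (\<forall>m. \<forall>s\<in>carrier M. \<forall>t\<in>carrier M. c m (s \<oplus>\<^bsub>M\<^esub> t) = c m s \<oplus>\<^bsub>M\<^esub> c m t) \<and>
    (\<forall>s\<in>carrier M. finite {m. c m s \<noteq> \<zero>\<^bsub>M\<^esub>}) \<and>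
    (\<forall>s\<in>carrier M. s = (\<Oplus>\<^bsub>M\<^esub>m\<in>{m. c m s \<noteq> \<zero>\<^bsub>M\<^esub>}. c m s)) \<and>
    (\<forall>r\<in>R. \<forall>k\<in>dual_monoid \<sigma>. \<forall>m. \<forall>s\<in>carrier M.
      c (k + m) (Poly_Mapping.single k r \<odot>\<^bsub>M\<^esub> s) = Poly_Mapping.single k r \<odot>\<^bsub>M\<^esub> c m s) \<and>
    (\<forall>m k. \<forall>s\<in>carrier M. c m (c k s) = (if m = k then c k s else \<zero>\<^bsub>M\<^esub>))"

end

section \<open>Embedding an equivariant bundle\<close>

context chart_module
begin

context
  fixes c assumes co: "coaction c"
begin

lemma coaction_closed: "s \<in> carrier M \<Longrightarrow> c m s \<in> carrier M"
  and coaction_add: "s \<in> carrier M \<Longrightarrow> t \<in> carrier M \<Longrightarrow> c m (s \<oplus>\<^bsub>M\<^esub> t) = c m s \<oplus>\<^bsub>M\<^esub> c m t"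
  and coaction_finite: "s \<in> carrier M \<Longrightarrow> finite {m. c m s \<noteq> \<zero>\<^bsub>M\<^esub>}"
  and coaction_sum: "s \<in> carrier M \<Longrightarrow> s = (\<Oplus>\<^bsub>M\<^esub>m\<in>{m. c m s \<noteq> \<zero>\<^bsub>M\<^esub>}. c m s)"
  and coaction_coaction: "s \<in> carrier M \<Longrightarrow> c m (c k s) = (if m = k then c k s else \<zero>\<^bsub>M\<^esub>)"
  using co unfolding coaction_def by blast+

lemma coaction_single:
  assumes "r \<in> R" "k \<in> dual_monoid \<sigma>" "s \<in> carrier M"
  shows "c m (Poly_Mapping.single k r \<odot>\<^bsub>M\<^esub> s) = Poly_Mapping.single k r \<odot>\<^bsub>M\<^esub> c (m - k) s"
proof -
  have "c (k + (m - k)) (Poly_Mapping.single k r \<odot>\<^bsub>M\<^esub> s) = Poly_Mapping.single k r \<odot>\<^bsub>M\<^esub> c (m - k) s"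
    using co assms unfolding coaction_def by blast
  then show ?thesis by simp
qed

lemma coaction_zero: "c m \<zero>\<^bsub>M\<^esub> = \<zero>\<^bsub>M\<^esub>"
  using coaction_add[of "\<zero>\<^bsub>M\<^esub>" "\<zero>\<^bsub>M\<^esub>" m] coaction_closed[of "\<zero>\<^bsub>M\<^esub>" m] by simp

end

lemma hom_smult:
  fixes \<phi> :: "'a \<Rightarrow> nat \<Rightarrow> 'n laurent"
  assumes add: "\<And>s t. s \<in> carrier M \<Longrightarrow> t \<in> carrier M \<Longrightarrow> \<phi> (s \<oplus>\<^bsub>M\<^esub> t) = (\<lambda>j. \<phi> s j + \<phi> t j)"
    and single: "\<And>k r s. k \<in> dual_monoid \<sigma> \<Longrightarrow> r \<in> R \<Longrightarrow> s \<in> carrier M \<Longrightarrow>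
      \<phi> (Poly_Mapping.single k r \<odot>\<^bsub>M\<^esub> s) = (\<lambda>j. Poly_Mapping.single k r * \<phi> s j)"
    and f: "f \<in> A" and s: "s \<in> carrier M"
  shows "\<phi> (f \<odot>\<^bsub>M\<^esub> s) = (\<lambda>j. f * \<phi> s j)"
proof -
  have zero: "\<phi> \<zero>\<^bsub>M\<^esub> = (\<lambda>_. 0)" using add[of "\<zero>\<^bsub>M\<^esub>" "\<zero>\<^bsub>M\<^esub>"] by (simp add: fun_eq_iff)
  have sing: "Poly_Mapping.single k (Poly_Mapping.lookup f k) \<in> A" if "k \<in> Poly_Mapping.keys f" for k
    using f that by (intro single_in_chart_ring[OF ring]) (auto simp: chart_ring_mem in_keys_iff)
  have "\<phi> ((\<Sum>k\<in>K. Poly_Mapping.single k (Poly_Mapping.lookup f k)) \<odot>\<^bsub>M\<^esub> s) =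
      (\<lambda>j. (\<Sum>k\<in>K. Poly_Mapping.single k (Poly_Mapping.lookup f k)) * \<phi> s j)"
    if "finite K" "K \<subseteq> Poly_Mapping.keys f" for K
    using that
  proof (induction K rule: finite_induct)
    case empty
    then show ?case by (simp add: smult_0[OF s] zero)
  next
    case (insert k K)
    let ?g = "\<Sum>k\<in>K. Poly_Mapping.single k (Poly_Mapping.lookup f k)"
    have k: "k \<in> dual_monoid \<sigma>" "Poly_Mapping.lookup f k \<in> R"
      using f insert.prems by (auto simp: chart_ring_mem in_keys_iff)
    have g: "?g \<in> A" using insert.prems sing by (intro chart_ring_sum[OF ring]) auto
    have kA: "Poly_Mapping.single k (Poly_Mapping.lookup f k) \<in> A" using insert.prems sing by auto
    have "(\<Sum>k\<in>insert k K. Poly_Mapping.single k (Poly_Mapping.lookup f k)) \<odot>\<^bsub>M\<^esub> s =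
        Poly_Mapping.single k (Poly_Mapping.lookup f k) \<odot>\<^bsub>M\<^esub> s \<oplus>\<^bsub>M\<^esub> ?g \<odot>\<^bsub>M\<^esub> s"
      using insert kA g s by (simp add: smult_add)
    then show ?case
      using insert kA g s k by (simp add: add single distrib_right)
  qed
  from this[of "Poly_Mapping.keys f"] show ?thesis by (simp flip: laurent_expand)
qed

text \<open>
  Starting from coordinates \<open>\<kappa>\<close> that need not respect the grading, the component of degree \<open>m\<close> is
  shifted to degree \<open>0\<close> and its coefficients, of which only finitely many can be nonzero, become
  new coordinates.
\<close>

lemma graded_embedding:
  assumes lf: "locally_free (chart_ring R \<sigma>) M P" and fg: "finitely_generated (chart_ring R \<sigma>) M"
    and co: "coaction c"
  shows "\<exists>N lam. (\<forall>s\<in>carrier M. \<forall>m e. coef (lam s) m e \<in> R \<and> (N \<le> e \<longrightarrow> lam s e = 0)) \<and>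
    (\<forall>s\<in>carrier M. \<forall>t\<in>carrier M. lam (s \<oplus>\<^bsub>M\<^esub> t) = (\<lambda>e. lam s e + lam t e)) \<and>
    (\<forall>f\<in>A. \<forall>s\<in>carrier M. lam (f \<odot>\<^bsub>M\<^esub> s) = (\<lambda>e. f * lam s e)) \<and>
    (\<forall>s\<in>carrier M. \<forall>m. lam (c m s) = mono_vec m (coef (lam s) m)) \<and>
    (\<forall>s\<in>carrier M. lam s = (\<lambda>_. 0) \<longrightarrow> s = \<zero>\<^bsub>M\<^esub>)"
proof -
  obtain n :: nat and \<kappa> where kmem: "\<forall>s\<in>carrier M. \<forall>j. \<kappa> s j \<in> A \<and> (n \<le> j \<longrightarrow> \<kappa> s j = 0)"
    and kadd': "\<forall>s\<in>carrier M. \<forall>t\<in>carrier M. \<kappa> (s \<oplus>\<^bsub>M\<^esub> t) = (\<lambda>j. \<kappa> s j + \<kappa> t j)"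
    and ksm': "\<forall>a\<in>A. \<forall>s\<in>carrier M. \<kappa> (a \<odot>\<^bsub>M\<^esub> s) = (\<lambda>j. a * \<kappa> s j)"
    and kinj: "\<forall>s\<in>carrier M. \<kappa> s = (\<lambda>_. 0) \<longrightarrow> s = \<zero>\<^bsub>M\<^esub>"
    using embedding[OF lf fg] by (elim exE conjE) (rule that)
  have kadd: "\<kappa> (s \<oplus>\<^bsub>M\<^esub> t) j = \<kappa> s j + \<kappa> t j" if "s \<in> carrier M" "t \<in> carrier M" for s t j
    using kadd' that by simp
  have ksingle: "\<kappa> (Poly_Mapping.single k r \<odot>\<^bsub>M\<^esub> s) j = Poly_Mapping.single k r * \<kappa> s j"
    if "k \<in> dual_monoid \<sigma>" "r \<in> R" "s \<in> carrier M" for k r s j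
    using ksm' single_in_chart_ring[OF ring that(2,1)] that(3) by simp
  have kzero: "\<kappa> \<zero>\<^bsub>M\<^esub> j = 0" for j using kadd[of "\<zero>\<^bsub>M\<^esub>" "\<zero>\<^bsub>M\<^esub>" j] by simp
  note cc = coaction_closed[OF co]
  obtain G where G: "finite G" "G \<subseteq> carrier M"
    and gen: "\<forall>s\<in>carrier M. \<exists>c\<in>G \<rightarrow> A. s = (\<Oplus>\<^bsub>M\<^esub>g\<in>G. c g \<odot>\<^bsub>M\<^esub> g)"
    using fg unfolding finitely_generated_def by (elim exE conjE) (rule that)
  \<comment> \<open>Exponents of the coordinates of homogeneous components, taken relative to the
    degree, for the finitely many generators. Multiplication by a character shifts exponent and
    degree alike, so \<open>degrees\<close> finds no further differences \<open>p - m\<close> in the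
    whole module.\<close>
  define K where "K = (\<Union>g\<in>G. \<Union>d\<in>{d. c d g \<noteq> \<zero>\<^bsub>M\<^esub>}. \<Union>j\<in>{..<n}. (\<lambda>p. p - d) ` Poly_Mapping.keys (\<kappa> (c d g) j))"
  have finK: "finite K" unfolding K_def using G coaction_finite[OF co] by (intro finite_UN_I) auto
  have degrees: "\<forall>m j p. Poly_Mapping.lookup (\<kappa> (c m s) j) p \<noteq> 0 \<longrightarrow> p - m \<in> K" if "s \<in> carrier M" for s
  proof (rule generated_induct[OF G gen that, where P = "\<lambda>s. \<forall>m j p. Poly_Mapping.lookup (\<kappa> (c m s) j) p \<noteq> 0 \<longrightarrow> p - m \<in> K"])
    fix g assume g: "g \<in> G"
    show "\<forall>m j p. Poly_Mapping.lookup (\<kappa> (c m g) j) p \<noteq> 0 \<longrightarrow> p - m \<in> K"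
    proof (intro allI impI)
      fix m j p assume nz: "Poly_Mapping.lookup (\<kappa> (c m g) j) p \<noteq> 0"
      have "c m g \<noteq> \<zero>\<^bsub>M\<^esub>" using nz kzero by auto
      moreover have "j < n" using nz kmem cc[of g m] g G by (metis lookup_zero not_le subsetD)
      moreover have "p - m \<in> (\<lambda>p. p - m) ` Poly_Mapping.keys (\<kappa> (c m g) j)"
        using nz by (intro imageI) (simp add: in_keys_iff)
      ultimately show "p - m \<in> K" unfolding K_def using g by blast
    qed
  next
    show zero: "\<forall>m j p. Poly_Mapping.lookup (\<kappa> (c m \<zero>\<^bsub>M\<^esub>) j) p \<noteq> 0 \<longrightarrow> p - m \<in> K"
      by (simp add: coaction_zero[OF co] kzero)
    show add: "\<forall>m j p. Poly_Mapping.lookup (\<kappa> (c m (s \<oplus>\<^bsub>M\<^esub> t)) j) p \<noteq> 0 \<longrightarrow> p - m \<in> K"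
      if st: "s \<in> carrier M" "t \<in> carrier M"
      and s: "\<forall>m j p. Poly_Mapping.lookup (\<kappa> (c m s) j) p \<noteq> 0 \<longrightarrow> p - m \<in> K"
      and t: "\<forall>m j p. Poly_Mapping.lookup (\<kappa> (c m t) j) p \<noteq> 0 \<longrightarrow> p - m \<in> K" for s t
    proof (intro allI impI)
      fix m j p assume nz: "Poly_Mapping.lookup (\<kappa> (c m (s \<oplus>\<^bsub>M\<^esub> t)) j) p \<noteq> 0"
      have "Poly_Mapping.lookup (\<kappa> (c m s) j) p \<noteq> 0 \<or> Poly_Mapping.lookup (\<kappa> (c m t) j) p \<noteq> 0"
        using nz by (auto simp: coaction_add[OF co st] kadd cc st lookup_add)
      then show "p - m \<in> K" using s t by blast
    qed
    fix f s assume f: "f \<in> A" and s: "s \<in> carrier M"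
      and Ps: "\<forall>m j p. Poly_Mapping.lookup (\<kappa> (c m s) j) p \<noteq> 0 \<longrightarrow> p - m \<in> K"
    show "\<forall>m j p. Poly_Mapping.lookup (\<kappa> (c m (f \<odot>\<^bsub>M\<^esub> s)) j) p \<noteq> 0 \<longrightarrow> p - m \<in> K"
    proof (rule smult_induct[OF f s, where P = "\<lambda>s. \<forall>m j p. Poly_Mapping.lookup (\<kappa> (c m s) j) p \<noteq> 0 \<longrightarrow> p - m \<in> K"])
      fix k r s assume k: "k \<in> dual_monoid \<sigma>" and r: "r \<in> R" and s: "s \<in> carrier M"
        and Ps: "\<forall>m j p. Poly_Mapping.lookup (\<kappa> (c m s) j) p \<noteq> 0 \<longrightarrow> p - m \<in> K"
      show "\<forall>m j p. Poly_Mapping.lookup (\<kappa> (c m (Poly_Mapping.single k r \<odot>\<^bsub>M\<^esub> s)) j) p \<noteq> 0 \<longrightarrow> p - m \<in> K"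
      proof (intro allI impI)
        fix m j p assume "Poly_Mapping.lookup (\<kappa> (c m (Poly_Mapping.single k r \<odot>\<^bsub>M\<^esub> s)) j) p \<noteq> 0"
        then have "Poly_Mapping.lookup (\<kappa> (c (m - k) s) j) (p - k) \<noteq> 0"
          by (simp add: coaction_single[OF co r k s] ksingle[OF k r cc[OF s]] lookup_single_mult)
        then have "(p - k) - (m - k) \<in> K" using Ps by blast
        then show "p - m \<in> K" by simp
      qed
    qed (use Ps zero add in blast)+
  qed
  \<comment> \<open>One new coordinate for each old coordinate \<open>j\<close> and relative
    exponent \<open>q\<close>: in degree \<open>m\<close> it records the coefficient of exponent
    \<open>q + m\<close> in coordinate \<open>j\<close>.\<close>
  define I where "I = {..<n} \<times> K"
  have "finite I" using finK by (simp add: I_def)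
  then obtain \<beta> where \<beta>: "bij_betw \<beta> {..<card I} I"
    using ex_bij_betw_nat_finite by (metis atLeast0LessThan)
  define lamc where "lamc s m e = (if e < card I then
    Poly_Mapping.lookup (\<kappa> (c m s) (fst (\<beta> e))) (snd (\<beta> e) + m) else 0)" for s m e
  have "\<exists>x. \<forall>m. coef x m = lamc s m" if "s \<in> carrier M" for s
    by (rule vec_of_coefs[OF coaction_finite[OF co that]])
      (auto simp: lamc_def fun_eq_iff kzero split: if_splits)
  then obtain lam where lam: "\<And>s m. s \<in> carrier M \<Longrightarrow> coef (lam s) m = lamc s m" by metis
  have add: "lam (s \<oplus>\<^bsub>M\<^esub> t) = (\<lambda>e. lam s e + lam t e)" if st: "s \<in> carrier M" "t \<in> carrier M" for s t
    by (rule coef_eqI)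
      (auto simp: coef_add lam st M.a_closed lamc_def coaction_add[OF co st] kadd cc lookup_add)
  have single: "lam (Poly_Mapping.single k r \<odot>\<^bsub>M\<^esub> s) = (\<lambda>e. Poly_Mapping.single k r * lam s e)"
    if k: "k \<in> dual_monoid \<sigma>" and r: "r \<in> R" and s: "s \<in> carrier M" for k r s
    by (rule coef_eqI)
      (auto simp: coef_single_mult lam s smult_closed single_in_chart_ring[OF ring r k] lamc_def
        coaction_single[OF co r k s] ksingle[OF k r cc[OF s]] lookup_single_mult add_diff_eq)
  have graded: "lam (c m s) = mono_vec m (coef (lam s) m)" if s: "s \<in> carrier M" for m s
    by (rule coef_eqI)
      (auto simp: coef_mono_vec lam s cc lamc_def coaction_coaction[OF co s] kzero fun_eq_iff)
  have inj: "s = \<zero>\<^bsub>M\<^esub>" if s: "s \<in> carrier M" and z: "lam s = (\<lambda>_. 0)" for s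
  proof -
    have "c m s = \<zero>\<^bsub>M\<^esub>" for m
    proof -
      \<comment> \<open>A nonzero coefficient would have its relative exponent in \<open>K\<close>
        and so be seen by one of the new coordinates.\<close>
      have "Poly_Mapping.lookup (\<kappa> (c m s) j) p = 0" for j p
      proof (rule ccontr)
        assume nz: "Poly_Mapping.lookup (\<kappa> (c m s) j) p \<noteq> 0"
        then have "p - m \<in> K" using degrees[OF s] by blast
        moreover have "j < n" using nz kmem cc[OF s, of m] by (metis lookup_zero not_le)
        ultimately have "(j, p - m) \<in> \<beta> ` {..<card I}" using \<beta> by (simp add: bij_betw_def I_def)
        then obtain e where e: "e < card I" "\<beta> e = (j, p - m)" by auto
        have "lamc s m e = 0" using lam[OF s, of m] z by (simp add: coef_def fun_eq_iff)
        then show False using nz e by (simp add: lamc_def)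
      qed
      then have "\<kappa> (c m s) = (\<lambda>_. 0)" by (intro ext poly_mapping_eqI) simp
      then show ?thesis using kinj cc[OF s] by blast
    qed
    then show ?thesis using coaction_sum[OF co s] by simp
  qed
  show ?thesis
  proof (intro exI[of _ "card I"] exI[of _ lam] conjI ballI allI impI)
    fix s m e assume s: "s \<in> carrier M"
    show "coef (lam s) m e \<in> R"
      using kmem cc[OF s, of m] ring by (simp add: lam[OF s] lamc_def chart_ring_mem ring_subset_def)
    assume "card I \<le> e"
    then show "lam s e = 0"
      using lam[OF s] by (intro poly_mapping_eqI) (simp add: lamc_def coef_def fun_eq_iff)
  next
    fix f s assume f: "f \<in> A" and s: "s \<in> carrier M"
    show "lam (f \<odot>\<^bsub>M\<^esub> s) = (\<lambda>e. f * lam s e)"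
      by (rule hom_smult[where \<phi> = lam, OF _ _ f s]) (rule add single; assumption)+
  qed (use add graded inj in auto)
qed

end

text \<open>Only the sections over the torus are embedded by \<open>graded_embedding\<close>; the
  other charts follow by restriction to \<open>{0}\<close>. That restriction is injective because
  elements of its kernel are killed by characters and the modules are torsion-free. As all charts
  land in one module, the restrictions of \<open>F\<close> become inclusions between the
  \<open>Z \<sigma>\<close>.\<close>

lemma equivariant_bundle_embedding:
  fixes R :: "complex set" and \<Sigma> :: "(real ^ 'n::finite) set set" and F :: "('n, 'a) sheaf"
  assumes R: "ring_subset R" and sf: "smooth_fan \<Sigma>"
    and vb: "vector_bundle R \<Sigma> F" and es: "equivariant_structure R \<Sigma> F c"
  shows "\<exists>N Z B \<Lambda>. graded_family R \<Sigma> N Z B \<and>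
    (\<forall>\<sigma>\<in>\<Sigma>. bij_betw (\<Lambda> \<sigma>) (sec F \<sigma>) (Z \<sigma>) \<and>
      (\<forall>s\<in>sec F \<sigma>. \<forall>t\<in>sec F \<sigma>. \<Lambda> \<sigma> (s \<oplus>\<^bsub>sections F \<sigma>\<^esub> t) = (\<lambda>e. \<Lambda> \<sigma> s e + \<Lambda> \<sigma> t e)) \<and>
      (\<forall>f\<in>carrier (chart_ring R \<sigma>). \<forall>s\<in>sec F \<sigma>. \<Lambda> \<sigma> (f \<odot>\<^bsub>sections F \<sigma>\<^esub> s) = (\<lambda>e. f * \<Lambda> \<sigma> s e))) \<and>
    (\<forall>\<sigma>\<in>\<Sigma>. \<forall>\<tau>\<in>\<Sigma>. \<tau> \<subseteq> \<sigma> \<longrightarrow> (\<forall>s\<in>sec F \<sigma>. \<Lambda> \<tau> (restr F \<sigma> \<tau> s) = \<Lambda> \<sigma> s))"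
proof -
  have qc: "quasi_coherent R \<Sigma> F" using vb by (simp add: vector_bundle_def coherent_def)
  have cm: "chart_module R \<sigma> (sections F \<sigma>)" if "\<sigma> \<in> \<Sigma>" for \<sigma>
    using qc that R by (auto simp: chart_module_def quasi_coherent_def)
  have fg: "finitely_generated (chart_ring R \<sigma>) (sections F \<sigma>)" if "\<sigma> \<in> \<Sigma>" for \<sigma>
    using vb that by (simp add: vector_bundle_def coherent_def)
  have lf: "locally_free (chart_ring R \<sigma>) (sections F \<sigma>) (\<lambda>r. True)" if "\<sigma> \<in> \<Sigma>" for \<sigma>
    using vb that by (simp add: vector_bundle_def)
  have co: "chart_module.coaction R \<sigma> (sections F \<sigma>) (c \<sigma>)" if "\<sigma> \<in> \<Sigma>" for \<sigma>
    unfolding chart_module.coaction_def[OF cm[OF that]]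
    using es that unfolding equivariant_structure_def Pi_iff by meson
  have co_restr: "c \<tau> m (restr F \<sigma> \<tau> s) = restr F \<sigma> \<tau> (c \<sigma> m s)"
    if "\<sigma> \<in> \<Sigma>" "\<tau> \<in> \<Sigma>" "\<tau> \<subseteq> \<sigma>" "s \<in> sec F \<sigma>" for \<sigma> \<tau> m s
    using es that unfolding equivariant_structure_def by blast
  have hom: "restr F \<sigma> \<tau> \<in> module_hom (chart_ring R \<sigma>) (sections F \<sigma>) (sections F \<tau>)"
    if "\<sigma> \<in> \<Sigma>" "\<tau> \<in> \<Sigma>" "\<tau> \<subseteq> \<sigma>" for \<sigma> \<tau>
    using qc that unfolding quasi_coherent_def by blast
  have ker: "\<exists>m\<in>inverted_chars \<sigma> \<tau>. char m \<odot>\<^bsub>sections F \<sigma>\<^esub> s = \<zero>\<^bsub>sections F \<sigma>\<^esub>"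
    if "\<sigma> \<in> \<Sigma>" "\<tau> \<in> \<Sigma>" "\<tau> \<subseteq> \<sigma>" "s \<in> sec F \<sigma>" "restr F \<sigma> \<tau> s = \<zero>\<^bsub>sections F \<tau>\<^esub>" for \<sigma> \<tau> s
    using qc that unfolding quasi_coherent_def by blast
  have local: "\<exists>m\<in>inverted_chars \<sigma> \<tau>. \<exists>s\<in>sec F \<sigma>. char m \<odot>\<^bsub>sections F \<tau>\<^esub> t = restr F \<sigma> \<tau> s"
    if "\<sigma> \<in> \<Sigma>" "\<tau> \<in> \<Sigma>" "\<tau> \<subseteq> \<sigma>" "t \<in> sec F \<tau>" for \<sigma> \<tau> t
    using qc that unfolding quasi_coherent_def by blast
  have trans: "restr F \<tau> \<upsilon> (restr F \<sigma> \<tau> s) = restr F \<sigma> \<upsilon> s"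
    if "\<sigma> \<in> \<Sigma>" "\<tau> \<in> \<Sigma>" "\<upsilon> \<in> \<Sigma>" "\<upsilon> \<subseteq> \<tau>" "\<tau> \<subseteq> \<sigma>" "s \<in> sec F \<sigma>" for \<sigma> \<tau> \<upsilon> s
    using qc that unfolding quasi_coherent_def by blast
  note o = fan_zero[OF sf]
  note z = zero_subset[OF sf]
  have one: "1 \<in> R" using R by (simp add: ring_subset_def)
  obtain N lam where lmem: "\<forall>s\<in>sec F {0}. \<forall>m e. coef (lam s) m e \<in> R \<and> (N \<le> e \<longrightarrow> lam s e = 0)"
    and ladd: "\<forall>s\<in>sec F {0}. \<forall>t\<in>sec F {0}. lam (s \<oplus>\<^bsub>sections F {0}\<^esub> t) = (\<lambda>e. lam s e + lam t e)"
    and lsm: "\<forall>f\<in>carrier (chart_ring R {0}). \<forall>s\<in>sec F {0}. lam (f \<odot>\<^bsub>sections F {0}\<^esub> s) = (\<lambda>e. f * lam s e)"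
    and lgr: "\<forall>s\<in>sec F {0}. \<forall>m. lam (c {0} m s) = mono_vec m (coef (lam s) m)"
    and linj: "\<forall>s\<in>sec F {0}. lam s = (\<lambda>_. 0) \<longrightarrow> s = \<zero>\<^bsub>sections F {0}\<^esub>"
    using chart_module.graded_embedding[OF cm[OF o] lf[OF o] fg[OF o] co[OF o]]
    by (elim exE conjE) (rule that)
  define \<Lambda> where "\<Lambda> \<sigma> s = lam (restr F \<sigma> {0} s)" for \<sigma> s
  define Z where "Z \<sigma> = \<Lambda> \<sigma> ` sec F \<sigma>" for \<sigma>
  have closed: "restr F \<sigma> {0} s \<in> sec F {0}" if "\<sigma> \<in> \<Sigma>" "s \<in> sec F \<sigma>" for \<sigma> s
    using hom[OF that(1) o z[OF that(1)]] that(2) by (auto simp: module_hom_def)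
  have add: "\<Lambda> \<sigma> (s \<oplus>\<^bsub>sections F \<sigma>\<^esub> t) = (\<lambda>e. \<Lambda> \<sigma> s e + \<Lambda> \<sigma> t e)"
    if s: "\<sigma> \<in> \<Sigma>" and st: "s \<in> sec F \<sigma>" "t \<in> sec F \<sigma>" for \<sigma> s t
    using hom[OF s o z[OF s]] st ladd closed[OF s st(1)] closed[OF s st(2)]
      by (simp add: module_hom_def \<Lambda>_def)
  have smult: "\<Lambda> \<sigma> (f \<odot>\<^bsub>sections F \<sigma>\<^esub> s) = (\<lambda>e. f * \<Lambda> \<sigma> s e)"
    if s: "\<sigma> \<in> \<Sigma>" and f: "f \<in> carrier (chart_ring R \<sigma>)" and sec: "s \<in> sec F \<sigma>" for \<sigma> f s
  proof -
    have "restr F \<sigma> {0} (f \<odot>\<^bsub>sections F \<sigma>\<^esub> s) = f \<odot>\<^bsub>sections F {0}\<^esub> restr F \<sigma> {0} s"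
      using hom[OF s o z[OF s]] f sec by (simp add: module_hom_def)
    moreover have "f \<in> carrier (chart_ring R {0})" using chart_ring_antimono[OF z[OF s]] f by blast
    ultimately show ?thesis using lsm closed[OF s sec] by (simp add: \<Lambda>_def)
  qed
  have graded: "\<Lambda> \<sigma> (c \<sigma> m s) = mono_vec m (coef (\<Lambda> \<sigma> s) m)" if s: "\<sigma> \<in> \<Sigma>" and sec: "s \<in> sec F \<sigma>" for \<sigma> m s
    using co_restr[OF s o z[OF s] sec, of m] lgr closed[OF s sec] by (metis \<Lambda>_def)
  have csec: "c \<sigma> m s \<in> sec F \<sigma>" if "\<sigma> \<in> \<Sigma>" "s \<in> sec F \<sigma>" for \<sigma> m s
    by (rule chart_module.coaction_closed[OF cm[OF that(1)] co[OF that(1)] that(2)])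
  have compat: "\<Lambda> \<tau> (restr F \<sigma> \<tau> s) = \<Lambda> \<sigma> s" if "\<sigma> \<in> \<Sigma>" "\<tau> \<in> \<Sigma>" "\<tau> \<subseteq> \<sigma>" "s \<in> sec F \<sigma>" for \<sigma> \<tau> s
    using trans[OF that(1,2) o z[OF that(2)] that(3,4)] by (simp add: \<Lambda>_def)
  have inj: "inj_on (\<Lambda> \<sigma>) (sec F \<sigma>)" if s: "\<sigma> \<in> \<Sigma>" for \<sigma>
  proof -
    interpret chart_module R \<sigma> "sections F \<sigma>" by (rule cm[OF s])
    show ?thesis
    proof (rule hom_inj_on[OF add[OF s]])
      fix t assume t: "t \<in> sec F \<sigma>" and "\<Lambda> \<sigma> t = (\<lambda>_. 0)"
      then have "restr F \<sigma> {0} t = \<zero>\<^bsub>sections F {0}\<^esub>" using linj closed[OF s t] by (simp add: \<Lambda>_def)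
      then obtain m where m: "m \<in> inverted_chars \<sigma> {0}" "char m \<odot>\<^bsub>sections F \<sigma>\<^esub> t = \<zero>\<^bsub>sections F \<sigma>\<^esub>"
        using ker[OF s o z[OF s] t] by blast
      have "char m \<in> carrier (chart_ring R \<sigma>)"
        using m one by (intro single_in_chart_ring[OF R]) (auto simp: inverted_chars_def)
      moreover have "char m \<noteq> 0" by (metis keys_single keys_zero insert_not_empty zero_neq_one)
      ultimately show "t = \<zero>\<^bsub>sections F \<sigma>\<^esub>" using torsion_free[OF lf[OF s] _ _ t m(2)] by blast
    qed
  qed
  define gens where "gens \<sigma> G \<longleftrightarrow> finite G \<and> G \<subseteq> sec F \<sigma> \<and>
    (\<forall>s\<in>sec F \<sigma>. \<exists>b \<in> G \<rightarrow> carrier (chart_ring R \<sigma>). s = (\<Oplus>\<^bsub>sections F \<sigma>\<^esub>g\<in>G. b g \<odot>\<^bsub>sections F \<sigma>\<^esub> g))" for \<sigma> G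
  have "\<exists>G. gens \<sigma> G" if "\<sigma> \<in> \<Sigma>" for \<sigma>
    using fg[OF that] unfolding gens_def finitely_generated_def .
  then obtain G where gens: "\<And>\<sigma>. \<sigma> \<in> \<Sigma> \<Longrightarrow> gens \<sigma> (G \<sigma>)" by metis
  \<comment> \<open>Homogeneous components of the images of the generators, listed only in the
    finitely many degrees that occur.\<close>
  define B where "B \<sigma> = (\<Union>g\<in>G \<sigma>. (\<lambda>d. (d, coef (\<Lambda> \<sigma> g) d)) ` (\<Union>e\<in>{..<N}. Poly_Mapping.keys (\<Lambda> \<sigma> g e)))" for \<sigma>
  have supp: "\<Lambda> \<sigma> s e = 0" if "\<sigma> \<in> \<Sigma>" "s \<in> sec F \<sigma>" "N \<le> e" for \<sigma> s e
    using lmem closed[OF that(1,2)] that(3) by (simp add: \<Lambda>_def)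
  have "graded_family R \<Sigma> N Z B"
  proof (rule graded_family.intro[OF R sf])
    fix \<sigma> assume s: "\<sigma> \<in> \<Sigma>"
    interpret chart_module R \<sigma> "sections F \<sigma>" by (rule cm[OF s])
    have zero: "\<Lambda> \<sigma> \<zero>\<^bsub>sections F \<sigma>\<^esub> = (\<lambda>_. 0)"
      using add[OF s, of "\<zero>\<^bsub>sections F \<sigma>\<^esub>" "\<zero>\<^bsub>sections F \<sigma>\<^esub>"] by (simp add: fun_eq_iff)
    show "\<And>x m e. x \<in> Z \<sigma> \<Longrightarrow> coef x m e \<in> R"
      using lmem closed[OF s] by (auto simp: Z_def \<Lambda>_def)
    show "\<And>x e. x \<in> Z \<sigma> \<Longrightarrow> N \<le> e \<Longrightarrow> x e = 0"
      using supp[OF s] by (auto simp: Z_def)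
    show "(\<lambda>_. 0) \<in> Z \<sigma>" unfolding Z_def using zero by (intro image_eqI[of _ _ "\<zero>\<^bsub>sections F \<sigma>\<^esub>"]) auto
    show "(\<lambda>e. x e + y e) \<in> Z \<sigma>" if x: "x \<in> Z \<sigma>" and y: "y \<in> Z \<sigma>" for x y
    proof -
      obtain s t where "s \<in> sec F \<sigma>" "t \<in> sec F \<sigma>" "x = \<Lambda> \<sigma> s" "y = \<Lambda> \<sigma> t"
        using x y by (auto simp: Z_def)
      then show ?thesis unfolding Z_def using add[OF s]
        by (intro image_eqI[of _ _ "s \<oplus>\<^bsub>sections F \<sigma>\<^esub> t"]) auto
    qed
    show "(\<lambda>e. Poly_Mapping.single k r * x e) \<in> Z \<sigma>" if x: "x \<in> Z \<sigma>" and k: "k \<in> dual_monoid \<sigma>" and r: "r \<in> R" for x k r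
    proof -
      obtain t where t: "t \<in> sec F \<sigma>" "x = \<Lambda> \<sigma> t" using x by (auto simp: Z_def)
      have "Poly_Mapping.single k r \<in> carrier (chart_ring R \<sigma>)" by (rule single_in_chart_ring[OF R r k])
      then show ?thesis unfolding Z_def using smult[OF s] t
        by (intro image_eqI[of _ _ "Poly_Mapping.single k r \<odot>\<^bsub>sections F \<sigma>\<^esub> t"]) auto
    qed
    show gr: "mono_vec m (coef x m) \<in> Z \<sigma>" if x: "x \<in> Z \<sigma>" for x m
    proof -
      obtain t where t: "t \<in> sec F \<sigma>" "x = \<Lambda> \<sigma> t" using x by (auto simp: Z_def)
      then have "mono_vec m (coef x m) = \<Lambda> \<sigma> (c \<sigma> m t)" using graded[OF s] by simp
      then show ?thesis unfolding Z_def using csec[OF s t(1)] by blast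
    qed
    show "finite (B \<sigma>)" unfolding B_def using gens[OF s] by (auto simp: gens_def)
    have G: "finite (G \<sigma>)" "G \<sigma> \<subseteq> sec F \<sigma>"
      and gen: "\<forall>s\<in>sec F \<sigma>. \<exists>b \<in> G \<sigma> \<rightarrow> carrier (chart_ring R \<sigma>). s = (\<Oplus>\<^bsub>sections F \<sigma>\<^esub>g\<in>G \<sigma>. b g \<odot>\<^bsub>sections F \<sigma>\<^esub> g)"
      using gens[OF s] unfolding gens_def by blast+
    show "mono_vec d b \<in> Z \<sigma>" if "(d, b) \<in> B \<sigma>" for d b
      using that gr G by (auto simp: B_def Z_def)
    show "coef x m \<in> lin_span R {b. \<exists>d. (d, b) \<in> B \<sigma> \<and> m - d \<in> dual_monoid \<sigma>}" if x: "x \<in> Z \<sigma>" for x m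
    proof -
      let ?L = "\<lambda>m. lin_span R {b. \<exists>d. (d, b) \<in> B \<sigma> \<and> m - d \<in> dual_monoid \<sigma>}"
      let ?P = "\<lambda>s. \<forall>m. coef (\<Lambda> \<sigma> s) m \<in> ?L m"
      have P0: "?P \<zero>\<^bsub>sections F \<sigma>\<^esub>" by (simp add: zero coef_zero lin_span.zero)
      have Padd: "?P (s \<oplus>\<^bsub>sections F \<sigma>\<^esub> t)" if "s \<in> sec F \<sigma>" "t \<in> sec F \<sigma>" "?P s" "?P t" for s t
        using that by (simp add: add[OF s] coef_add lin_span_add)
      obtain t where t: "t \<in> sec F \<sigma>" "x = \<Lambda> \<sigma> t" using x by (auto simp: Z_def)
      have "?P t"
      proof (rule generated_induct[OF G gen t(1), where P = ?P])
        fix g assume g: "g \<in> G \<sigma>"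
        then have gs: "g \<in> sec F \<sigma>" using G by blast
        show "?P g"
        proof
          fix m show "coef (\<Lambda> \<sigma> g) m \<in> ?L m"
          proof (cases "coef (\<Lambda> \<sigma> g) m = (\<lambda>_. 0)")
            case True
            then show ?thesis by (simp add: lin_span.zero)
          next
            case False
            then obtain e where e: "Poly_Mapping.lookup (\<Lambda> \<sigma> g e) m \<noteq> 0"
              by (auto simp: coef_def fun_eq_iff)
            then have "e < N" using supp[OF s gs, of e] by (cases "N \<le> e") auto
            then have "m \<in> (\<Union>e\<in>{..<N}. Poly_Mapping.keys (\<Lambda> \<sigma> g e))" using e by (auto simp: in_keys_iff)
            then have "(m, coef (\<Lambda> \<sigma> g) m) \<in> B \<sigma>" using g unfolding B_def by blast
            then show ?thesis
              by (intro lin_span_base[OF R]) (auto simp: zero_in_dual_monoid intro!: exI[of _ m])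
          qed
        qed
      next
        fix f u assume f: "f \<in> carrier (chart_ring R \<sigma>)" and u: "u \<in> sec F \<sigma>" and Pu: "?P u"
        show "?P (f \<odot>\<^bsub>sections F \<sigma>\<^esub> u)"
        proof (rule smult_induct[OF f u, where P = ?P])
          fix k r v assume k: "k \<in> dual_monoid \<sigma>" and r: "r \<in> R" and v: "v \<in> sec F \<sigma>" and Pv: "?P v"
          show "?P (Poly_Mapping.single k r \<odot>\<^bsub>sections F \<sigma>\<^esub> v)"
          proof
            fix m
            have "(\<lambda>e. r * coef (\<Lambda> \<sigma> v) (m - k) e) \<in> ?L (m - k)" using Pv r
              by (intro lin_span_scale[OF R]) auto
            moreover have "{b. \<exists>d. (d, b) \<in> B \<sigma> \<and> m - k - d \<in> dual_monoid \<sigma>} \<subseteq>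
                {b. \<exists>d. (d, b) \<in> B \<sigma> \<and> m - d \<in> dual_monoid \<sigma>}"
            proof clarify
              fix b d assume "(d, b) \<in> B \<sigma>" "m - k - d \<in> dual_monoid \<sigma>"
              then have "k + (m - k - d) \<in> dual_monoid \<sigma>" using k by (intro dual_monoid_add)
              then show "\<exists>d. (d, b) \<in> B \<sigma> \<and> m - d \<in> dual_monoid \<sigma>" using \<open>(d, b) \<in> B \<sigma>\<close>
                by (auto intro!: exI[of _ d])
            qed
            ultimately have "(\<lambda>e. r * coef (\<Lambda> \<sigma> v) (m - k) e) \<in> ?L m" by (rule lin_span_mono[rotated])
            then show "coef (\<Lambda> \<sigma> (Poly_Mapping.single k r \<odot>\<^bsub>sections F \<sigma>\<^esub> v)) m \<in> ?L m"
              by (simp add: smult[OF s single_in_chart_ring[OF R r k] v] coef_single_mult)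
          qed
        qed (use Pu P0 Padd in blast)+
      qed (use P0 Padd in blast)+
      then show ?thesis using t by simp
    qed
  next
    fix \<sigma> \<tau> assume st: "\<sigma> \<in> \<Sigma>" "\<tau> \<in> \<Sigma>" "\<tau> \<subseteq> \<sigma>"
    have rs: "restr F \<sigma> \<tau> s \<in> sec F \<tau>" if "s \<in> sec F \<sigma>" for s
      using hom[OF st] that by (auto simp: module_hom_def)
    show "Z \<sigma> \<subseteq> Z \<tau>"
    proof
      fix x assume "x \<in> Z \<sigma>"
      then obtain s where s: "s \<in> sec F \<sigma>" "x = \<Lambda> \<sigma> s" by (auto simp: Z_def)
      then show "x \<in> Z \<tau>"
        unfolding Z_def using compat[OF st s(1)] rs[OF s(1)]
          by (intro image_eqI[of _ _ "restr F \<sigma> \<tau> s"]) auto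
    qed
    fix x assume "x \<in> Z \<tau>"
    then obtain t where t: "t \<in> sec F \<tau>" "x = \<Lambda> \<tau> t" by (auto simp: Z_def)
    obtain k s where k: "k \<in> inverted_chars \<sigma> \<tau>" and s: "s \<in> sec F \<sigma>"
      and eq: "char k \<odot>\<^bsub>sections F \<tau>\<^esub> t = restr F \<sigma> \<tau> s"
      using local[OF st t(1)] by blast
    have "k \<in> dual_monoid \<tau>" using k dual_monoid_antimono[OF st(3)] by (auto simp: inverted_chars_def)
    then have "(\<lambda>e. char k * x e) = \<Lambda> \<tau> (char k \<odot>\<^bsub>sections F \<tau>\<^esub> t)"
      using smult[OF st(2) single_in_chart_ring[OF R one] t(1)] t(2) by simp
    also have "\<dots> = \<Lambda> \<sigma> s" unfolding eq by (rule compat[OF st s])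
    finally show "\<exists>k\<in>inverted_chars \<sigma> \<tau>. (\<lambda>e. char k * x e) \<in> Z \<sigma>"
      using k s by (intro bexI[of _ k]) (auto simp: Z_def)
  qed
  then show ?thesis
    using inj add smult compat
    by (intro exI[of _ N] exI[of _ Z] exI[of _ B] exI[of _ \<Lambda>]) (auto simp: bij_betw_def Z_def)
qed

section \<open>The resolution\<close>

lemma mat_map_add: "mat_map n A (\<lambda>j. x j + y j) = (\<lambda>i. mat_map n A x i + mat_map n A y i)"
  by (simp add: mat_map_def distrib_left sum.distrib)

lemma mat_map_smult: "mat_map n A (\<lambda>j. f * x j) = (\<lambda>i. f * mat_map n A x i)"
  by (simp add: mat_map_def sum_distrib_left mult.left_commute)

lemma mat_map_eq_zero: "mat_map n A x = (\<lambda>_. 0) \<longleftrightarrow> (\<forall>m. mat_app n A (coef x m) = (\<lambda>_. 0))"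
proof
  assume "\<forall>m. mat_app n A (coef x m) = (\<lambda>_. 0)"
  then show "mat_map n A x = (\<lambda>_. 0)" by (intro coef_eqI) (simp add: coef_mat_map coef_zero)
next
  assume "mat_map n A x = (\<lambda>_. 0)"
  then show "\<forall>m. mat_app n A (coef x m) = (\<lambda>_. 0)" by (simp add: coef_zero flip: coef_mat_map)
qed

text \<open>A monomial of degree \<open>m\<close> in entry \<open>j\<close> satisfies the conditions
  of the divisor \<open>- d j\<close> exactly when its degree along the rays is at least
  \<open>d j\<close>; \<open>box_le_clamp\<close> rewrites this as the order relation that defines
  \<open>free_at\<close>.\<close>

lemma sec_sum_sheaf_box:
  fixes \<Sigma> :: "(real ^ 'n::finite) set set"
  assumes R: "ring_subset R" and s: "\<sigma> \<in> \<Sigma>" and d: "\<And>j. j < n \<Longrightarrow> d j \<in> box \<Sigma> L U"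
  shows "sec (sum_sheaf R {..<n} (\<lambda>j u. - d j u)) \<sigma> =
    family_sections (box_part \<Sigma> L U (free_at R n d) \<sigma>)"
proof (intro equalityI subsetI)
  fix x assume x: "x \<in> sec (sum_sheaf R {..<n} (\<lambda>j u. - d j u)) \<sigma>"
  have R0: "0 \<in> R" using R by (simp add: ring_subset_def)
  have c: "coef x m j \<in> R \<and> (coef x m j \<noteq> 0 \<longrightarrow> j < n \<and> (\<forall>u\<in>ray_gens \<sigma>. d j u \<le> ipair m u))" for m j
    using x R0 by (cases "j < n") (auto simp: sec_sum_sheaf dsec_def coef_def)
  have "coef x m \<in> box_part \<Sigma> L U (free_at R n d) \<sigma> m" for m
    using c[of m] box_le_clamp[OF s d, of _ m] unfolding box_part_def free_at_def
      by (auto simp: fun_eq_iff)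
  then show "x \<in> family_sections (box_part \<Sigma> L U (free_at R n d) \<sigma>)" by (simp add: family_sections_def)
next
  fix x assume "x \<in> family_sections (box_part \<Sigma> L U (free_at R n d) \<sigma>)"
  then have x: "coef x m \<in> box_part \<Sigma> L U (free_at R n d) \<sigma> m" for m by (simp add: family_sections_def)
  have c: "Poly_Mapping.lookup (x j) m \<in> R \<and>
      (Poly_Mapping.lookup (x j) m \<noteq> 0 \<longrightarrow> j < n \<and> (\<forall>u\<in>ray_gens \<sigma>. d j u \<le> ipair m u))" for m j
  proof (cases "good_degree L \<sigma> m")
    case True
    then have "coef x m j \<in> R \<and> (coef x m j \<noteq> 0 \<longrightarrow> j < n \<and> d j \<le> clamp_degree \<Sigma> U \<sigma> m)"
      using x[of m] by (simp add: box_part_def free_at_def)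
    then show ?thesis using box_le_clamp[OF s d, of j m] True by (auto simp: coef_def)
  next
    case False
    then show ?thesis using x[of m] R by (simp add: box_part_def ring_subset_def coef_def fun_eq_iff)
  qed
  have "x j = 0" if "\<not> j < n" for j
    by (rule poly_mapping_eqI) (use c[of j] that in auto)
  then show "x \<in> sec (sum_sheaf R {..<n} (\<lambda>j u. - d j u)) \<sigma>"
    using c by (auto simp: sec_sum_sheaf dsec_def)
qed

theorem proposition1p5:
  fixes R :: "complex set" and \<Sigma> :: "(real ^ 'n::finite) set set"
    and F :: "('n, 'a) sheaf" and c :: "(real ^ 'n) set \<Rightarrow> int ^ 'n \<Rightarrow> 'a \<Rightarrow> 'a"
  assumes "base_ring R"
    and "smooth_fan \<Sigma>" and "projective_fan \<Sigma>"
    and "vector_bundle R \<Sigma> F" and "equivariant_structure R \<Sigma> F c"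
  shows "\<exists>(E :: nat \<Rightarrow> ('n, nat \<Rightarrow> 'n laurent) sheaf) h d \<epsilon>. canonically_metrized R \<Sigma> F E h d \<epsilon>"
proof -
  note sf = assms(2)
  have pid: "pid_subset R" by (rule base_ring_imp_pid_subset[OF assms(1)])
  then have R: "ring_subset R" by (simp add: pid_subset_def)
  obtain N Z B \<Lambda> where gf: "graded_family R \<Sigma> N Z B"
    and \<Lambda>: "\<forall>\<sigma>\<in>\<Sigma>. bij_betw (\<Lambda> \<sigma>) (sec F \<sigma>) (Z \<sigma>) \<and>
      (\<forall>s\<in>sec F \<sigma>. \<forall>t\<in>sec F \<sigma>. \<Lambda> \<sigma> (s \<oplus>\<^bsub>sections F \<sigma>\<^esub> t) = (\<lambda>e. \<Lambda> \<sigma> s e + \<Lambda> \<sigma> t e)) \<and>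
      (\<forall>f\<in>carrier (chart_ring R \<sigma>). \<forall>s\<in>sec F \<sigma>. \<Lambda> \<sigma> (f \<odot>\<^bsub>sections F \<sigma>\<^esub> s) = (\<lambda>e. f * \<Lambda> \<sigma> s e))"
    and compat: "\<forall>\<sigma>\<in>\<Sigma>. \<forall>\<tau>\<in>\<Sigma>. \<tau> \<subseteq> \<sigma> \<longrightarrow> (\<forall>s\<in>sec F \<sigma>. \<Lambda> \<tau> (restr F \<sigma> \<tau> s) = \<Lambda> \<sigma> s)"
    using equivariant_bundle_embedding[OF R sf assms(4,5)] by (elim exE conjE) (rule that)
  interpret graded_family R \<Sigma> N Z B by (rule gf)
  obtain L U where LU: "L \<le> U" and Z: "\<forall>\<sigma>\<in>\<Sigma>. Z \<sigma> = family_sections (box_part \<Sigma> L U box_module \<sigma>)"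
    using family_is_box_family by (elim exE conjE) (rule that)
  have sub: "\<forall>p\<in>box \<Sigma> L U. submod R N (box_module p)"
    and mono: "\<forall>p\<in>box \<Sigma> L U. \<forall>q\<in>box \<Sigma> L U. p \<le> q \<longrightarrow> box_module p \<subseteq> box_module q"
    using submod_box_module box_module_mono by blast+
  obtain n :: "nat \<Rightarrow> nat" and d A l
    where dP: "\<And>i j. j < n i \<Longrightarrow> d i j \<in> box \<Sigma> L U"
    and im0: "\<And>p. p \<in> box \<Sigma> L U \<Longrightarrow> mat_app (n 0) (A 0) ` free_at R (n 0) (d 0) p = box_module p"
    and imS: "\<And>i p. p \<in> box \<Sigma> L U \<Longrightarrow> mat_app (n (Suc i)) (A (Suc i)) ` free_at R (n (Suc i)) (d (Suc i)) p =
      {v \<in> free_at R (n i) (d i) p. mat_app (n i) (A i) v = (\<lambda>_. 0)}"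
    and fin: "\<And>i. i > l \<Longrightarrow> n i = 0"
    by (rule filtered_resolution[OF pid finite_box[OF sf] sub mono]) (rule that)
  define E :: "nat \<Rightarrow> ('n, nat \<Rightarrow> 'n laurent) sheaf"
    where "E i = sum_sheaf R {..<n i} (\<lambda>j u. - d i j u)" for i
  define D :: "nat \<Rightarrow> (real ^ 'n) set \<Rightarrow> (nat \<Rightarrow> 'n laurent) \<Rightarrow> nat \<Rightarrow> 'n laurent"
    where "D i \<sigma> = mat_map (n (Suc i)) (A (Suc i))" for i \<sigma>
  \<comment> \<open>\<open>filtered_resolution\<close> resolves the embedded copy
    \<open>Z \<sigma>\<close>; the augmentation to \<open>F\<close> inverts the embedding.\<close>
  define \<epsilon> where "\<epsilon> \<sigma> x = inv_into (sec F \<sigma>) (\<Lambda> \<sigma>) (mat_map (n 0) (A 0) x)" for \<sigma> x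
  let ?part = "\<lambda>i. box_part \<Sigma> L U (free_at R (n i) (d i))"
  have secE: "sec (E i) \<sigma> = family_sections (?part i \<sigma>)" if "\<sigma> \<in> \<Sigma>" for i \<sigma>
    unfolding E_def by (rule sec_sum_sheaf_box[OF R that dP])
  have zero_free: "(\<lambda>_. 0) \<in> free_at R k b p" for k p and b :: "nat \<Rightarrow> 'n divisor"
    using R by (simp add: free_at_def ring_subset_def)
  have zero_part: "(\<lambda>_. 0) \<in> ?part i \<sigma> m" for i \<sigma> m
    using zero_free by (simp add: box_part_def)
  have image0: "mat_map (n 0) (A 0) ` sec (E 0) \<sigma> = Z \<sigma>" if s: "\<sigma> \<in> \<Sigma>" for \<sigma>
    unfolding secE[OF s] bspec[OF Z s]
  proof (rule family_sections_image[where N = N])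
    fix m
    show "mat_app (n 0) (A 0) ` ?part 0 \<sigma> m = box_part \<Sigma> L U box_module \<sigma> m"
      using im0[OF clamp_degree_in_box[OF LU s]] by (simp add: box_part_def mat_app_def)
    fix v e assume "v \<in> box_part \<Sigma> L U box_module \<sigma> m" "N \<le> e"
    then show "v e = 0" by (auto simp: box_part_def box_module_def split: if_splits)
  qed (rule zero_part)
  have imageS: "D i \<sigma> ` sec (E (Suc i)) \<sigma> = {x \<in> sec (E i) \<sigma>. mat_map (n i) (A i) x = (\<lambda>_. 0)}"
    if s: "\<sigma> \<in> \<Sigma>" for i \<sigma>
  proof -
    \<comment> \<open>The kernel is graded as well. In good degrees its parts are the images
      supplied by \<open>imS\<close> at the truncated degree; in the others both sides are
      zero.\<close>
    let ?K = "\<lambda>m. {v \<in> ?part i \<sigma> m. mat_app (n i) (A i) v = (\<lambda>_. 0)}"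
    have "D i \<sigma> ` sec (E (Suc i)) \<sigma> = family_sections ?K"
      unfolding secE[OF s] D_def
    proof (rule family_sections_image[where N = "n i"])
      fix m
      show "mat_app (n (Suc i)) (A (Suc i)) ` ?part (Suc i) \<sigma> m = ?K m"
      proof (cases "good_degree L \<sigma> m")
        case True
        then show ?thesis using imS[OF clamp_degree_in_box[OF LU s True]] by (simp add: box_part_def)
      next
        case False
        then show ?thesis by (auto simp: box_part_def mat_app_def)
      qed
      fix v e assume "v \<in> ?K m" "n i \<le> e"
      then show "v e = 0" by (auto simp: box_part_def free_at_def split: if_splits)
    qed (rule zero_part)
    also have "\<dots> = {x \<in> sec (E i) \<sigma>. mat_map (n i) (A i) x = (\<lambda>_. 0)}"
      unfolding secE[OF s] mat_map_eq_zero by (auto simp: family_sections_def)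
    finally show ?thesis .
  qed
  have \<epsilon>: "\<epsilon> \<sigma> x \<in> sec F \<sigma>" "\<Lambda> \<sigma> (\<epsilon> \<sigma> x) = mat_map (n 0) (A 0) x"
    if s: "\<sigma> \<in> \<Sigma>" and x: "x \<in> sec (E 0) \<sigma>" for \<sigma> x
  proof -
    have "mat_map (n 0) (A 0) x \<in> \<Lambda> \<sigma> ` sec F \<sigma>"
      using image0[OF s] x \<Lambda> s unfolding bij_betw_def by blast
    then show "\<epsilon> \<sigma> x \<in> sec F \<sigma>" "\<Lambda> \<sigma> (\<epsilon> \<sigma> x) = mat_map (n 0) (A 0) x"
      unfolding \<epsilon>_def by (rule inv_into_into, rule f_inv_into_f)
  qed
  \<comment> \<open>Identities in \<open>F\<close> are checked after applying \<Lambda>, where they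
    become identities between vectors of Laurent polynomials.\<close>
  have inj: "s = t" if "\<sigma> \<in> \<Sigma>" "s \<in> sec F \<sigma>" "t \<in> sec F \<sigma>" "\<Lambda> \<sigma> s = \<Lambda> \<sigma> t" for \<sigma> s t
    using \<Lambda> that unfolding bij_betw_def inj_on_def by blast
  have qc: "quasi_coherent R \<Sigma> F" using assms(4) by (simp add: vector_bundle_def coherent_def)
  have cm: "chart_module R \<sigma> (sections F \<sigma>)" if "\<sigma> \<in> \<Sigma>" for \<sigma>
    using qc that R by (auto simp: chart_module_def quasi_coherent_def)
  have Esimps: "add (sections (E i) \<sigma>) = (\<lambda>x y j. x j + y j)" "zero (sections (E i) \<sigma>) = (\<lambda>_. 0)"
    "smult (sections (E i) \<sigma>) = (\<lambda>f x j. f * x j)" "restr (E i) \<sigma> \<tau> x = x" for i \<sigma> \<tau> x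
    by (simp_all add: E_def)
  have Emod: "Module.module (chart_ring R \<sigma>) (sections (E i) \<sigma>)" if "\<sigma> \<in> \<Sigma>" for i \<sigma>
    using quasi_coherent_sum_sheaf[OF R sf finite_lessThan] that by (simp add: E_def quasi_coherent_def)
  have Eadd: "(\<lambda>j. x j + y j) \<in> sec (E i) \<sigma>" if "\<sigma> \<in> \<Sigma>" "x \<in> sec (E i) \<sigma>" "y \<in> sec (E i) \<sigma>" for i \<sigma> x y
    using that by (auto simp: E_def sec_sum_sheaf dsec_add[OF R sf])
  have Esmult: "(\<lambda>j. f * x j) \<in> sec (E i) \<sigma>"
    if "\<sigma> \<in> \<Sigma>" "f \<in> carrier (chart_ring R \<sigma>)" "x \<in> sec (E i) \<sigma>" for i \<sigma> f x
    using that by (auto simp: E_def sec_sum_sheaf dsec_smult[OF R sf])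
  have Erestr: "x \<in> sec (E i) \<tau>" if "\<sigma> \<in> \<Sigma>" "\<tau> \<in> \<Sigma>" "\<tau> \<subseteq> \<sigma>" "x \<in> sec (E i) \<sigma>" for i \<sigma> \<tau> x
    using that dsec_antimono[OF R sf that(1-3)] by (auto simp: E_def sec_sum_sheaf subset_iff)
  have hom0: "\<epsilon> \<in> sheaf_hom R \<Sigma> (E 0) F"
    unfolding sheaf_hom_def module_hom_def
  proof (intro CollectI conjI ballI impI)
    fix \<sigma> assume s: "\<sigma> \<in> \<Sigma>"
    interpret FM: chart_module R \<sigma> "sections F \<sigma>" by (rule cm[OF s])
    show "\<epsilon> \<sigma> \<in> sec (E 0) \<sigma> \<rightarrow> sec F \<sigma>" using \<epsilon>(1)[OF s] by auto
    show "\<epsilon> \<sigma> (x \<oplus>\<^bsub>sections (E 0) \<sigma>\<^esub> y) = \<epsilon> \<sigma> x \<oplus>\<^bsub>sections F \<sigma>\<^esub> \<epsilon> \<sigma> y"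
      if x: "x \<in> sec (E 0) \<sigma>" and y: "y \<in> sec (E 0) \<sigma>" for x y
    proof (rule inj[OF s])
      note xy = Eadd[OF s x y]
      show "\<epsilon> \<sigma> (x \<oplus>\<^bsub>sections (E 0) \<sigma>\<^esub> y) \<in> sec F \<sigma>" using \<epsilon>(1)[OF s xy] by (simp add: Esimps)
      show "\<epsilon> \<sigma> x \<oplus>\<^bsub>sections F \<sigma>\<^esub> \<epsilon> \<sigma> y \<in> sec F \<sigma>" using \<epsilon>(1)[OF s x] \<epsilon>(1)[OF s y] by simp
      show "\<Lambda> \<sigma> (\<epsilon> \<sigma> (x \<oplus>\<^bsub>sections (E 0) \<sigma>\<^esub> y)) = \<Lambda> \<sigma> (\<epsilon> \<sigma> x \<oplus>\<^bsub>sections F \<sigma>\<^esub> \<epsilon> \<sigma> y)"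
        using \<epsilon>(2)[OF s xy] \<epsilon>[OF s x] \<epsilon>[OF s y] \<Lambda> s by (simp add: Esimps mat_map_add)
    qed
    show "\<epsilon> \<sigma> (f \<odot>\<^bsub>sections (E 0) \<sigma>\<^esub> x) = f \<odot>\<^bsub>sections F \<sigma>\<^esub> \<epsilon> \<sigma> x"
      if f: "f \<in> carrier (chart_ring R \<sigma>)" and x: "x \<in> sec (E 0) \<sigma>" for f x
    proof (rule inj[OF s])
      note fx = Esmult[OF s f x]
      show "\<epsilon> \<sigma> (f \<odot>\<^bsub>sections (E 0) \<sigma>\<^esub> x) \<in> sec F \<sigma>" using \<epsilon>(1)[OF s fx] by (simp add: Esimps)
      show "f \<odot>\<^bsub>sections F \<sigma>\<^esub> \<epsilon> \<sigma> x \<in> sec F \<sigma>" using \<epsilon>(1)[OF s x] f by simp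
      show "\<Lambda> \<sigma> (\<epsilon> \<sigma> (f \<odot>\<^bsub>sections (E 0) \<sigma>\<^esub> x)) = \<Lambda> \<sigma> (f \<odot>\<^bsub>sections F \<sigma>\<^esub> \<epsilon> \<sigma> x)"
        using \<epsilon>(2)[OF s fx] \<epsilon>[OF s x] \<Lambda> s f by (simp add: Esimps mat_map_smult)
    qed
  next
    fix \<sigma> \<tau> x assume st: "\<sigma> \<in> \<Sigma>" "\<tau> \<in> \<Sigma>" "\<tau> \<subseteq> \<sigma>" and x: "x \<in> sec (E 0) \<sigma>"
    note x' = Erestr[OF st x]
    show "\<epsilon> \<tau> (restr (E 0) \<sigma> \<tau> x) = restr F \<sigma> \<tau> (\<epsilon> \<sigma> x)"
    proof (rule inj[OF st(2)])
      show "\<epsilon> \<tau> (restr (E 0) \<sigma> \<tau> x) \<in> sec F \<tau>" using \<epsilon>(1)[OF st(2) x'] by (simp add: Esimps)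
      have "restr F \<sigma> \<tau> \<in> module_hom (chart_ring R \<sigma>) (sections F \<sigma>) (sections F \<tau>)"
        using qc st unfolding quasi_coherent_def by blast
      then show "restr F \<sigma> \<tau> (\<epsilon> \<sigma> x) \<in> sec F \<tau>" using \<epsilon>(1)[OF st(1) x] by (auto simp: module_hom_def)
      show "\<Lambda> \<tau> (\<epsilon> \<tau> (restr (E 0) \<sigma> \<tau> x)) = \<Lambda> \<tau> (restr F \<sigma> \<tau> (\<epsilon> \<sigma> x))"
        using \<epsilon>(2)[OF st(2) x'] \<epsilon>[OF st(1) x] compat st by (simp add: Esimps)
    qed
  qed
  have homD: "D i \<in> sheaf_hom R \<Sigma> (E (Suc i)) (E i)" for i
    unfolding sheaf_hom_def module_hom_def
  proof (intro CollectI conjI ballI impI)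
    fix \<sigma> assume s: "\<sigma> \<in> \<Sigma>"
    show "D i \<sigma> \<in> sec (E (Suc i)) \<sigma> \<rightarrow> sec (E i) \<sigma>" using imageS[OF s, of i] by blast
  qed (simp_all add: Esimps D_def mat_map_add mat_map_smult)
  have eps_zero: "\<epsilon> \<sigma> x = \<zero>\<^bsub>sections F \<sigma>\<^esub> \<longleftrightarrow> mat_map (n 0) (A 0) x = (\<lambda>_. 0)"
    if s: "\<sigma> \<in> \<Sigma>" and x: "x \<in> sec (E 0) \<sigma>" for \<sigma> x
  proof -
    interpret FM: chart_module R \<sigma> "sections F \<sigma>" by (rule cm[OF s])
    have "\<Lambda> \<sigma> (\<zero>\<^bsub>sections F \<sigma>\<^esub> \<oplus>\<^bsub>sections F \<sigma>\<^esub> \<zero>\<^bsub>sections F \<sigma>\<^esub>) =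
        (\<lambda>e. \<Lambda> \<sigma> \<zero>\<^bsub>sections F \<sigma>\<^esub> e + \<Lambda> \<sigma> \<zero>\<^bsub>sections F \<sigma>\<^esub> e)"
      using \<Lambda> s FM.M.zero_closed by blast
    then have "\<Lambda> \<sigma> \<zero>\<^bsub>sections F \<sigma>\<^esub> = (\<lambda>_. 0)" by (simp add: fun_eq_iff)
    then show ?thesis using inj[OF s \<epsilon>(1)[OF s x] FM.M.zero_closed] \<epsilon>(2)[OF s x] by auto
  qed
  have res: "finite_resolution R \<Sigma> E D \<epsilon> F"
    unfolding finite_resolution_def
  proof (intro conjI allI ballI hom0 homD)
    fix \<sigma> assume s: "\<sigma> \<in> \<Sigma>"
    show "\<epsilon> \<sigma> ` sec (E 0) \<sigma> = sec F \<sigma>"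
    proof (intro equalityI subsetI)
      fix t assume t: "t \<in> sec F \<sigma>"
      then have "\<Lambda> \<sigma> t \<in> Z \<sigma>" using \<Lambda> s unfolding bij_betw_def by blast
      then obtain x where x: "x \<in> sec (E 0) \<sigma>" "\<Lambda> \<sigma> t = mat_map (n 0) (A 0) x"
        using image0[OF s] by blast
      then have "\<epsilon> \<sigma> x = t" using \<epsilon>[OF s x(1)] t by (intro inj[OF s]) auto
      then show "t \<in> \<epsilon> \<sigma> ` sec (E 0) \<sigma>" using x by blast
    qed (use \<epsilon>(1)[OF s] in auto)
    show "D 0 \<sigma> ` sec (E 1) \<sigma> = {x \<in> sec (E 0) \<sigma>. \<epsilon> \<sigma> x = \<zero>\<^bsub>sections F \<sigma>\<^esub>}"
      using imageS[OF s, of 0] eps_zero[OF s] by auto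
    show "D (Suc i) \<sigma> ` sec (E (Suc (Suc i))) \<sigma> = {x \<in> sec (E (Suc i)) \<sigma>. D i \<sigma> x = \<zero>\<^bsub>sections (E i) \<sigma>\<^esub>}" for i
      using imageS[OF s, of "Suc i"] by (simp add: D_def Esimps)
  next
    show "\<exists>l. \<forall>i>l. \<forall>\<sigma>\<in>\<Sigma>. sec (E i) \<sigma> = {\<zero>\<^bsub>sections (E i) \<sigma>\<^esub>}"
      using fin by (intro exI[of _ l]) (auto simp: E_def sec_sum_sheaf)
  qed
  \<comment> \<open>Each term receives its metric separately; nothing has to relate it to the
    differentials.\<close>
  have "\<exists>h. hermitian_vector_bundle R \<Sigma> (E i) h \<and> orthogonal_sum_of_canonical R \<Sigma> (E i) h" for i
    unfolding E_def by (rule sum_sheaf_canonical[OF R sf assms(3)])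
  then obtain h where h: "\<And>i. hermitian_vector_bundle R \<Sigma> (E i) (h i)"
    "\<And>i. orthogonal_sum_of_canonical R \<Sigma> (E i) (h i)" by metis
  have "coherent R \<Sigma> F" using assms(4) by (simp add: vector_bundle_def)
  then have "canonically_metrized R \<Sigma> F E h D \<epsilon>"
    using h res by (simp add: canonically_metrized_def metrized_coherent_sheaf_def)
  then show ?thesis by blast
qed

end
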